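(* Let $\eta>0$, $\alpha>0$, $0<\beta\le1$. The solution (in the transform sense described in the context) of $$\frac{\partial^\beta N(x,t)}{\partial t^\beta}=\eta\;{}_{-\infty}D_x^\alpha N(x,t),\qquad x\in\mathbb{R},\ t>0,$$ with the initial condition $N(x,t=0)=\delta(x)$, where $\delta$ is the Dirac delta function, is given for $x\ne0$, $t>0$ by $$N(x,t)=\frac{1}{\alpha|x|}H^{2,1}_{3,3}\!\left[\frac{|x|}{(\eta t^\beta)^{1/\alpha}}\,\middle|\,\begin{matrix}(1,1/\alpha),(1,\beta/\alpha),(1,1/2)\\(1,1),(1,1/\alpha),(1,1/2)\end{matrix}\right].$$
   Context: Fourier transform in $x$: $\tilde h(k)=\int_{-\infty}^\infty h(x)e^{ikx}\,dx$, with inverse $h(x)=\frac1{2\pi}\int_{-\infty}^\infty\tilde h(k)e^{-ikx}\,dk$ (understood as an improper integral where necessary); $\tilde\delta(k)=1$. $\partial^\beta/\partial t^\beta$ is the Caputo derivative in $t$: for $0<\beta<1$, $D_t^\beta u(t)=\frac{1}{\Gamma(1-\beta)}\int_0^t\frac{u'(\tau)}{(t-\tau)^{\beta}}\,d\tau$, and $D_t^1u=u'$. Its Laplace transform is $s^\beta U(s)-s^{\beta-1}u(0+)$, where $U(s)=\int_0^\infty e^{-st}u(t)\,dt$. ${}_{-\infty}D_x^\alpha$ is the space-fractional operator of order $\alpha$ defined by the convention $\widetilde{({}_{-\infty}D_x^\alpha h)}(k)=-|k|^\alpha\tilde h(k)$. Solution in the transform sense: for each $k\in\mathbb{R}$ the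 Fourier transform $\tilde N(k,t)$ of $N$ in $x$ is continuous in $t\ge 0$, Laplace transformable in $t$, and satisfies $D_t^\beta\tilde N(k,t)=-\eta|k|^\alpha\tilde N(k,t)$, $\tilde N(k,0)=1$, the Laplace transform rule above applying to it; and $N(\cdot,t)$ is the inverse Fourier transform of $\tilde N(\cdot,t)$. $H$-function: for integers $0\le n\le p$, $1\le m\le q$, $A_i,B_j>0$ and $a_i,b_j\in\mathbb{C}$, $$H^{m,n}_{p,q}\!\left[z\,\middle|\,\begin{matrix}(a_1,A_1),\dots,(a_p,A_p)\\(b_1,B_1),\dots,(b_q,B_q)\end{matrix}\right]=\frac1{2\pi i}\int_\Omega\frac{\prod_{j=1}^m\Gamma(b_j+B_j\xi)\prod_{j=1}^n\Gamma(1-a_j-A_j\xi)}{\prod_{j=m+1}^q\Gamma(1-b_j-B_j\xi)\prod_{j=n+1}^p\Gamma(a_j+A_j\xi)}\,z^{-\xi}\,d\xi,$$ empty products being $1$, where the contour $\Omega$ separates the poles of the $\Gamma(b_j+B_j\xi)$, $1\le j\le m$, from those of the $\Gamma(1-a_j-A_j\xi)$, $1\le j\le n$, and is (as convergence requires) a line from $\gamma-i\infty$ to $\gamma+i\infty$ with $\gamma\in\mathbb{R}$, or a loop in a horizontal strip starting and ending at $-\infty$, or such a loop starting and ending at $+\infty$. *)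

theory Defs
  imports "HOL-Complex_Analysis.Complex_Analysis"
begin

text \<open>
  All integrals over unbounded intervals use the gauge integral: \<open>has_integral\<close> over \<open>UNIV\<close>
  (or over \<open>{0..}\<close>) is the improper integral with independent limits at both ends, and
  conditional convergence is allowed.
\<close>

subsection \<open>Fourier and Laplace transforms, Caputo derivative\<close>

definition has_fourier_transform :: "(real \<Rightarrow> complex) \<Rightarrow> real \<Rightarrow> complex \<Rightarrow> bool" where
  "has_fourier_transform h k H \<longleftrightarrow>
     ((\<lambda>x. h x * exp (\<i> * of_real (k * x))) has_integral H) UNIV"

definition has_inverse_fourier_transform :: "(real \<Rightarrow> complex) \<Rightarrow> real \<Rightarrow> complex \<Rightarrow> bool" where
  "has_inverse_fourier_transform H x h \<longleftrightarrow>
     ((\<lambda>k. 1 / (2 * of_real pi) * (H k * exp (- (\<i> * of_real (k * x))))) has_integral h) UNIV"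

definition has_laplace_transform :: "(real \<Rightarrow> complex) \<Rightarrow> real \<Rightarrow> complex \<Rightarrow> bool" where
  "has_laplace_transform u s U \<longleftrightarrow>
     ((\<lambda>t. of_real (exp (- (s * t))) * u t) has_integral U) {0..}"

text \<open>
  Meant for \<open>0 < \<beta> \<le> 1\<close> and \<open>t > 0\<close>. The derivative \<open>u'\<close> is only needed on the open interval,
  since it may be singular at \<open>0\<close>.
\<close>

definition has_caputo_derivative ::
    "real \<Rightarrow> (real \<Rightarrow> complex) \<Rightarrow> complex \<Rightarrow> real \<Rightarrow> bool" where
  "has_caputo_derivative \<beta> u D t \<longleftrightarrow>
     (if \<beta> = 1 then (u has_vector_derivative D) (at t)
      else (\<exists>u'. (\<forall>\<tau>\<in>{0<..<t}. (u has_vector_derivative u' \<tau>) (at \<tau>)) \<and>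
                 ((\<lambda>\<tau>. 1 / of_real (Gamma (1 - \<beta>)) * (u' \<tau> / of_real ((t - \<tau>) powr \<beta>)))
                    has_integral D) {0..t}))"

text \<open>
  \<open>u\<close> is Laplace transformable and its Caputo derivative has the Laplace transform
  \<open>s\<^sup>\<beta> U(s) - s\<^sup>\<beta>\<^sup>-\<^sup>1 u(0+)\<close>, for all sufficiently large real \<open>s\<close>.
\<close>

definition caputo_laplace_rule :: "real \<Rightarrow> (real \<Rightarrow> complex) \<Rightarrow> bool" where
  "caputo_laplace_rule \<beta> u \<longleftrightarrow>
     (\<exists>Du. (\<forall>t>0. has_caputo_derivative \<beta> u (Du t) t) \<and>
       (\<exists>s0\<ge>0. \<forall>s>s0. \<exists>U. has_laplace_transform u s U \<and>
          has_laplace_transform Du s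
            (of_real (s powr \<beta>) * U - of_real (s powr (\<beta> - 1)) * Lim (at_right 0) u)))"

subsection \<open>The space-fractional diffusion equation\<close>

text \<open>
  Fourier multiplier of the space-fractional operator of order \<open>\<alpha>\<close>. For \<open>\<alpha> > 0\<close> it vanishes
  at \<open>k = 0\<close>, because \<open>0 powr \<alpha> = 0\<close>.
\<close>

definition space_fractional_symbol :: "real \<Rightarrow> real \<Rightarrow> real" where
  "space_fractional_symbol \<alpha> k = - (\<bar>k\<bar> powr \<alpha>)"

text \<open>
  \<open>N x t\<close> solves the equation with initial value the Dirac delta, in the transform sense;
  \<open>Nh k t\<close> is the Fourier transform of \<open>N\<close> in \<open>x\<close>. At \<open>t = 0\<close> the solution is the Dirac delta,
  not a function, and enters only through its transform \<open>Nh k 0 = 1\<close>; so \<open>N\<close> is constrained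
  only for \<open>t > 0\<close>. The inverse transform is taken at \<open>x \<noteq> 0\<close>: for \<open>\<alpha> \<le> 1\<close> and \<open>\<beta> < 1\<close>
  the inversion integral diverges at \<open>x = 0\<close>, where the solution is singular.
\<close>

definition transform_solution ::
    "real \<Rightarrow> real \<Rightarrow> real \<Rightarrow> (real \<Rightarrow> real \<Rightarrow> complex) \<Rightarrow> bool" where
  "transform_solution \<eta> \<alpha> \<beta> N \<longleftrightarrow>
     (\<exists>Nh :: real \<Rightarrow> real \<Rightarrow> complex.
        (\<forall>t>0. \<forall>k. has_fourier_transform (\<lambda>x. N x t) k (Nh k t)) \<and>
        (\<forall>k. continuous_on {0..} (Nh k) \<and>
             (\<forall>t>0. has_caputo_derivative \<beta> (Nh k)
                       (of_real (\<eta> * space_fractional_symbol \<alpha> k) * Nh k t) t) \<and>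
             Nh k 0 = 1 \<and>
             caputo_laplace_rule \<beta> (Nh k)) \<and>
        (\<forall>t>0. \<forall>x. x \<noteq> 0 \<longrightarrow> has_inverse_fourier_transform (\<lambda>k. Nh k t) x (N x t)))"

subsection \<open>The H-function\<close>

text \<open>
  The parameters are the lists \<open>as = [(a\<^sub>1, A\<^sub>1), \<dots>, (a\<^sub>p, A\<^sub>p)]\<close> and
  \<open>bs = [(b\<^sub>1, B\<^sub>1), \<dots>, (b\<^sub>q, B\<^sub>q)]\<close>, indexed from \<open>0\<close>, and it is understood that \<open>n \<le> p\<close>,
  \<open>1 \<le> m \<le> q\<close> and all \<open>A\<^sub>i, B\<^sub>j > 0\<close>. Since \<open>Gamma\<close> is \<open>0\<close> at its poles and \<open>x / 0 = 0\<close>, the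
  denominator is handled correctly there: the reciprocal Gamma function vanishes.
\<close>

definition fox_H_kernel ::
    "nat \<Rightarrow> nat \<Rightarrow> (complex \<times> real) list \<Rightarrow> (complex \<times> real) list \<Rightarrow> complex \<Rightarrow> complex" where
  "fox_H_kernel m n as bs \<xi> =
     (\<Prod>j<m. Gamma (fst (bs ! j) + of_real (snd (bs ! j)) * \<xi>)) *
     (\<Prod>j<n. Gamma (1 - fst (as ! j) - of_real (snd (as ! j)) * \<xi>)) /
     ((\<Prod>j=m..<length bs. Gamma (1 - fst (bs ! j) - of_real (snd (bs ! j)) * \<xi>)) *
      (\<Prod>j=n..<length as. Gamma (fst (as ! j) + of_real (snd (as ! j)) * \<xi>)))"

definition fox_H_left_poles :: "nat \<Rightarrow> (complex \<times> real) list \<Rightarrow> complex set" where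
  "fox_H_left_poles m bs =
     {\<xi>. \<exists>j<m. fst (bs ! j) + of_real (snd (bs ! j)) * \<xi> \<in> \<int>\<^sub>\<le>\<^sub>0}"

definition fox_H_right_poles :: "nat \<Rightarrow> (complex \<times> real) list \<Rightarrow> complex set" where
  "fox_H_right_poles n as =
     {\<xi>. \<exists>j<n. 1 - fst (as ! j) - of_real (snd (as ! j)) * \<xi> \<in> \<int>\<^sub>\<le>\<^sub>0}"

text \<open>
  The value \<open>w\<close> is attained along a separating line from \<open>\<gamma> - \<i>\<infinity>\<close> to \<open>\<gamma> + \<i>\<infinity>\<close>, parametrised by
  \<open>\<xi> = \<gamma> + \<i> y\<close>, with \<open>d\<xi> = \<i> dy\<close>.
\<close>

definition fox_H_on_line ::
    "nat \<Rightarrow> nat \<Rightarrow> (complex \<times> real) list \<Rightarrow> (complex \<times> real) list \<Rightarrow> complex \<Rightarrow> complex \<Rightarrow> bool" where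
  "fox_H_on_line m n as bs z w \<longleftrightarrow>
     (\<exists>\<gamma>::real.
        (\<forall>\<xi>\<in>fox_H_left_poles m bs. Re \<xi> < \<gamma>) \<and>
        (\<forall>\<xi>\<in>fox_H_right_poles n as. \<gamma> < Re \<xi>) \<and>
        ((\<lambda>y. 1 / (2 * of_real pi * \<i>) *
              (fox_H_kernel m n as bs (Complex \<gamma> y) * z powr (- Complex \<gamma> y) * \<i>))
           has_integral w) UNIV)"

text \<open>
  Loops \<open>g\<close> in a horizontal strip, with \<open>\<sigma> = - 1\<close> for those starting and ending at \<open>-\<infinity>\<close> and
  \<open>\<sigma> = 1\<close> for those starting and ending at \<open>+\<infinity>\<close>. The truncation of \<open>g\<close> to \<open>[- R, R]\<close> is closed
  by a segment, and the winding numbers of the resulting paths for large \<open>R\<close> say which poles are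
  encircled: a loop at \<open>-\<infinity>\<close> goes counterclockwise around the left poles, a loop at \<open>+\<infinity>\<close>
  goes clockwise around the right poles, so that both have the left poles on their left.
\<close>

definition fox_H_loop ::
    "real \<Rightarrow> complex set \<Rightarrow> complex set \<Rightarrow> (real \<Rightarrow> complex) \<Rightarrow> bool" where
  "fox_H_loop \<sigma> L R g \<longleftrightarrow>
     (\<forall>a b. g piecewise_C1_differentiable_on {a..b}) \<and>
     bounded (range (\<lambda>s. Im (g s))) \<and>
     filterlim (\<lambda>s. \<sigma> * Re (g s)) at_top at_top \<and>
     filterlim (\<lambda>s. \<sigma> * Re (g s)) at_top at_bot \<and>
     range g \<inter> (L \<union> R) = {} \<and>
     (let closed_at = (\<lambda>r. (\<lambda>u. g ((2 * u - 1) * r)) +++ linepath (g r) (g (- r))) in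
        (\<forall>\<xi>\<in>L. \<forall>\<^sub>F r in at_top. winding_number (closed_at r) \<xi> = (if \<sigma> < 0 then 1 else 0)) \<and>
        (\<forall>\<xi>\<in>R. \<forall>\<^sub>F r in at_top. winding_number (closed_at r) \<xi> = (if \<sigma> < 0 then 0 else - 1)))"

text \<open>
  Absolute convergence is what the usual conditions for loops provide; it excludes accidental
  conditional convergence along oscillating loops.
\<close>

definition fox_H_on_loop ::
    "real \<Rightarrow> nat \<Rightarrow> nat \<Rightarrow> (complex \<times> real) list \<Rightarrow> (complex \<times> real) list \<Rightarrow> complex \<Rightarrow> complex \<Rightarrow> bool" where
  "fox_H_on_loop \<sigma> m n as bs z w \<longleftrightarrow>
     (\<exists>g. fox_H_loop \<sigma> (fox_H_left_poles m bs) (fox_H_right_poles n as) g \<and>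
        (let f = (\<lambda>s. 1 / (2 * of_real pi * \<i>) *
                    (fox_H_kernel m n as bs (g s) * z powr (- g s) * vector_derivative g (at s)))
         in f absolutely_integrable_on UNIV \<and> w = integral UNIV f))"

text \<open>
  The contour is chosen as convergence requires: a line if the integral converges along some
  separating line, otherwise a loop at \<open>-\<infinity>\<close>, otherwise a loop at \<open>+\<infinity>\<close>.
\<close>

definition fox_H ::
    "nat \<Rightarrow> nat \<Rightarrow> (complex \<times> real) list \<Rightarrow> (complex \<times> real) list \<Rightarrow> complex \<Rightarrow> complex" where
  "fox_H m n as bs z =
     (if \<exists>w. fox_H_on_line m n as bs z w then THE w. fox_H_on_line m n as bs z w
      else if \<exists>w. fox_H_on_loop (- 1) m n as bs z w then THE w. fox_H_on_loop (- 1) m n as bs z w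
      else THE w. fox_H_on_loop 1 m n as bs z w)"

end

theory Submission
  imports Defs
begin

text \<open>
  In the Fourier variable the equation reads \<open>D\<^sub>t\<^sup>\<beta> u = - \<eta> \<bar>k\<bar>\<^sup>\<alpha> u\<close>, \<open>u 0 = 1\<close>; its Laplace transform
  is forced to be \<open>s\<^sup>\<beta>\<^sup>-\<^sup>1 / (s\<^sup>\<beta> + \<eta> \<bar>k\<bar>\<^sup>\<alpha>)\<close>, so by Lerch's theorem \<open>u\<close> is the Mittag-Leffler function
  \<open>E\<^sub>\<beta> (- \<eta> \<bar>k\<bar>\<^sup>\<alpha> t\<^sup>\<beta>)\<close>. A second use of Lerch's theorem gives its Mellin-Barnes representation
  \<open>E\<^sub>\<beta> (- y) = 1 / (2 pi \<i>) \<integral> Gamma s Gamma (1 - s) / Gamma (1 - \<beta> s) y\<^sup>-\<^sup>s ds\<close> on a line with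
  \<open>0 < Re s < 1\<close>, since the Laplace transform of a power is explicit and the remaining integral is the
  inverse Mellin transform of \<open>1 / (1 + y)\<close>. In this form the Fourier inversion reduces to the conditionally
  convergent integrals \<open>\<integral> \<bar>k\<bar>\<^sup>-\<^sup>w e\<^sup>i\<^sup>k\<^sup>x dk\<close>, \<open>0 < Re w < 1\<close>, whose partial integrals are bounded by
  \<open>C (1 + \<bar>w\<bar>)\<close>, so that they may be taken inside the rapidly convergent Mellin-Barnes integral. The
  substitution \<open>\<xi> = - \<alpha> s\<close> turns the result into the contour integral of the H-function. At \<open>k = 0\<close>
  the Fourier integral is evaluated by shifting the line across the pole at \<open>s = 0\<close>.
\<close>

subsection \<open>Complex powers of positive reals\<close>

text \<open>For \<open>\<beta> < 1\<close> the transform in \<open>k\<close> decays only like a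
  power with exponent -\<alpha>, so for small \<alpha> the inversion integral converges only
  conditionally and Fubini fails on the whole line. The integrals are therefore exchanged on bounded
  intervals \<open>{0..T}\<close>, and T tends to infinity under dominated convergence in the
  Mellin-Barnes variable. The majorant comes from a balance of exponents on vertical lines. Up to
  polynomial factors, Gamma s Gamma (1 - s) decays like exp (- pi |Im s|), while 1 / Gamma (1 -
  \<beta> s) grows at most like exp (pi / 2 |Im s|). The factor contributed by the cosine transform
  stays bounded for every \<alpha>, because the growth of its reciprocal Gamma function is cancelled
  by that of its cosine. What remains is estimated by exp (- |Im s|). The line has to satisfy 0 < Re
  s < 1 and 0 < \<alpha> Re s < 1 simultaneously. Then \<alpha> s and 1 - \<alpha> s are both
  admissible exponents, one formula for the Fourier integral of a superposition of powers serves
  both directions, and \<open>cos_mellin_reflection\<close> makes the two directions inverse to each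
  other.\<close>

text \<open>
  Meant for \<open>x > 0\<close>, where it is \<open>x powr w\<close>; at \<open>x = 0\<close> it has the junk value \<open>1\<close>.
\<close>

definition rpow :: "real \<Rightarrow> complex \<Rightarrow> complex" where
  "rpow x w = exp (w * of_real (ln x))"

lemma norm_rpow: "x > 0 \<Longrightarrow> norm (rpow x w) = x powr Re w"
  by (simp add: rpow_def powr_def)

lemma rpow_nonzero [simp]: "rpow x w \<noteq> 0"
  by (simp add: rpow_def)

lemma rpow_zero [simp]: "rpow x 0 = 1"
  by (simp add: rpow_def)

lemma rpow_add: "rpow x (v + w) = rpow x v * rpow x w"
  by (simp add: rpow_def ring_distribs exp_add)

lemma rpow_minus: "rpow x (- w) = inverse (rpow x w)"
  by (simp add: rpow_def exp_minus)

lemma rpow_mult: "x > 0 \<Longrightarrow> y > 0 \<Longrightarrow> rpow (x * y) w = rpow x w * rpow y w"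
  by (simp add: rpow_def ln_mult ring_distribs exp_add)

lemma rpow_of_real: "x > 0 \<Longrightarrow> rpow x (of_real a) = of_real (x powr a)"
  by (simp add: rpow_def powr_def exp_of_real flip: of_real_mult)

lemma rpow_powr: "x > 0 \<Longrightarrow> rpow (x powr a) w = rpow x (of_real a * w)"
  by (simp add: rpow_def ln_powr mult_ac)

lemma powr_eq_rpow: "x > 0 \<Longrightarrow> of_real x powr w = rpow x w"
  by (simp add: rpow_def powr_def Ln_of_real)

lemma rpow_measurable [measurable]:
  assumes [measurable]: "f \<in> borel_measurable M" "g \<in> borel_measurable M"
  shows "(\<lambda>x. rpow (f x) (g x)) \<in> borel_measurable M"
  unfolding rpow_def by measurable

lemma rpow_has_vector_derivative:
  assumes "x > 0"
  shows "((\<lambda>x. rpow x w) has_vector_derivative w * rpow x (w - 1)) (at x within S)"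
proof -
  have "((\<lambda>z. exp (w * z)) has_field_derivative w * exp (w * of_real (ln x))) (at (of_real (ln x)))"
    by (auto intro!: derivative_eq_intros)
  moreover have "((\<lambda>x. complex_of_real (ln x)) has_vector_derivative of_real (1 / x))
      (at x within S)"
    using assms by (intro has_vector_derivative_of_real)
      (auto intro!: derivative_eq_intros simp:
          has_real_derivative_iff_has_vector_derivative[symmetric])
  ultimately have "((\<lambda>z. exp (w * z)) \<circ> (\<lambda>x. complex_of_real (ln x)) has_vector_derivative
      of_real (1 / x) * (w * exp (w * of_real (ln x)))) (at x within S)"
    by (intro field_vector_diff_chain_within) (auto intro: has_field_derivative_at_within)
  moreover have "rpow x (w - 1) = of_real (1 / x) * rpow x w"
    using assms by (simp add: rpow_def ring_distribs exp_diff exp_of_real divide_inverse)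
  ultimately show ?thesis
    by (simp add: o_def rpow_def mult_ac)
qed

lemma continuous_on_rpow_left: "S \<subseteq> {0<..} \<Longrightarrow> continuous_on S (\<lambda>x. rpow x w)"
  unfolding rpow_def by (intro continuous_intros) auto

subsection \<open>The Gamma function on vertical strips\<close>

text \<open>
  The factors \<open>norm (z + k) / (Re z + k)\<close> of Euler's product decrease in \<open>Re z\<close>, so that the worst case
  in the half plane is the line \<open>Re z = 1/2\<close>, where the reflection formula gives the exact value.
\<close>

lemma norm_rGamma_series_le:
  assumes "Re z \<ge> 1/2"
  shows "norm (rGamma_series z n) * rGamma_series (1/2) n
           \<le> rGamma_series (Re z) n * norm (rGamma_series (Complex (1/2) (Im z)) n)"
proof -
  have factor: "norm (z + of_nat k) * (1/2 + real k) \<le> (Re z + real k) * norm (Complex (1/2) (Im z)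
      + of_nat k)" for k
  proof -
    \<comment> \<open>After squaring, both sides contain the term (Re z + k)^2 (1/2 + k)^2; only
      this comparison is left.\<close>
    have "(Im z)\<^sup>2 * (1/2 + real k)\<^sup>2 \<le> (Im z)\<^sup>2 * (Re z + real k)\<^sup>2"
      using assms by (intro mult_left_mono power_mono) auto
    hence "(norm (z + of_nat k) * (1/2 + real k))\<^sup>2
        \<le> ((Re z + real k) * norm (Complex (1/2) (Im z) + of_nat k))\<^sup>2"
      by (simp add: power_mult_distrib cmod_power2) (simp add: algebra_simps)
    thus ?thesis
      by (rule power2_le_imp_le) (use assms in auto)
  qed
  have "norm (pochhammer z (n+1)) * pochhammer (1/2) (n+1) =
      (\<Prod>k=0..<n+1. norm (z + of_nat k) * (1/2 + real k))"
    by (simp only: pochhammer_prod prod.distrib prod_norm)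
  also have "\<dots> \<le> (\<Prod>k=0..<n+1. (Re z + real k) * norm (Complex (1/2) (Im z) + of_nat k))"
    by (intro prod_mono conjI factor mult_nonneg_nonneg) auto
  also have "\<dots> = pochhammer (Re z) (n+1) * norm (pochhammer (Complex (1/2) (Im z)) (n+1))"
    by (simp only: pochhammer_prod prod.distrib prod_norm)
  finally have poch: "norm (pochhammer z (n+1)) * pochhammer (1/2) (n+1)
     \<le> pochhammer (Re z) (n+1) * norm (pochhammer (Complex (1/2) (Im z)) (n+1))" .
  \<comment> \<open>The modulus of n to the power z depends on Re z alone, so both products have the
    same denominator.\<close>
  define D where "D = (fact n * exp (Re z * ln (real n))) * (fact n * exp (1/2 * ln (real n)))"
  have "norm (rGamma_series z n) * rGamma_series (1/2) n = norm (pochhammer z (n+1))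
      * pochhammer (1/2) (n+1) / D"
    by (simp add: rGamma_series_def D_def norm_divide norm_mult norm_fact)
  moreover have "rGamma_series (Re z) n * norm (rGamma_series (Complex (1/2) (Im z)) n)
      = pochhammer (Re z) (n+1) * norm (pochhammer (Complex (1/2) (Im z)) (n+1)) / D"
    by (simp add: rGamma_series_def D_def norm_divide norm_mult norm_fact)
  ultimately show ?thesis
    using poch by (simp add: D_def divide_right_mono)
qed

text \<open>On the line Re z = 1/2 conjugation is the map z -> 1 - z, so the squared modulus is the
  product in the reflection formula.\<close>

lemma cmod_rGamma_half: "(norm (rGamma (Complex (1/2) y)))\<^sup>2 = cosh (pi * y) / pi"
proof -
  define z where "z = Complex (1/2) y"
  have c: "cnj z = 1 - z"
    by (auto simp: z_def complex_eq_iff)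
  have "cnj (rGamma z) = rGamma (cnj z)"
    by (rule cnj_rGamma)
  hence "of_real ((norm (rGamma z))\<^sup>2) = rGamma z * rGamma (1 - z)"
    by (simp add: c complex_norm_square flip: of_real_power)
  also have "\<dots> = sin (of_real pi * z) / of_real pi"
    by (rule rGamma_reflection_complex)
  also have "of_real pi * z = of_real pi / 2 + \<i> * of_real (pi * y)"
    by (auto simp: z_def complex_eq_iff)
  also have "sin \<dots> = cos (\<i> * of_real (pi * y))"
    unfolding sin_add by simp
  also have "\<dots> = of_real (cosh (pi * y))"
    by (simp add: cosh_def cos_exp_eq exp_of_real[symmetric] scaleR_conv_of_real mult_ac)
  finally have "of_real ((norm (rGamma z))\<^sup>2) = complex_of_real (cosh (pi * y) / pi)"
    by simp
  thus ?thesis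
    unfolding of_real_eq_iff z_def .
qed

text \<open>Limit of \<open>norm_rGamma_series_le\<close>. The value 1 / sqrt pi of
  \<open>rGamma (1/2)\<close> cancels the sqrt pi from the critical line.\<close>

lemma norm_rGamma_le_cosh:
  assumes "Re z \<ge> 1/2"
  shows "norm (rGamma z) \<le> rGamma (Re z) * sqrt (cosh (pi * Im z))"
proof -
  have "norm (rGamma z) * rGamma (1/2) \<le> rGamma (Re z) * norm (rGamma (Complex (1/2) (Im z)))"
    by (rule LIMSEQ_le[OF tendsto_mult[OF tendsto_norm[OF rGamma_series_LIMSEQ]
        rGamma_series_LIMSEQ]
          tendsto_mult[OF rGamma_series_LIMSEQ tendsto_norm[OF rGamma_series_LIMSEQ]]])
       (use norm_rGamma_series_le[OF assms] in blast)
  also have "norm (rGamma (Complex (1/2) (Im z))) = sqrt (cosh (pi * Im z) / pi)"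
    using cmod_rGamma_half[of "Im z"] by (metis norm_ge_zero real_sqrt_unique)
  also have "rGamma (1/2 :: real) = 1 / sqrt pi"
    unfolding rGamma_inverse_Gamma Gamma_one_half_real by (simp add: divide_inverse)
  finally have "norm (rGamma z) / sqrt pi \<le> rGamma (Re z) * sqrt (cosh (pi * Im z)) / sqrt pi"
    by (simp add: real_sqrt_divide)
  thus ?thesis by (simp add: divide_le_cancel)
qed

lemma cosh_le_exp_abs: "cosh (x::real) \<le> exp \<bar>x\<bar>"
  by (cases "x \<ge> 0") (auto simp: cosh_def)

lemma norm_rGamma_le_exp_right:
  "\<exists>C\<ge>0. \<forall>z. 1/2 \<le> Re z \<longrightarrow> Re z \<le> b \<longrightarrow> norm (rGamma z) \<le> C * exp (pi / 2 * \<bar>Im z\<bar>)"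
proof -
  have "compact ((\<lambda>x::real. rGamma x) ` {1/2..b})"
    by (intro compact_continuous_image continuous_intros compact_Icc)
  then obtain C where C: "\<And>x. x \<in> {1/2..b} \<Longrightarrow> \<bar>rGamma x\<bar> \<le> C"
    using compact_imp_bounded bounded_iff by (metis imageI real_norm_def)
  \<comment> \<open>For b < 1/2 the interval is empty and C may be negative, hence the maximum with
    0.\<close>
  have "norm (rGamma z) \<le> max C 0 * exp (pi / 2 * \<bar>Im z\<bar>)" if z: "1/2 \<le> Re z" "Re z \<le> b" for z
  proof -
    have "sqrt (cosh (pi * Im z)) \<le> sqrt (exp (\<bar>pi * Im z\<bar>))"
      by (intro real_sqrt_le_mono cosh_le_exp_abs)
    also have "exp (\<bar>pi * Im z\<bar>) = (exp (pi / 2 * \<bar>Im z\<bar>))\<^sup>2"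
      by (simp add: power2_eq_square abs_mult flip: exp_add)
    finally have "sqrt (cosh (pi * Im z)) \<le> exp (pi / 2 * \<bar>Im z\<bar>)"
      by simp
    moreover have "rGamma (Re z) \<le> max C 0"
      using C[of "Re z"] z by auto
    ultimately have "rGamma (Re z) * sqrt (cosh (pi * Im z)) \<le> max C 0 * exp (pi / 2 * \<bar>Im z\<bar>)"
      by (intro mult_mono) auto
    with norm_rGamma_le_cosh[of z] z show ?thesis by simp
  qed
  thus ?thesis by (intro exI[of _ "max C 0"]) auto
qed

text \<open>The functional equation carries the previous bound one unit to the left at the price of
  a linear factor. This is needed for 1 - \<beta> s, whose real part drops below 1/2 when \<beta> Re
  s exceeds 1/2.\<close>

lemma norm_rGamma_le_exp:
  "\<exists>C\<ge>0. \<forall>z. - (1/2) \<le> Re z \<longrightarrow> Re z \<le> b \<longrightarrow> norm (rGamma z) \<le> C * (1 + norm z) * exp (pi / 2 * \<bar>Im z\<bar>)"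
proof -
  obtain C where C: "C \<ge> 0" "\<And>z. 1/2 \<le> Re z \<Longrightarrow> Re z \<le> b + 1 \<Longrightarrow> norm (rGamma z)
      \<le> C * exp (pi / 2 * \<bar>Im z\<bar>)"
    using norm_rGamma_le_exp_right[of "b + 1"] by blast
  have "norm (rGamma z) \<le> C * (1 + norm z) * exp (pi / 2 * \<bar>Im z\<bar>)" if z: "- (1/2) \<le> Re z"
      "Re z \<le> b" for z
  proof -
    have "norm (rGamma z) = norm z * norm (rGamma (z + 1))"
      by (simp add: rGamma_plus1 flip: norm_mult)
    also have "\<dots> \<le> (1 + norm z) * (C * exp (pi / 2 * \<bar>Im z\<bar>))"
      using C(2)[of "z + 1"] z by (intro mult_mono) auto
    finally show ?thesis by (simp add: mult_ac)
  qed
  thus ?thesis using C(1) by blast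
qed

section \<open>Lower bounds for the complex cosine and sine\<close>

lemma cosh_ge_exp_abs: "cosh (y::real) \<ge> exp \<bar>y\<bar> / 2"
  by (cases "y \<ge> 0") (auto simp: cosh_def)

text \<open>Only the first term of |cos (x + i y)|^2 = cos^2 x cosh^2 y + sin^2 x sinh^2 y is kept.
  The bound has content where cos (Re z) is positive, in particular for |Re z| < pi / 2.\<close>

lemma norm_cos_ge: "norm (cos z) \<ge> cos (Re z) * exp \<bar>Im z\<bar> / 2"
proof -
  have "\<bar>cos (Re z)\<bar> * cosh (Im z) \<le> norm (cos z)"
  proof (rule power2_le_imp_le)
    have "(cos (Re z))\<^sup>2 * (cosh (Im z))\<^sup>2 \<le> (cos (Re z) * cosh (Im z))\<^sup>2
        + (sin (Re z) * sinh (Im z))\<^sup>2"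
      by (simp add: power_mult_distrib)
    also have "\<dots> = (norm (cos z))\<^sup>2"
      unfolding cmod_power2 Re_cos Im_cos cosh_def sinh_def
      by (simp add: power2_eq_square field_simps)
    finally show "(\<bar>cos (Re z)\<bar> * cosh (Im z))\<^sup>2 \<le> (norm (cos z))\<^sup>2"
      by (simp add: power_mult_distrib)
  qed simp
  moreover have "cos (Re z) * (exp \<bar>Im z\<bar> / 2) \<le> \<bar>cos (Re z)\<bar> * cosh (Im z)"
    using cosh_ge_exp_abs by (intro mult_mono) auto
  ultimately show ?thesis by simp
qed

lemma norm_sin_ge: "norm (sin z) \<ge> \<bar>sin (Re z)\<bar> * exp \<bar>Im z\<bar> / 2"
proof -
  have 1: "cos (z - of_real pi / 2) = sin z" and 2: "cos (z + of_real pi / 2) = - sin z"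
    unfolding cos_diff cos_add by simp_all
  have 3: "cos (Re z - pi / 2) = sin (Re z)" and 4: "cos (Re z + pi / 2) = - sin (Re z)"
    unfolding cos_diff cos_add by simp_all
  have "norm (sin z) \<ge> sin (Re z) * exp \<bar>Im z\<bar> / 2"
    using norm_cos_ge[of "z - of_real pi / 2"] by (simp add: 1 3)
  moreover have "norm (sin z) \<ge> - sin (Re z) * exp \<bar>Im z\<bar> / 2"
    using norm_cos_ge[of "z + of_real pi / 2"] by (simp add: 2 4)
  ultimately show ?thesis by (cases "sin (Re z) \<ge> 0") simp_all
qed

text \<open>This version is uniform in Re z. It serves on strips around the imaginary axis, where
  sin (Re z) may vanish and only the distance from the real axis helps.\<close>

lemma norm_sin_ge': "norm (sin z) \<ge> (exp \<bar>Im z\<bar> - 1) / 2"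
proof -
  have "\<bar>norm (exp (\<i> * z)) - norm (exp (- (\<i> * z)))\<bar> \<le> norm (exp (\<i> * z) - exp (- (\<i> * z)))"
    by (rule norm_triangle_ineq3)
  also have "\<dots> = 2 * norm (sin z)"
    by (simp add: sin_exp_eq norm_divide norm_mult)
  finally have *: "\<bar>exp (- Im z) - exp (Im z)\<bar> \<le> 2 * norm (sin z)"
    by simp
  have aux: "(y - 1) / 2 \<le> n" if "\<bar>x - y\<bar> \<le> 2 * n" "x \<le> 1" for x y n :: real
    using abs_le_D1[of "y - x" "2 * n"] that by (simp add: abs_minus_commute)
  show ?thesis
  proof (cases "Im z \<ge> 0")
    case True
    hence "exp (- Im z) \<le> 1" by simp
    from aux[OF * this] have "(exp (Im z) - 1) / 2 \<le> norm (sin z)" .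
    with True show ?thesis by simp
  next
    case False
    hence "exp (Im z) \<le> 1" by simp
    from aux[OF _ this] * have "(exp (- Im z) - 1) / 2 \<le> norm (sin z)"
      by (simp add: abs_minus_commute)
    with False show ?thesis by simp
  qed
qed

subsection \<open>Vertical line integrals\<close>

lemma integrable_exp_abs:
  assumes "d > 0"
  shows "integrable lborel (\<lambda>v::real. exp (- d * \<bar>v\<bar>))"
proof -
  define f where "f = (\<lambda>v::real. indicator {0..} v *\<^sub>R exp (- d * v))"
  have "(\<lambda>v. exp (- d * v)) absolutely_integrable_on {0..}"
    using has_integral_exp_minus_to_infinity[OF assms, of 0]
    by (intro nonnegative_absolutely_integrable_1) (auto simp: has_integral_iff)
  hence f: "integrable lborel f"
    unfolding set_integrable_def f_def by (subst (asm) integrable_completion) auto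
  \<comment> \<open>At v = 0 both summands equal 1, so the sum dominates the even exponential
    instead of being equal to it.\<close>
  have "integrable lborel (\<lambda>v. f v + f (0 + (-1) * v))"
    by (intro Bochner_Integration.integrable_add f lborel_integrable_real_affine) auto
  thus ?thesis
    by (rule Bochner_Integration.integrable_bound) (auto simp: f_def indicator_def)
qed

lemma integrable_exp_bound:
  fixes f :: "real \<Rightarrow> 'a :: {banach, second_countable_topology}"
  assumes "f \<in> borel_measurable borel" "d > 0" "\<And>v. norm (f v) \<le> C * exp (- d * \<bar>v\<bar>)"
  shows "integrable lborel f"
proof (rule Bochner_Integration.integrable_bound)
  show "integrable lborel (\<lambda>v::real. C * exp (- d * \<bar>v\<bar>))"
    by (intro integrable_mult_right integrable_exp_abs assms)
qed (use assms in \<open>auto intro!: AE_I2 order_trans[OF _ abs_ge_self]\<close>)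

text \<open>Trades a linear factor for an arbitrarily small loss d in an exponential rate.\<close>

lemma le_exp_div: "d > 0 \<Longrightarrow> (x::real) \<le> exp (d * x) / d"
  using exp_ge_add_one_self[of "d * x"] by (simp add: field_simps order_trans[of _ "1 + d * x"])

lemma integral_symmetric_interval_tendsto:
  fixes f :: "real \<Rightarrow> complex"
  assumes "integrable lborel f" "continuous_on UNIV f"
  shows "(\<lambda>n. integral {- real n..real n} f) \<longlonglongrightarrow> (LINT v|lborel. f v)"
proof -
  have "(\<lambda>n. LINT v|lborel. indicator {- real n..real n} v *\<^sub>R f v) \<longlonglongrightarrow> (LINT v|lborel. f v)"
  proof (rule integral_dominated_convergence)
    show "integrable lborel (\<lambda>v. norm (f v))" using assms by simp
    show "AE v in lborel. (\<lambda>n. indicator {- real n..real n} v *\<^sub>R f v) \<longlonglongrightarrow> f v"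
    proof (intro AE_I2)
      fix v :: real
      have "\<forall>\<^sub>F n in sequentially. indicator {- real n..real n} v *\<^sub>R f v = f v"
        using eventually_ge_at_top[of "nat \<lceil>\<bar>v\<bar>\<rceil>"]
        by eventually_elim (auto simp: indicator_def nat_ceiling_le_eq abs_le_iff)
      thus "(\<lambda>n. indicator {- real n..real n} v *\<^sub>R f v) \<longlonglongrightarrow> f v"
        by (rule tendsto_eventually)
    qed
  qed (use assms(1) in \<open>auto simp: indicator_def intro!: AE_I2\<close>)
  moreover have "(LINT v|lborel. indicator {- real n..real n} v *\<^sub>R f v)
      = integral {- real n..real n} f" for n
    using set_borel_integral_eq_integral(2)[of "{- real n..real n}" f] assms
    by (simp add: set_lebesgue_integral_def set_integrable_def borel_integrable_compact
        continuous_on_subset)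
  ultimately show ?thesis by simp
qed

lemma contour_integral_rectpath:
  assumes "Re a1 < Re a3" "Im a1 < Im a3" "continuous_on (path_image (rectpath a1 a3)) F"
  shows "contour_integral (rectpath a1 a3) F =
      contour_integral (linepath a1 (Complex (Re a3) (Im a1))) F
    + \<i> * integral {Im a1..Im a3} (\<lambda>v. F (Complex (Re a3) v))
    + contour_integral (linepath a3 (Complex (Re a1) (Im a3))) F
    - \<i> * integral {Im a1..Im a3} (\<lambda>v. F (Complex (Re a1) v))"
proof -
  define a2 a4 where "a2 = Complex (Re a3) (Im a1)" and "a4 = Complex (Re a1) (Im a3)"
  have rp: "rectpath a1 a3 = linepath a1 a2 +++ linepath a2 a3 +++ linepath a3 a4 +++ linepath a4
      a1"
    by (simp add: rectpath_def a2_def a4_def Let_def)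
  have img: "closed_segment a1 a2 \<union> closed_segment a2 a3 \<union> closed_segment a3 a4 \<union> closed_segment a4
      a1
        \<subseteq> path_image (rectpath a1 a3)"
    unfolding rp by (auto simp: path_image_join)
  have c: "continuous_on (closed_segment a1 a2) F" "continuous_on (closed_segment a2 a3) F"
     "continuous_on (closed_segment a3 a4) F" "continuous_on (closed_segment a4 a1) F"
    using img by (auto intro: continuous_on_subset[OF assms(3)])
  hence ci: "F contour_integrable_on linepath a1 a2" "F contour_integrable_on linepath a2 a3"
    "F contour_integrable_on linepath a3 a4" "F contour_integrable_on linepath a4 a1"
    by (auto intro: contour_integrable_continuous_linepath)
  have "contour_integral (rectpath a1 a3) F = contour_integral (linepath a1 a2) F
     + contour_integral (linepath a2 a3) F + contour_integral (linepath a3 a4) F + contour_integral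
         (linepath a4 a1) F"
    unfolding rp using ci by (simp add: valid_path_join contour_integrable_joinI)
  also have "contour_integral (linepath a2 a3) F = \<i> * integral {Im a1..Im a3}
      (\<lambda>v. F (Complex (Re a3) v))"
    by (rule contour_integral_linepath_same_Re) (use assms in \<open>auto simp: a2_def\<close>)
  also have "contour_integral (linepath a4 a1) F = - contour_integral (linepath a1 a4) F"
    using c by (intro contour_integral_reverse_linepath) (simp add: closed_segment_commute)
  also have "contour_integral (linepath a1 a4) F = \<i> * integral {Im a1..Im a3}
      (\<lambda>v. F (Complex (Re a1) v))"
    by (rule contour_integral_linepath_same_Re) (use assms in \<open>auto simp: a4_def\<close>)
  finally show ?thesis by (simp add: a2_def a4_def)
qed

lemma continuous_on_Complex [continuous_intros]:
  "continuous_on A f \<Longrightarrow> continuous_on A g \<Longrightarrow> continuous_on A (\<lambda>x. Complex (f x) (g x))"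
  unfolding Complex_eq by (intro continuous_intros)

text \<open>Cauchy's integral formula on rectangles of growing height: the horizontal sides vanish
  by the exponential bound, the vertical sides remain. The constant is 2 pi without the imaginary
  unit because ds = i dv on a vertical line.\<close>

lemma strip_line_difference:
  fixes f :: "complex \<Rightarrow> complex"
  assumes hol: "f holomorphic_on {s. l < Re s \<and> Re s < r}"
    and ab: "l < a" "a < Re p" "Re p < b" "b < r" and d: "d > 0"
    and bound: "\<And>s. a \<le> Re s \<Longrightarrow> Re s \<le> b \<Longrightarrow> norm (f s) \<le> C * exp (- d * \<bar>Im s\<bar>)"
  shows "integrable lborel (\<lambda>v. f (Complex a v) / (Complex a v - p))"
    and "integrable lborel (\<lambda>v. f (Complex b v) / (Complex b v - p))"
    and "(LINT v|lborel. f (Complex b v) / (Complex b v - p)) -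
         (LINT v|lborel. f (Complex a v) / (Complex a v - p)) = 2 * of_real pi * f p"
proof -
  define S where "S = {s. l < Re s \<and> Re s < r}"
  have S: "convex S" "open S" "S = {s. l < Re s} \<inter> {s. Re s < r}"
    unfolding S_def by (auto intro!: convex_Int convex_halfspace_Re_gt convex_halfspace_Re_lt
       open_Int open_halfspace_Re_gt open_halfspace_Re_lt simp: Collect_conj_eq)
  have hol: "f holomorphic_on S" using hol by (simp add: S_def)
  define F where "F = (\<lambda>s. f s / (s - p))"
  have contF: "continuous_on (S - {p}) F"
    unfolding F_def
    by (intro continuous_intros continuous_on_subset[OF holomorphic_on_imp_continuous_on[OF hol]])
        auto
  have cont_line: "continuous_on UNIV (\<lambda>v. F (Complex c v))" if "c \<in> {a, b}" for c
    by (rule continuous_on_compose2[OF contF])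
       (use that ab in \<open>auto intro!: continuous_intros simp: S_def\<close>)
  have C: "C \<ge> 0"
  proof -
    have "0 \<le> norm (f (Complex a 0))" by simp
    also have "\<dots> \<le> C" using bound[of "Complex a 0"] ab by simp
    finally show ?thesis .
  qed
  have int: "integrable lborel (\<lambda>v. F (Complex c v))" if c: "c \<in> {a, b}" for c
  proof (rule integrable_exp_bound[OF _ d])
    show "(\<lambda>v. F (Complex c v)) \<in> borel_measurable borel"
      using cont_line[OF c] by (rule borel_measurable_continuous_onI)
    fix v
    have 1: "\<bar>c - Re p\<bar> > 0" using c ab by auto
    have 2: "\<bar>c - Re p\<bar> \<le> norm (Complex c v - p)"
      using abs_Re_le_cmod[of "Complex c v - p"] by simp
    have "norm (F (Complex c v)) \<le> C * exp (- d * \<bar>v\<bar>) / \<bar>c - Re p\<bar>"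
      unfolding F_def norm_divide using bound[of "Complex c v"] c ab 1 2 C
      by (intro frac_le) auto
    thus "norm (F (Complex c v)) \<le> (C / \<bar>c - Re p\<bar>) * exp (- d * \<bar>v\<bar>)" by simp
  qed
  show "integrable lborel (\<lambda>v. f (Complex a v) / (Complex a v - p))"
       "integrable lborel (\<lambda>v. f (Complex b v) / (Complex b v - p))"
    using int by (auto simp: F_def)
  \<comment> \<open>By Cauchy's formula this is the contribution of the two horizontal sides at
    height n, once p lies inside the rectangle.\<close>
  define E where "E = (\<lambda>n::nat. 2 * of_real pi * \<i> * f p
     - \<i> * (integral {- real n..real n} (\<lambda>v. F (Complex b v)) - integral {- real n..real n}
         (\<lambda>v. F (Complex a v))))"
  have Elim: "E \<longlonglongrightarrow> 2 * of_real pi * \<i> * f p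
     - \<i> * ((LINT v|lborel. F (Complex b v)) - (LINT v|lborel. F (Complex a v)))"
    unfolding E_def by (intro tendsto_intros integral_symmetric_interval_tendsto int cont_line) auto
  \<comment> \<open>This height puts p inside the rectangle and at distance at least 1 from both
    horizontal sides, so that dividing by s - p does no harm there.\<close>
  have Ebound: "norm (E n) \<le> 2 * (b - a) * (C * exp (- d * real n))" if n: "real n \<ge> \<bar>Im p\<bar> + 1"
      for n
  proof -
    define a1 a3 where "a1 = Complex a (- real n)" and "a3 = Complex b (real n)"
    have pbox: "p \<in> box a1 a3"
      using ab n by (auto simp: in_box_complex_iff a1_def a3_def)
    have sub: "path_image (rectpath a1 a3) \<subseteq> cbox a1 a3 - {p}"
      using pbox ab n path_image_rectpath_subset_cbox[of a1 a3] path_image_rectpath_inter_box[of a1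
          a3]
      by (auto simp: a1_def a3_def)
    have cb: "cbox a1 a3 \<subseteq> S"
      using ab by (auto simp: in_cbox_complex_iff a1_def a3_def S_def)
    have "(F has_contour_integral (2*pi * \<i> * winding_number (rectpath a1 a3) p * f p))
        (rectpath a1 a3)"
      unfolding F_def
      by (rule Cauchy_integral_formula_convex_simple[OF S(1) hol])
         (use S(2) sub cb ab in \<open>auto simp: interior_open S_def\<close>)
    hence "contour_integral (rectpath a1 a3) F = 2 * pi * \<i> * f p"
      using winding_number_rectpath[OF pbox] contour_integral_unique by force
    moreover have "continuous_on (path_image (rectpath a1 a3)) F"
      using sub cb by (intro continuous_on_subset[OF contF]) auto
    ultimately have En: "E n = contour_integral (linepath a1 (Complex b (- real n))) F
        + contour_integral (linepath a3 (Complex a (real n))) F"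
      using contour_integral_rectpath[of a1 a3 F] ab n
      by (simp add: a1_def a3_def E_def algebra_simps)
    have seg_bound: "norm (contour_integral (linepath (Complex x y) (Complex x' y)) F)
        \<le> C * exp (- d * real n) * norm (Complex x' y - Complex x y)"
      if xy: "x \<in> {a, b}" "x' \<in> {a, b}" "\<bar>y\<bar> = real n" for x x' y
    proof (rule contour_integral_bound_linepath)
      have seg: "s \<in> S - {p} \<and> a \<le> Re s \<and> Re s \<le> b \<and> Im s = y"
          if "s \<in> closed_segment (Complex x y) (Complex x' y)" for s
        using that xy ab n by (auto simp: closed_segment_same_Im closed_segment_eq_real_ivl S_def
            split: if_splits)
      show "F contour_integrable_on linepath (Complex x y) (Complex x' y)"
        by (intro contour_integrable_continuous_linepath continuous_on_subset[OF contF])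
            (use seg in blast)
      show "0 \<le> C * exp (- d * real n)" using C by simp
      fix s assume "s \<in> closed_segment (Complex x y) (Complex x' y)"
      from seg[OF this] have s: "a \<le> Re s" "Re s \<le> b" "Im s = y" by auto
      have "norm (s - p) \<ge> 1"
        using abs_Im_le_cmod[of "s - p"] s(3) xy(3) n by simp
      hence "norm (F s) \<le> C * exp (- d * \<bar>y\<bar>) / 1"
        unfolding F_def norm_divide using bound[of s] s C by (intro frac_le) auto
      thus "norm (F s) \<le> C * exp (- d * real n)" using xy by simp
    qed
    have nrm: "norm (Complex x' y - Complex x y) = \<bar>x' - x\<bar>" for x x' y
      by (simp add: cmod_def)
    have "norm (contour_integral (linepath a1 (Complex b (- real n))) F) \<le> C * exp (- d * real n)
        * (b - a)"
       "norm (contour_integral (linepath a3 (Complex a (real n))) F) \<le> C * exp (- d * real n)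
           * (b - a)"
      using ab seg_bound[of a b "- real n"] seg_bound[of b a "real n"]
          by (auto simp: a1_def a3_def nrm)
    thus ?thesis
      unfolding En
      using norm_triangle_ineq[of "contour_integral (linepath a1 (Complex b (- real n))) F"
          "contour_integral (linepath a3 (Complex a (real n))) F"]
      by (simp add: algebra_simps)
  qed
  have "E \<longlonglongrightarrow> 0"
  proof (rule Lim_null_comparison)
    show "\<forall>\<^sub>F n in sequentially. norm (E n) \<le> 2 * (b - a) * (C * exp (- d * real n))"
      using eventually_ge_at_top[of "nat \<lceil>\<bar>Im p\<bar> + 1\<rceil>"]
      by eventually_elim (rule Ebound, linarith)
    show "(\<lambda>n. 2 * (b - a) * (C * exp (- d * real n))) \<longlonglongrightarrow> 0"
      using d by real_asymp
  qed
  from LIMSEQ_unique[OF this Elim]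
  have "\<i> * ((LINT v|lborel. F (Complex b v)) - (LINT v|lborel. F (Complex a v)))
      = \<i> * (2 * of_real pi * f p)"
    by (simp add: algebra_simps)
  thus "(LINT v|lborel. f (Complex b v) / (Complex b v - p)) -
         (LINT v|lborel. f (Complex a v) / (Complex a v - p)) = 2 * of_real pi * f p"
    by (simp only: mult_cancel_left F_def) simp
qed

text \<open>Apply the previous lemma to (s - p) f s with an artificial point p between the lines:
  the residue is 0, and the additional linear factor costs half of the decay rate.\<close>

lemma strip_line_shift:
  fixes f :: "complex \<Rightarrow> complex"
  assumes hol: "f holomorphic_on {s. l < Re s \<and> Re s < r}"
    and ab: "l < a" "a < b" "b < r" and d: "d > 0"
    and bound: "\<And>s. a \<le> Re s \<Longrightarrow> Re s \<le> b \<Longrightarrow> norm (f s) \<le> C * exp (- d * \<bar>Im s\<bar>)"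
  shows "(LINT v|lborel. f (Complex b v)) = (LINT v|lborel. f (Complex a v))"
proof -
  define p where "p = complex_of_real ((a + b) / 2)"
  have p: "a < Re p" "Re p < b" using ab by (auto simp: p_def)
  have C: "C \<ge> 0"
  proof -
    have "0 \<le> norm (f (Complex a 0))" by simp
    also have "\<dots> \<le> C" using bound[of "Complex a 0"] ab by simp
    finally show ?thesis .
  qed
  have "norm ((s - p) * f s) \<le> ((b - a + 2 / d) * C) * exp (- (d / 2) * \<bar>Im s\<bar>)"
    if s: "a \<le> Re s" "Re s \<le> b" for s
  proof -
    define e where "e = exp (d / 2 * \<bar>Im s\<bar>)"
    have e: "e \<ge> 1" using d by (auto simp: e_def)
    have ee: "exp (- d * \<bar>Im s\<bar>) * e = exp (- (d / 2) * \<bar>Im s\<bar>)"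
      by (simp add: e_def flip: exp_add)
    have "norm (s - p) \<le> \<bar>Re (s - p)\<bar> + \<bar>Im (s - p)\<bar>" by (rule cmod_le)
    also have "\<dots> \<le> (b - a) + \<bar>Im s\<bar>" using s by (simp add: p_def abs_le_iff)
        (auto simp: field_simps)
    also have "\<dots> \<le> (b - a) * e + e / (d / 2)"
      using le_exp_div[of "d / 2" "\<bar>Im s\<bar>"] d ab e
      by (intro add_mono) (auto simp: e_def)
    also have "\<dots> = (b - a + 2 / d) * e" by (simp add: field_simps)
    finally have "norm (s - p) * norm (f s) \<le> ((b - a + 2 / d) * e) * (C * exp (- d * \<bar>Im s\<bar>))"
      using bound[OF s] ab d e by (intro mult_mono) auto
    also have "\<dots> = ((b - a + 2 / d) * C) * (exp (- d * \<bar>Im s\<bar>) * e)" by (simp add: mult_ac)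
    finally show ?thesis by (simp only: norm_mult ee)
  qed
  hence "(LINT v|lborel. (Complex b v - p) * f (Complex b v) / (Complex b v - p)) -
         (LINT v|lborel. (Complex a v - p) * f (Complex a v) / (Complex a v - p))
             = 2 * of_real pi * ((p - p) * f p)"
    using hol ab p d
    by (intro strip_line_difference(3)[where l = l and r = r and d = "d/2" and C
        = "(b - a + 2 / d) * C"] holomorphic_intros) auto
  moreover have "Complex c v - p \<noteq> 0" if "c \<in> {a, b}" for c v
    using that p by (auto simp: complex_eq_iff)
  ultimately show ?thesis by simp
qed

subsection \<open>The reflected Gamma product\<close>

text \<open>This is pi s / sin (pi s) with its singularity at 0 removed, that is, s Gamma s Gamma (1
  - s). The pole of Gamma s at 0 then appears as an explicit division by s, the form treated by
  \<open>strip_line_difference\<close>.\<close>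

definition gamma_pair :: "complex \<Rightarrow> complex" where
  "gamma_pair s = Gamma (1 + s) * Gamma (1 - s)"

lemma gamma_pair_0 [simp]: "gamma_pair 0 = 1"
  by (simp add: gamma_pair_def)

lemma gamma_pair_eq:
  assumes "- 1 < Re s" "Re s < 1" "s \<noteq> 0"
  shows "gamma_pair s = of_real pi * s / sin (of_real pi * s)"
proof -
  have "s \<notin> \<int>\<^sub>\<le>\<^sub>0"
    using assms by (auto elim!: nonpos_Ints_cases)
  hence "gamma_pair s = s * (Gamma s * Gamma (1 - s))"
    using Gamma_plus1[of s] by (simp add: gamma_pair_def add.commute mult_ac)
  thus ?thesis by (simp add: Gamma_reflection_complex)
qed

lemma holomorphic_gamma_pair: "gamma_pair holomorphic_on {s. - 1 < Re s \<and> Re s < 1}"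
  unfolding gamma_pair_def by (intro holomorphic_intros) (auto elim!: nonpos_Ints_cases simp:
      complex_eq_iff)

text \<open>Compactness settles the part of the strip near the real axis. Elsewhere the sine
  supplies the decay, and the linear factor is the numerator s of
  \<open>gamma_pair_eq\<close>.\<close>

lemma gamma_pair_bound:
  assumes ab: "- 1 < a" "b < 1"
  shows "\<exists>C\<ge>0. \<forall>s. a \<le> Re s \<longrightarrow> Re s \<le> b \<longrightarrow> norm (gamma_pair s) \<le> C * (1 + \<bar>Im s\<bar>)
      * exp (- pi * \<bar>Im s\<bar>)"
proof -
  have "compact (gamma_pair ` cbox (Complex a (-1)) (Complex b 1))"
    by (intro compact_continuous_image holomorphic_on_imp_continuous_on
         holomorphic_on_subset[OF holomorphic_gamma_pair] compact_cbox)
       (use ab in \<open>auto simp: in_cbox_complex_iff\<close>)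
  then obtain M where M: "\<And>s. s \<in> cbox (Complex a (-1)) (Complex b 1) \<Longrightarrow> norm (gamma_pair s) \<le> M"
    using compact_imp_bounded bounded_iff by (metis imageI)
  define C where "C = max (\<bar>M\<bar> * exp pi) (4 * pi)"
  have "norm (gamma_pair s) \<le> C * (1 + \<bar>Im s\<bar>) * exp (- pi * \<bar>Im s\<bar>)" if s: "a \<le> Re s" "Re s \<le> b"
      for s
  proof (cases "\<bar>Im s\<bar> \<le> 1")
    case True
    have "norm (gamma_pair s) \<le> \<bar>M\<bar> * 1"
      using M[of s] s True by (auto simp: in_cbox_complex_iff abs_le_iff)
    also have "\<dots> \<le> \<bar>M\<bar> * (exp pi * exp (- pi * \<bar>Im s\<bar>))"
      using True by (intro mult_left_mono) (auto simp flip: exp_add)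
    also have "\<dots> \<le> C * exp (- pi * \<bar>Im s\<bar>)"
      by (simp add: C_def flip: mult.assoc)
    also have "\<dots> \<le> C * (1 + \<bar>Im s\<bar>) * exp (- pi * \<bar>Im s\<bar>)"
      by (intro mult_right_mono) (auto simp: C_def le_max_iff_disj algebra_simps)
    finally show ?thesis .
  next
    case False
    define e where "e = exp (pi * \<bar>Im s\<bar>)"
    have "1 + pi * \<bar>Im s\<bar> \<le> e" unfolding e_def by (rule exp_ge_add_one_self)
    moreover have "1 \<le> pi * \<bar>Im s\<bar>" using False pi_gt3 mult_mono[of 1 pi 1 "\<bar>Im s\<bar>"] by simp
    \<comment> \<open>From e \<ge> 2 on, (e - 1) / 2 is at least e / 4, which turns the bound for
      the sine into a pure exponential.\<close>
    ultimately have e: "e \<ge> 2" by linarith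
    have "(e - 1) / 2 \<le> norm (sin (of_real pi * s))"
      using norm_sin_ge'[of "of_real pi * s"] by (simp add: e_def abs_mult)
    moreover have "e / 4 \<le> (e - 1) / 2" using e by simp
    ultimately have sn: "e / 4 \<le> norm (sin (of_real pi * s))" by linarith
    have ns: "norm s \<le> 1 + \<bar>Im s\<bar>"
      using cmod_le[of s] s ab by linarith
    have "norm (gamma_pair s) = pi * norm s / norm (sin (of_real pi * s))"
      using False s ab by (subst gamma_pair_eq) (auto simp: norm_mult norm_divide)
    also have "\<dots> \<le> pi * (1 + \<bar>Im s\<bar>) / (e / 4)"
      using sn e ns by (intro frac_le mult_left_mono) auto
    also have "\<dots> = 4 * pi * (1 + \<bar>Im s\<bar>) * exp (- pi * \<bar>Im s\<bar>)"
      by (simp add: e_def exp_minus field_simps)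
    also have "\<dots> \<le> C * (1 + \<bar>Im s\<bar>) * exp (- pi * \<bar>Im s\<bar>)"
      by (intro mult_right_mono) (auto simp: C_def)
    finally show ?thesis .
  qed
  moreover have "C \<ge> 0" by (simp add: C_def le_max_iff_disj)
  ultimately show ?thesis by blast
qed

text \<open>
  The integrand is \<open>pi / sin (pi s) * exp (- l s)\<close>. A shift of the line by \<open>- 1\<close> multiplies the integral by
  \<open>- exp l\<close>, and the difference of the two integrals is the residue at \<open>0\<close>.
\<close>

lemma integral_exp_div_sin:
  assumes \<sigma>: "0 < \<sigma>" "\<sigma> < 1" and l: "\<bar>Im l\<bar> < pi"
  shows "integrable lborel (\<lambda>v. gamma_pair (Complex \<sigma> v) / Complex \<sigma> v * exp (- l * Complex \<sigma> v))"
      (is ?int)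
    and "(LINT v|lborel. gamma_pair (Complex \<sigma> v) / Complex \<sigma> v * exp (- l * Complex \<sigma> v))
        = 2 * of_real pi / (1 + exp l)" (is ?eq)
proof -
  define f where "f = (\<lambda>s. gamma_pair s * exp (- l * s))"
  \<comment> \<open>Half of the slack between pi and |Im l|; the other half absorbs the linear
    factor of \<open>gamma_pair_bound\<close>.\<close>
  define d where "d = (pi - \<bar>Im l\<bar>) / 2"
  have d: "d > 0" using l by (simp add: d_def)
  obtain C where C: "C \<ge> 0" "\<And>s. \<sigma> - 1 \<le> Re s \<Longrightarrow> Re s \<le> \<sigma> \<Longrightarrow> norm (gamma_pair s) \<le> C * (1 + \<bar>Im s\<bar>)
      * exp (- pi * \<bar>Im s\<bar>)"
    using gamma_pair_bound[of "\<sigma> - 1" \<sigma>] \<sigma> by auto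
  have bound: "norm (f s) \<le> (C * (exp d / d) * exp \<bar>Re l\<bar>) * exp (- d * \<bar>Im s\<bar>)"
      if s: "\<sigma> - 1 \<le> Re s" "Re s \<le> \<sigma>" for s
  proof -
    have "\<bar>Re l * Re s\<bar> \<le> \<bar>Re l\<bar> * 1"
      unfolding abs_mult using s \<sigma> by (intro mult_left_mono) auto
    moreover have "\<bar>Im l * Im s\<bar> \<le> \<bar>Im l\<bar> * \<bar>Im s\<bar>" by (simp add: abs_mult)
    ultimately have "Re (- l * s) \<le> \<bar>Re l\<bar> + \<bar>Im l\<bar> * \<bar>Im s\<bar>" by (simp add: abs_le_iff)
    hence 1: "norm (exp (- l * s)) \<le> exp (\<bar>Re l\<bar> + \<bar>Im l\<bar> * \<bar>Im s\<bar>)" by simp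
    have "1 + \<bar>Im s\<bar> \<le> exp d / d * exp (d * \<bar>Im s\<bar>)"
      using le_exp_div[OF d, of "1 + \<bar>Im s\<bar>"] by (simp add: ring_distribs exp_add)
    hence "C * (1 + \<bar>Im s\<bar>) * exp (- pi * \<bar>Im s\<bar>) \<le> C * (exp d / d * exp (d * \<bar>Im s\<bar>))
        * exp (- pi * \<bar>Im s\<bar>)"
      using C(1) d by (intro mult_mono) auto
    with C(2)[OF s] have "norm (gamma_pair s) \<le> C * (exp d / d * exp (d * \<bar>Im s\<bar>))
        * exp (- pi * \<bar>Im s\<bar>)"
      by linarith
    with 1 have "norm (f s) \<le> C * (exp d / d * exp (d * \<bar>Im s\<bar>)) * exp (- pi * \<bar>Im s\<bar>) * exp (\<bar>Re l\<bar>
        + \<bar>Im l\<bar> * \<bar>Im s\<bar>)"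
      unfolding f_def norm_mult by (intro mult_mono) (use C d in auto)
    also have "\<dots> = C * (exp d / d) * exp \<bar>Re l\<bar> * exp (d * \<bar>Im s\<bar>
        + (- pi * \<bar>Im s\<bar> + \<bar>Im l\<bar> * \<bar>Im s\<bar>))"
      by (simp only: exp_add) (simp add: mult_ac)
    also have "d * \<bar>Im s\<bar> + (- pi * \<bar>Im s\<bar> + \<bar>Im l\<bar> * \<bar>Im s\<bar>) = - d * \<bar>Im s\<bar>"
      by (simp add: d_def field_simps)
    finally show ?thesis .
  qed
  have "f holomorphic_on {s. - 1 < Re s \<and> Re s < 1}"
    unfolding f_def by (intro holomorphic_intros holomorphic_gamma_pair)
  note shift = strip_line_difference[where p = 0 and a = "\<sigma> - 1" and b = \<sigma>, OF this _ _ _ _ d bound]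
  have *: "integrable lborel (\<lambda>v. f (Complex \<sigma> v) / Complex \<sigma> v)"
    "(LINT v|lborel. f (Complex \<sigma> v) / Complex \<sigma> v)
        - (LINT v|lborel. f (Complex (\<sigma> - 1) v) / Complex (\<sigma> - 1) v)
        = 2 * of_real pi"
    using shift(2,3) \<sigma> by (simp_all add: f_def)
  have "f (Complex (\<sigma> - 1) v) / Complex (\<sigma> - 1) v = - exp l * (f (Complex \<sigma> v) / Complex \<sigma> v)" for v
  proof -
    define s where "s = Complex \<sigma> v"
    have s': "Complex (\<sigma> - 1) v = s - 1" by (simp add: s_def complex_eq_iff)
    have nz: "s \<noteq> 0" "s - 1 \<noteq> 0" using \<sigma> by (auto simp: s_def complex_eq_iff)
    have "gamma_pair s / s = of_real pi / sin (of_real pi * s)"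
      using gamma_pair_eq[of s] nz \<sigma> by (simp add: s_def)
    moreover have "gamma_pair (s - 1) / (s - 1) = of_real pi / sin (of_real pi * (s - 1))"
      using gamma_pair_eq[of "s - 1"] nz \<sigma> by (simp add: s_def)
    moreover have "sin (of_real pi * (s - 1)) = - sin (of_real pi * s)"
      by (simp add: ring_distribs sin_diff)
    moreover have "exp (- l * (s - 1)) = exp l * exp (- l * s)"
      by (simp add: ring_distribs flip: exp_add)
    moreover have "f (s - 1) / (s - 1) = gamma_pair (s - 1) / (s - 1) * exp (- l * (s - 1))"
      "f s / s = gamma_pair s / s * exp (- l * s)" by (simp_all add: f_def)
    ultimately show ?thesis unfolding s' s_def[symmetric] by simp
  qed
  hence "(LINT v|lborel. f (Complex (\<sigma> - 1) v) / Complex (\<sigma> - 1) v)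
      = - exp l * (LINT v|lborel. f (Complex \<sigma> v) / Complex \<sigma> v)"
    by (simp only: integral_mult_right_zero)
  with *(2) have "(LINT v|lborel. f (Complex \<sigma> v) / Complex \<sigma> v) * (1 + exp l) = 2 * of_real pi"
    by (simp add: algebra_simps)
  moreover from this have "1 + exp l \<noteq> 0" by auto
  ultimately have "(LINT v|lborel. f (Complex \<sigma> v) / Complex \<sigma> v) = 2 * of_real pi / (1 + exp l)"
    by (simp add: eq_divide_eq)
  with *(1) show ?int ?eq by (simp_all add: f_def)
qed

text \<open>The change of variables speaks about the completed Lebesgue measure, the Fubini
  arguments about \<open>lborel\<close>; this is the passage between them.\<close>

lemma absolutely_integrable_on_iff_lborel:
  fixes f :: "real \<Rightarrow> complex"
  assumes "f \<in> borel_measurable borel" "S \<in> sets borel"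
  shows "f absolutely_integrable_on S \<longleftrightarrow> set_integrable lborel S f"
  unfolding set_integrable_def
  by (rule integrable_completion)
      (use assms in \<open>auto intro!: borel_measurable_scaleR borel_measurable_indicator\<close>)

text \<open>
  The substitution \<open>u = \<theta> exp (pi v)\<close> leads to the previous integral on the line \<open>Re s = 1/2\<close> with
  \<open>l = \<i> pi w\<close>.
\<close>

lemma integral_rpow_div_sum_squares:
  assumes w: "- 1 < Re w" "Re w < 1" and \<theta>: "\<theta> > 0"
  shows "set_integrable lborel {0<..} (\<lambda>u. rpow u w / of_real (u\<^sup>2 + \<theta>\<^sup>2))"
    and "(LINT u:{0<..}|lborel. rpow u w / of_real (u\<^sup>2 + \<theta>\<^sup>2))
           = rpow \<theta> (w - 1) * of_real pi / (2 * cos (of_real pi * w / 2))"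
proof -
  define l where "l = \<i> * of_real pi * w"
  have l: "\<bar>Im l\<bar> < pi" using w by (auto simp: l_def abs_mult abs_less_iff)
  define K where "K = (\<lambda>v. gamma_pair (Complex (1/2) v) / Complex (1/2) v
      * exp (- l * Complex (1/2) v))"
  have K: "integrable lborel K" "(LINT v|lborel. K v) = 2 * of_real pi / (1 + exp l)"
    unfolding K_def using integral_exp_div_sin[of "1/2" l] l by auto
  define f where "f = (\<lambda>u. rpow u w / of_real (u\<^sup>2 + \<theta>\<^sup>2))"
  define g where "g = (\<lambda>v. \<theta> * exp (pi * v))"
  have Kv: "(pi * g v) *\<^sub>R f (g v) = (rpow \<theta> (w - 1) * exp (l / 2) / 2) * K v" for v
  proof -
    define s where "s = Complex (1/2) v"
    have "s \<noteq> 0" by (auto simp: s_def complex_eq_iff)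
    hence "gamma_pair s / s = of_real pi / sin (of_real pi * s)"
      using gamma_pair_eq[of s] by (simp add: s_def)
    also have "of_real pi * s = of_real pi / 2 + \<i> * of_real (pi * v)"
      by (auto simp: s_def complex_eq_iff)
    also have "sin \<dots> = cos (\<i> * of_real (pi * v))"
      unfolding sin_add by simp
    also have "\<dots> = of_real (cosh (pi * v))"
      by (simp add: cosh_def cos_exp_eq exp_of_real[symmetric] scaleR_conv_of_real mult_ac)
    finally have 1: "gamma_pair s / s = of_real (pi / cosh (pi * v))" by simp
    have "- l * s + l / 2 = w * of_real (pi * v)"
      by (simp add: l_def s_def complex_eq_iff algebra_simps)
    hence 2: "exp (l / 2) * exp (- l * s) = exp (w * of_real (pi * v))"
      by (metis mult_exp_exp add.commute)
    have 3: "(rpow \<theta> (w - 1) * exp (l / 2) / 2) * K v = rpow \<theta> (w - 1) / 2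
        * exp (w * of_real (pi * v)) * of_real (pi / cosh (pi * v))"
      unfolding K_def s_def[symmetric] 1 by (simp only: 2[symmetric]) (simp add: mult_ac)
    have 4: "f (g v) = rpow \<theta> w * exp (w * of_real (pi * v)) / of_real ((g v)\<^sup>2 + \<theta>\<^sup>2)"
      using \<theta> by (simp add: f_def g_def rpow_def ln_mult ring_distribs exp_add)
    have 5: "rpow \<theta> w = rpow \<theta> (w - 1) * of_real \<theta>"
      using rpow_add[of \<theta> "w - 1" 1] rpow_of_real[of \<theta> 1] \<theta> by simp
    \<comment> \<open>With u = \<theta> exp (pi v) the sum of squares is u \<theta> times 2 cosh (pi
      v). Together with the derivative pi u of the substitution this produces the kernel pi / cosh
      (pi v).\<close>
    have "pi * g v * \<theta> / ((g v)\<^sup>2 + \<theta>\<^sup>2) = pi / (2 * cosh (pi * v))"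
    proof -
      have "(g v)\<^sup>2 + \<theta>\<^sup>2 = g v * \<theta> * (2 * cosh (pi * v))"
        by (simp add: g_def cosh_def power2_eq_square exp_minus field_simps)
      thus ?thesis using \<theta> by (simp add: g_def)
    qed
    hence 6: "of_real (pi * g v * \<theta> / ((g v)\<^sup>2 + \<theta>\<^sup>2)) = complex_of_real (pi / (2 * cosh (pi * v)))"
      by simp
    have "of_real (pi * g v) * f (g v) = rpow \<theta> (w - 1) * exp (w * of_real (pi * v))
        * of_real (pi * g v * \<theta> / ((g v)\<^sup>2 + \<theta>\<^sup>2))"
      unfolding 4 5 by (simp add: mult_ac)
    hence "of_real (pi * g v) * f (g v) = rpow \<theta> (w - 1) * exp (w * of_real (pi * v))
        * of_real (pi / (2 * cosh (pi * v)))"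
      unfolding 6 .
    thus ?thesis unfolding 3 by (simp add: scaleR_conv_of_real)
  qed
  define b where "b = (rpow \<theta> (w - 1) * exp (l / 2) / 2) * (2 * of_real pi / (1 + exp l))"
  have int: "integrable lborel (\<lambda>v. (pi * g v) *\<^sub>R f (g v))" "(LINT v|lborel. (pi * g v) *\<^sub>R f (g v))
      = b"
    unfolding Kv b_def using K(1) by (simp, simp only: integral_mult_right_zero K(2))
  have meas: "f \<in> borel_measurable borel" unfolding f_def by measurable
  have abs: "\<bar>pi * g v\<bar> = pi * g v" for v using \<theta> by (simp add: g_def)
  have "(\<lambda>v. \<bar>pi * g v\<bar> *\<^sub>R f (g v)) absolutely_integrable_on UNIV
      \<and> integral UNIV (\<lambda>v. \<bar>pi * g v\<bar> *\<^sub>R f (g v)) = b"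
    unfolding abs using int has_integral_integral_lborel[OF int(1)]
    by (simp add: set_integrable_def integrable_completion borel_measurable_integrable
        integral_unique)
  hence "f absolutely_integrable_on g ` UNIV \<and> integral (g ` UNIV) f = b"
    by (subst (asm) has_absolute_integral_change_of_variables_real)
       (use \<theta> in \<open>auto simp: g_def inj_on_def intro!: derivative_eq_intros\<close>)
  moreover have "g ` UNIV = {0<..}"
  proof -
    have "x \<in> range g" if "x > 0" for x
      using \<theta> that by (intro image_eqI[of _ _ "ln (x / \<theta>) / pi"]) (auto simp: g_def)
    thus ?thesis using \<theta> by (auto simp: g_def)
  qed
  ultimately have fin: "set_integrable lborel {0<..} f" "integral {0<..} f = b"
    using absolutely_integrable_on_iff_lborel[OF meas] by auto
  thus "set_integrable lborel {0<..} (\<lambda>u. rpow u w / of_real (u\<^sup>2 + \<theta>\<^sup>2))"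
    by (simp add: f_def)
  \<comment> \<open>Taking exp (l / 2) out of 1 + exp l cancels the same factor in \<open>b\<close>.
    A cosine is left because l / 2 = i pi w / 2.\<close>
  have "exp (l / 2) * (exp (- (l / 2)) + exp (l / 2)) = 1 + exp l"
    by (simp add: ring_distribs flip: exp_add)
  moreover have "exp (- (l / 2)) + exp (l / 2) = 2 * cos (of_real pi * w / 2)"
    by (simp add: cos_exp_eq l_def mult_ac)
  ultimately have ex: "1 + exp l = exp (l / 2) * (2 * cos (of_real pi * w / 2))" by simp
  have "b = rpow \<theta> (w - 1) * of_real pi / (2 * cos (of_real pi * w / 2))"
    unfolding b_def ex by simp
  moreover have "(LINT u:{0<..}|lborel. f u) = integral {0<..} f"
    using fin(1) by (rule set_borel_integral_eq_integral)
  ultimately show "(LINT u:{0<..}|lborel. rpow u w / of_real (u\<^sup>2 + \<theta>\<^sup>2))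
           = rpow \<theta> (w - 1) * of_real pi / (2 * cos (of_real pi * w / 2))"
    using fin(2) by (simp add: f_def)
qed

subsection \<open>Improper integrals\<close>

lemma has_integral_imp_tendsto_at_top:
  fixes f :: "real \<Rightarrow> 'a :: banach"
  assumes "(f has_integral I) {0..}"
  shows "((\<lambda>T. integral {0..T} f) \<longlongrightarrow> I) at_top"
proof (rule tendstoI)
  fix e :: real assume "e > 0"
  with assms obtain B where B: "B > 0" "\<And>a b. ball 0 B \<subseteq> cbox a b
      \<Longrightarrow> norm (integral (cbox a b) (\<lambda>x. if x \<in> {0..} then f x else 0) - I) < e"
    unfolding has_integral_alt' by blast
  show "\<forall>\<^sub>F T in at_top. dist (integral {0..T} f) I < e"
    using eventually_ge_at_top[of B]
  proof eventually_elim
    case (elim T)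
    have "{- T..T} \<inter> {0..} = {0..T}" using B elim by auto
    hence "integral {- T..T} (\<lambda>x. if x \<in> {0..} then f x else 0) = integral {0..T} f"
      by (simp only: Henstock_Kurzweil_Integration.integral_restrict_Int Int_commute)
    moreover have "ball 0 B \<subseteq> cbox (- T) T"
      using elim by (auto simp: dist_real_def)
    ultimately show ?case using B(2)[of "- T" T] by (simp add: dist_norm)
  qed
qed

text \<open>Lebesgue integrals are taken over intervals open at an end point, where powers may be
  singular or have a junk value; the gauge integrals of the definitions include that point.\<close>

lemma set_integrable_imp_has_integral:
  fixes f :: "real \<Rightarrow> 'a :: euclidean_space"
  assumes "set_integrable lborel S f" "S \<subseteq> T" "T - S \<subseteq> {a}"
  shows "(f has_integral (LINT t:S|lborel. f t)) T"
proof -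
  have "(f has_integral (LINT t:S|lborel. f t)) S"
    using set_borel_integral_eq_integral[OF assms(1)] by (simp add: has_integral_iff)
  moreover have "negligible {x \<in> S - T. f x \<noteq> 0}"
    by (rule negligible_subset[of "{}"]) (use assms(2) in auto)
  moreover have "negligible {x \<in> T - S. f x \<noteq> 0}"
    by (rule negligible_subset[of "{a}"]) (use assms(3) in auto)
  ultimately show ?thesis
    using has_integral_spike_set_eq by blast
qed

text \<open>The gauge integral over the whole line only tests boxes containing a large ball, and
  such a box splits at 0 into two truncations that converge separately. No absolute integrability is
  involved.\<close>

lemma has_integral_UNIV_improper:
  fixes f :: "real \<Rightarrow> 'a :: banach"
  assumes int: "\<And>T. T \<ge> 0 \<Longrightarrow> f integrable_on {0..T}" "\<And>T. T \<ge> 0 \<Longrightarrow> (\<lambda>x. f (- x)) integrable_on {0..T}"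
    and lim: "((\<lambda>T. integral {0..T} f) \<longlongrightarrow> A) at_top" "((\<lambda>T. integral {0..T} (\<lambda>x. f (- x))) \<longlongrightarrow> B)
        at_top"
  shows "(f has_integral A + B) UNIV"
proof -
  have neg: "f integrable_on {- T..0}" "integral {- T..0} f = integral {0..T} (\<lambda>x. f (- x))"
      if "T \<ge> 0" for T
    using int(2)[OF that] Henstock_Kurzweil_Integration.integrable_reflect_real[where a
        = "- T" and b = 0 and f = f] Henstock_Kurzweil_Integration.integral_reflect_real[where a
        = "- T" and b = 0 and f = f] by auto
  have seg: "f integrable_on {a..b}" "integral {a..b} f = integral {0..- a} (\<lambda>x. f (- x))
      + integral {0..b} f" if "a \<le> 0" "b \<ge> 0" for a b
  proof -
    show *: "f integrable_on {a..b}"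
      by (rule Henstock_Kurzweil_Integration.integrable_combine[where c = 0])
          (use that neg(1)[of "- a"] int in auto)
    show "integral {a..b} f = integral {0..- a} (\<lambda>x. f (- x)) + integral {0..b} f"
      using Henstock_Kurzweil_Integration.integral_combine[OF that *] neg(2)[of "- a"] that by simp
  qed
  have "f integrable_on {a..b}" for a b
    by (rule integrable_on_subinterval[OF seg(1)[of "min a 0" "max b 0"]]) auto
  moreover have "\<exists>R>0. \<forall>a b. ball 0 R \<subseteq> cbox a b \<longrightarrow> norm (integral (cbox a b) f - (A + B)) < e"
      if "e > 0" for e
  proof -
    from that lim have "\<forall>\<^sub>F T in at_top. norm (integral {0..T} f - A) < e / 2
        \<and> norm (integral {0..T} (\<lambda>x. f (- x)) - B) < e / 2"
      unfolding tendsto_iff dist_norm by (intro eventually_conj) (auto elim!: allE[of _ "e / 2"])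
    then obtain R where R: "\<And>T. T \<ge> R \<Longrightarrow> norm (integral {0..T} f - A) < e / 2
        \<and> norm (integral {0..T} (\<lambda>x. f (- x)) - B) < e / 2"
      unfolding eventually_at_top_linorder by blast
    define R' where "R' = max R 1"
    \<comment> \<open>The radius is doubled so that both points \<open>R'\<close> and
      \<open>- R'\<close> lie in the open ball.\<close>
    have "norm (integral (cbox a b) f - (A + B)) < e" if sub: "ball 0 (2 * R') \<subseteq> cbox a b" for a b
    proof -
      have "R' \<in> ball 0 (2 * R')" "- R' \<in> ball 0 (2 * R')" by (auto simp: R'_def)
      with sub have "R' \<in> cbox a b" "- R' \<in> cbox a b" by blast+
      hence ab: "a \<le> - R'" "R' \<le> b" by auto
      hence "integral (cbox a b) f - (A + B) = (integral {0..- a} (\<lambda>x. f (- x)) - B)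
          + (integral {0..b} f - A)"
        using seg(2)[of a b] by (simp add: R'_def)
      also have "norm \<dots> < e / 2 + e / 2"
        using ab R[of b] R[of "- a"] by (intro norm_add_less) (auto simp: R'_def)
      finally show ?thesis by simp
    qed
    moreover have "2 * R' > 0" by (simp add: R'_def)
    ultimately show ?thesis by blast
  qed
  ultimately show ?thesis unfolding has_integral_alt' by simp
qed

subsection \<open>Laplace transforms\<close>

text \<open>Euler's integral after the scaling t = p u. It is read in two ways: as the Laplace
  transform of a power of time, and as a representation of a power of p by exponentials.\<close>

lemma laplace_rpow:
  assumes z: "Re z > 0" and p: "p > 0"
  shows "set_integrable lborel {0<..} (\<lambda>u. rpow u (z - 1) * of_real (exp (- (p * u))))"
    and "(LINT u:{0<..}|lborel. rpow u (z - 1) * of_real (exp (- (p * u))))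
        = Gamma z * rpow p (- z)"
proof -
  define f where "f = (\<lambda>u. rpow u (z - 1) * complex_of_real (exp (- u)))"
  define h where "h = (\<lambda>u. rpow u (z - 1) * complex_of_real (exp (- (p * u))))"
  have eq: "complex_of_real t powr (z - 1) / of_real (exp t) = f t" if "t \<in> {0<..}" for t
    using that by (simp add: f_def powr_eq_rpow exp_minus divide_inverse)
  have f: "f absolutely_integrable_on {0<..}" "integral {0<..} f = Gamma z"
    using absolutely_integrable_Gamma_integral'[OF z]
        has_integral_eq[OF eq Gamma_integral_complex'[OF z]]
    by (auto intro: set_integrable_cong[THEN iffD1, OF refl refl eq] integral_unique)
  have img: "(\<lambda>t. p * t) ` {0<..} = {0<..}"
    using p by (auto simp: image_iff intro!: bexI[of _ "_ / p"])
  have "(\<lambda>t. \<bar>p\<bar> *\<^sub>R f (p * t)) absolutely_integrable_on {0<..} \<and> integral {0<..}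
      (\<lambda>t. \<bar>p\<bar> *\<^sub>R f (p * t)) = Gamma z"
    by (subst has_absolute_integral_change_of_variables_real)
       (use f p in \<open>auto simp: img inj_on_def intro!: derivative_eq_intros\<close>)
  hence *: "(\<lambda>t. \<bar>p\<bar> *\<^sub>R f (p * t)) absolutely_integrable_on {0<..}"
      "integral {0<..} (\<lambda>t. \<bar>p\<bar> *\<^sub>R f (p * t)) = Gamma z"
    by blast+
  have fp: "\<bar>p\<bar> *\<^sub>R f (p * t) = rpow p z * h t" if "t \<in> {0<..}" for t
    using p that rpow_add[of p "z - 1" 1] rpow_of_real[of p 1]
    by (simp add: f_def h_def rpow_mult scaleR_conv_of_real)
  have "(\<lambda>t. rpow p z * h t) absolutely_integrable_on {0<..}" "integral {0<..} (\<lambda>t. rpow p z * h t)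
      = Gamma z"
    using set_integrable_cong[OF refl refl, THEN iffD1, OF _ *(1), of "\<lambda>t. rpow p z * h t"]
      Henstock_Kurzweil_Integration.integral_cong[of "{0<..}" "\<lambda>t. \<bar>p\<bar> *\<^sub>R f (p * t)"
          "\<lambda>t. rpow p z * h t"] *(2) fp by simp_all
  moreover have "h \<in> borel_measurable borel" unfolding h_def by measurable
  ultimately have h: "set_integrable lborel {0<..} h" "integral {0<..} h = Gamma z / rpow p z"
    by (auto simp: absolutely_integrable_on_iff_lborel field_simps)
  thus "set_integrable lborel {0<..} (\<lambda>u. rpow u (z - 1) * of_real (exp (- (p * u))))"
    by (simp add: h_def)
  show "(LINT u:{0<..}|lborel. rpow u (z - 1) * of_real (exp (- (p * u)))) = Gamma z * rpow p (- z)"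
    using h(2) set_borel_integral_eq_integral(2)[OF h(1)]
    by (simp add: h_def rpow_minus divide_inverse)
qed

lemma set_integrable_of_real_iff:
  "set_integrable M A (\<lambda>x. complex_of_real (f x)) \<longleftrightarrow> set_integrable M A f"
  unfolding set_integrable_def
  by (subst complex_of_real_integrable_eq[symmetric]) (simp add: scaleR_conv_of_real)

lemma laplace_powr:
  fixes a p :: real
  assumes a: "a > 0" and p: "p > 0"
  shows "set_integrable lborel {0<..} (\<lambda>u. u powr (a - 1) * exp (- (p * u)))"
    and "(LINT u:{0<..}|lborel. u powr (a - 1) * exp (- (p * u))) = Gamma a * p powr (- a)"
proof -
  have eq: "rpow u (of_real a - 1) * of_real (exp (- (p * u)))
      = complex_of_real (u powr (a - 1) * exp (- (p * u)))" if "u \<in> {0<..}" for u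
    using that rpow_of_real[of u "a - 1"] by simp
  have "set_integrable lborel {0<..} (\<lambda>u. complex_of_real (u powr (a - 1) * exp (- (p * u))))"
    using laplace_rpow(1)[of "of_real a" p] a p eq
    by (subst set_integrable_cong[OF refl refl, of _ _
        "\<lambda>u. rpow u (of_real a - 1) * of_real (exp (- (p * u)))"]) auto
  thus *: "set_integrable lborel {0<..} (\<lambda>u. u powr (a - 1) * exp (- (p * u)))"
    by (simp only: set_integrable_of_real_iff)
  have "(LINT u:{0<..}|lborel. complex_of_real (u powr (a - 1) * exp (- (p * u))))
      = Gamma (of_real a) * rpow p (- of_real a)"
    using laplace_rpow(2)[of "of_real a" p] a p eq
    by (subst set_lebesgue_integral_cong[of _ _ _
        "\<lambda>u. rpow u (of_real a - 1) * of_real (exp (- (p * u)))"]) auto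
  also have "\<dots> = of_real (Gamma a * p powr (- a))"
    using rpow_of_real[of p "- a"] p by (simp add: Gamma_complex_of_real)
  finally show "(LINT u:{0<..}|lborel. u powr (a - 1) * exp (- (p * u))) = Gamma a * p powr (- a)"
    unfolding set_integral_complex_of_real of_real_eq_iff .
qed

section \<open>Lerch's uniqueness theorem\<close>

text \<open>By Weierstrass, f is uniformly close to a polynomial q; since q f integrates to 0, the
  integral of f^2 is arbitrarily small.\<close>

lemma moments_zero_imp_zero:
  fixes f :: "real \<Rightarrow> real"
  assumes cont: "continuous_on {0..1} f" and mom: "\<And>n::nat. integral {0..1} (\<lambda>x. x ^ n * f x) = 0"
    and x: "x \<in> {0..1}"
  shows "f x = 0"
proof -
  have poly: "integral {0..1} (\<lambda>x. q x * f x) = 0" if q: "real_polynomial_function q" for q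
  proof -
    obtain a n where q: "q = (\<lambda>x. \<Sum>i\<le>n. a i * x ^ i)"
      using q real_polynomial_function_iff_sum by blast
    have "integral {0..1} (\<lambda>x. q x * f x) = integral {0..1} (\<lambda>x. \<Sum>i\<le>n. a i * (x ^ i * f x))"
      by (simp add: q sum_distrib_right mult.assoc)
    also have "\<dots> = (\<Sum>i\<le>n. integral {0..1} (\<lambda>x. a i * (x ^ i * f x)))"
      by (intro integral_sum integrable_continuous_interval continuous_intros cont) auto
    also have "\<dots> = 0" by (simp add: mom)
    finally show ?thesis .
  qed
  have int: "(\<lambda>x. f x * f x) integrable_on {0..1}" "(\<lambda>x. \<bar>f x\<bar>) integrable_on {0..1}"
    by (intro integrable_continuous_interval continuous_intros cont)+
  define M where "M = integral {0..1} (\<lambda>x. \<bar>f x\<bar>)"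
  have M: "M \<ge> 0" unfolding M_def by (intro Henstock_Kurzweil_Integration.integral_nonneg int) auto
  have "integral {0..1} (\<lambda>x. f x * f x) \<le> e" if e: "e > 0" for e
  proof -
    \<comment> \<open>The error is weighted by the integral M of |f|; the summand 1 keeps the
      quotient meaningful when M = 0.\<close>
    obtain q where q: "real_polynomial_function q" "\<And>x. x \<in> {0..1} \<Longrightarrow> \<bar>f x - q x\<bar> < e / (M + 1)"
      using Stone_Weierstrass_real_polynomial_function[OF compact_Icc cont, of "e / (M + 1)"] e M
          by auto
    have cq: "continuous_on {0..1} q"
      using q(1) by (simp add: real_polynomial_function_eq continuous_on_polymonial_function)
    have "integral {0..1} (\<lambda>x. f x * f x) = integral {0..1} (\<lambda>x. f x * f x) - integral {0..1}
        (\<lambda>x. q x * f x)"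
      using poly[OF q(1)] by simp
    also have "\<dots> = integral {0..1} (\<lambda>x. f x * f x - q x * f x)"
      by (intro Henstock_Kurzweil_Integration.integral_diff[symmetric]
          integrable_continuous_interval continuous_intros cont cq)
    also have "\<dots> \<le> integral {0..1} (\<lambda>x. e / (M + 1) * \<bar>f x\<bar>)"
    proof (intro integral_le integrable_continuous_interval continuous_intros cont cq)
      fix x :: real assume x: "x \<in> {0..1}"
      have "f x * f x - q x * f x \<le> \<bar>f x - q x\<bar> * \<bar>f x\<bar>"
        by (simp add: left_diff_distrib[symmetric] abs_mult[symmetric])
      also have "\<dots> \<le> e / (M + 1) * \<bar>f x\<bar>" using q(2)[OF x] by (intro mult_right_mono) auto
      finally show "f x * f x - q x * f x \<le> e / (M + 1) * \<bar>f x\<bar>" .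
    qed
    also have "\<dots> = e * (M / (M + 1))" by (simp add: M_def)
    also have "\<dots> \<le> e" using M e by (intro mult_left_le) auto
    finally show ?thesis .
  qed
  hence "integral {0..1} (\<lambda>x. f x * f x) \<le> 0" by (rule field_le_epsilon) simp
  moreover have "integral {0..1} (\<lambda>x. f x * f x) \<ge> 0"
    by (intro Henstock_Kurzweil_Integration.integral_nonneg int) auto
  ultimately have "integral {0..1} (\<lambda>x. f x * f x) = 0" by simp
  hence "f x * f x = 0"
    using integral_eq_0_iff[of 0 1 "\<lambda>x. f x * f x"] continuous_on_mult[OF cont cont] x by simp
  thus ?thesis by simp
qed

text \<open>The given integrals may converge only conditionally, so g is first replaced by the
  primitive \<open>G\<close> of exp (- s1 t) g t, which is continuous and tends to 0. Under x = exp
  (- t) its Laplace integrals at positive integers become the moments of a continuous function on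
  [0, 1].\<close>

lemma laplace_unique_real:
  fixes g :: "real \<Rightarrow> real"
  assumes cont: "continuous_on {0<..} g"
    and lap: "\<And>s. s > s0 \<Longrightarrow> ((\<lambda>t. exp (- (s * t)) * g t) has_integral 0) {0..}"
    and t: "t > 0"
  shows "g t = 0"
proof -
  define s1 where "s1 = s0 + 1"
  define \<phi> where "\<phi> = (\<lambda>t. exp (- (s1 * t)) * g t)"
  define G where "G = (\<lambda>t. integral {0..t} \<phi>)"
  have "(\<phi> has_integral 0) {0..}" using lap[of s1] by (simp add: s1_def \<phi>_def)
  hence int: "\<phi> integrable_on {0..T}" for T
    using integrable_on_subinterval[of \<phi> "{0..}" 0 T] by (auto simp: has_integral_iff)
  have G_lim: "(G \<longlongrightarrow> 0) at_top"
    unfolding G_def by (rule has_integral_imp_tendsto_at_top) fact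
  have contG: "continuous_on {0..T} G" for T
    unfolding G_def by (rule indefinite_integral_continuous_1[OF int])
  have G0: "G 0 = 0" by (simp add: G_def)
  have derivG: "(G has_vector_derivative \<phi> x) (at x)" if "x > 0" for x
  proof -
    have "continuous_on {0<..} \<phi>" unfolding \<phi>_def by (intro continuous_intros cont)
    hence "continuous (at x) \<phi>" using that by (simp add: continuous_on_eq_continuous_at)
    hence "continuous (at x within {0..x+1}) \<phi>" by (rule continuous_at_imp_continuous_at_within)
    hence "((\<lambda>u. integral {0..u} \<phi>) has_vector_derivative \<phi> x) (at x within {0..x+1})"
      using that integral_has_vector_derivative_continuous_at[OF int, of x "x + 1" "{}"] by simp
    thus ?thesis using that by (simp add: G_def at_within_Icc_at)
  qed
  \<comment> \<open>The value at 0 is the limit of \<open>G\<close> at infinity, which makes \<psi>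
    continuous on the closed interval.\<close>
  define \<psi> where "\<psi> = (\<lambda>x. if x = 0 then 0 else G (- ln x))"
  have cont\<psi>: "continuous_on {0..1} \<psi>"
    unfolding continuous_on_eq_continuous_within
  proof
    fix x :: real assume x: "x \<in> {0..1}"
    show "continuous (at x within {0..1}) \<psi>"
    proof (cases "x = 0")
      case True
      have "((\<lambda>x. G (- ln x)) \<longlongrightarrow> 0) (at_right 0)"
        by (rule filterlim_compose[OF G_lim]) real_asymp
      moreover have "\<forall>\<^sub>F x in at_right 0. G (- ln x) = \<psi> x"
        using eventually_at_right_less[of "0::real"] by eventually_elim (simp add: \<psi>_def)
      ultimately have "(\<psi> \<longlongrightarrow> 0) (at_right 0)"
        by (rule Lim_transform_eventually)
      thus ?thesis using True by (simp add: continuous_within \<psi>_def at_within_Icc_at_right)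
    next
      case False
      have "continuous_on {x/2..1} (\<lambda>x. G (- ln x))"
        using x False by (intro continuous_on_compose2[OF contG[of "- ln (x/2)"]] continuous_intros)
            auto
      hence "continuous_on {x/2..1} \<psi>"
        by (rule continuous_on_eq) (use x False in \<open>auto simp: \<psi>_def\<close>)
      hence "continuous (at x within {x/2..1}) \<psi>"
        using x False by (auto simp: continuous_on_eq_continuous_within)
      moreover have "at x within {x/2..1} = at x within {0..1}"
        by (rule at_within_nhd[of _ "{x/2<..<2}"]) (use x False in auto)
      ultimately show ?thesis by (simp add: continuous_within)
    qed
  qed
  have "integral {0..1} (\<lambda>x. x ^ n * \<psi> x) = 0" for n
  proof -
    \<comment> \<open>The exponent exceeds n by one because dx = - exp (- t) dt supplies another
      power of x.\<close>
    define k where "k = real (Suc n)"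
    \<comment> \<open>Integration by parts, which transfers the known vanishing for
      \<open>\<phi>\<close> to \<open>G\<close>.\<close>
    have parts: "integral {0..T} (\<lambda>t. exp (- (k * t)) * G t)
        = (integral {0..T} (\<lambda>t. exp (- (k * t)) * \<phi> t) - exp (- (k * T)) * G T) / k" if "T \<ge> 0"
        for T
    proof -
      have "((\<lambda>t. exp (- (k * t)) * \<phi> t - k * (exp (- (k * t)) * G t))
          has_integral (exp (- (k * T)) * G T - exp (- (k * 0)) * G 0)) {0..T}"
      proof (rule fundamental_theorem_of_calculus_interior)
        fix x assume "x \<in> {0<..<T}"
        hence "(G has_real_derivative \<phi> x) (at x)"
          using derivG by (simp add: has_real_derivative_iff_has_vector_derivative)
        hence "((\<lambda>t. exp (- (k * t)) * G t) has_real_derivative exp (- (k * x)) * \<phi> x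
            - k * (exp (- (k * x)) * G x)) (at x)"
          by (auto intro!: derivative_eq_intros)
        thus "((\<lambda>t. exp (- (k * t)) * G t) has_vector_derivative exp (- (k * x)) * \<phi> x
            - k * (exp (- (k * x)) * G x)) (at x)"
          by (simp add: has_real_derivative_iff_has_vector_derivative)
      qed (intro continuous_intros contG that)+
      moreover have "((\<lambda>t. k * (exp (- (k * t)) * G t)) has_integral k * integral {0..T}
          (\<lambda>t. exp (- (k * t)) * G t)) {0..T}"
        by (intro has_integral_mult_right integrable_integral integrable_continuous_interval
            continuous_intros contG)
      ultimately have "((\<lambda>t. (exp (- (k * t)) * \<phi> t - k * (exp (- (k * t)) * G t))
          + k * (exp (- (k * t)) * G t)) has_integral
          (exp (- (k * T)) * G T - exp (- (k * 0)) * G 0) + k * integral {0..T}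
              (\<lambda>t. exp (- (k * t)) * G t)) {0..T}"
        by (rule has_integral_add)
      hence "integral {0..T} (\<lambda>t. exp (- (k * t)) * \<phi> t) = exp (- (k * T)) * G T
          + k * integral {0..T} (\<lambda>t. exp (- (k * t)) * G t)"
        by (simp add: integral_unique G0)
      thus ?thesis by (simp add: k_def field_simps)
    qed
    have "exp (- (k * t)) * \<phi> t = exp (- ((k + s1) * t)) * g t" for t
      by (simp add: \<phi>_def ring_distribs flip: exp_add)
    moreover have "k + s1 > s0" by (simp add: k_def s1_def)
    ultimately have "((\<lambda>t. exp (- (k * t)) * \<phi> t) has_integral 0) {0..}"
      using lap[of "k + s1"] by simp
    from has_integral_imp_tendsto_at_top[OF this]
    have "((\<lambda>T. (integral {0..T} (\<lambda>t. exp (- (k * t)) * \<phi> t) - exp (- (k * T)) * G T) / k)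
        \<longlongrightarrow> (0 - 0 * 0) / k) at_top"
      by (rule tendsto_divide[OF tendsto_diff[OF _ tendsto_mult[OF _ G_lim]] tendsto_const])
         (auto simp: k_def, real_asymp)
    hence "((\<lambda>T. (integral {0..T} (\<lambda>t. exp (- (k * t)) * \<phi> t) - exp (- (k * T)) * G T) / k) \<longlongrightarrow> 0)
        at_top"
      by simp
    hence lim1: "((\<lambda>T. integral {0..T} (\<lambda>t. exp (- (k * t)) * G t)) \<longlongrightarrow> 0) at_top"
      by (rule Lim_transform_eventually) (rule eventually_mono[OF eventually_ge_at_top[of 0]], rule
          parts[symmetric])
    define h where "h = (\<lambda>x. x ^ n * \<psi> x)"
    have conth: "continuous_on {0..1} h" unfolding h_def by (intro continuous_intros cont\<psi>)
    have subst: "integral {exp (- T)..1} h = integral {0..T} (\<lambda>t. exp (- (k * t)) * G t)" if "T \<ge> 0"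
        for T
    proof -
      have "((\<lambda>u. exp u *\<^sub>R h (exp u)) has_integral integral {exp (- T)..exp 0} h) {- T..0}"
        by (rule has_integral_substitution[of _ _ _ 0 1])
           (use that conth in \<open>auto intro!: derivative_eq_intros\<close>)
      moreover have "exp u *\<^sub>R h (exp u) = exp (- (k * - u)) * G (- u)" for u
        by (simp add: h_def \<psi>_def k_def ring_distribs exp_add exp_of_nat_mult)
      ultimately have "((\<lambda>u. exp (- (k * - u)) * G (- u)) has_integral integral {exp (- T)..1} h)
          {- T..0}"
        by simp
      thus ?thesis
        using Henstock_Kurzweil_Integration.has_integral_reflect_real[of "\<lambda>t. exp (- (k * t)) * G t"
            _ T 0]
        by (simp add: integral_unique)
    qed
    have "continuous_on {0..1} (\<lambda>x. integral {x..1} h)"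
      by (intro indefinite_integral_continuous_1' integrable_continuous_interval conth)
    hence "((\<lambda>x. integral {x..1} h) \<longlongrightarrow> integral {0..1} h) (at_right 0)"
      by (auto simp: continuous_on_def at_within_Icc_at_right dest: bspec[of _ _ 0])
    hence "((\<lambda>T. integral {exp (- T)..1} h) \<longlongrightarrow> integral {0..1} h) at_top"
      by (rule filterlim_compose) real_asymp
    hence "((\<lambda>T. integral {0..T} (\<lambda>t. exp (- (k * t)) * G t)) \<longlongrightarrow> integral {0..1} h) at_top"
      by (rule Lim_transform_eventually) (rule eventually_mono[OF eventually_ge_at_top[of 0]], rule
          subst)
    from tendsto_unique[OF _ this lim1] show ?thesis by (simp add: h_def)
  qed
  with cont\<psi> have \<psi>0: "\<psi> x = 0" if "x \<in> {0..1}" for x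
    using moments_zero_imp_zero that by blast
  have "G x = 0" if "x > 0" for x
    using \<psi>0[of "exp (- x)"] that by (simp add: \<psi>_def)
  hence "((\<lambda>x. 0) has_vector_derivative \<phi> t) (at t)"
    by (intro has_vector_derivative_transform_within_open[OF derivG[OF t], of "{0<..}"])
        (use t in auto)
  hence "\<phi> t = 0"
    using vector_derivative_unique_at has_vector_derivative_const by blast
  thus ?thesis by (simp add: \<phi>_def)
qed

lemma laplace_unique:
  fixes g :: "real \<Rightarrow> complex"
  assumes cont: "continuous_on {0<..} g"
    and lap: "\<And>s. s > s0 \<Longrightarrow> ((\<lambda>t. of_real (exp (- (s * t))) * g t) has_integral 0) {0..}"
    and t: "t > 0"
  shows "g t = 0"
proof -
  have "Re (g t) = 0"
  proof (rule laplace_unique_real[OF _ _ t, of "\<lambda>t. Re (g t)" s0])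
    show "((\<lambda>t. exp (- (s * t)) * Re (g t)) has_integral 0) {0..}" if "s > s0" for s
      using has_integral_linear[OF lap[OF that] bounded_linear_Re] by (simp add: o_def)
  qed (intro continuous_intros cont)
  moreover have "Im (g t) = 0"
  proof (rule laplace_unique_real[OF _ _ t, of "\<lambda>t. Im (g t)" s0])
    show "((\<lambda>t. exp (- (s * t)) * Im (g t)) has_integral 0) {0..}" if "s > s0" for s
      using has_integral_linear[OF lap[OF that] bounded_linear_Im] by (simp add: o_def)
  qed (intro continuous_intros cont)
  ultimately show ?thesis by (simp add: complex_eq_iff)
qed

subsection \<open>The Mittag-Leffler function\<close>

lemma rGamma_real_nonneg: "x > 0 \<Longrightarrow> rGamma (x::real) \<ge> 0"
  by (simp add: rGamma_inverse_Gamma Gamma_real_pos less_imp_le)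

text \<open>Discarding Euler's integral below R leaves at least R^x exp (- R). As R is free, 1 /
  Gamma decays faster than any geometric sequence, so the Mittag-Leffler series converges
  everywhere.\<close>

lemma rGamma_plus1_le:
  assumes x: "(x::real) \<ge> 0" and R: "R > 0"
  shows "rGamma (x + 1) \<le> exp R * R powr (- x)"
proof -
  define f where "f = (\<lambda>t::real. t powr x / exp t)"
  have "(f has_integral Gamma (x + 1)) {0..}"
    using Gamma_integral_real[of "x + 1"] x by (simp add: f_def)
  hence f: "f integrable_on {0..}" "integral {0..} f = Gamma (x + 1)"
    by (auto simp: has_integral_iff)
  hence "f absolutely_integrable_on {0..}"
    by (intro nonnegative_absolutely_integrable_1) (auto simp: f_def)
  hence "f absolutely_integrable_on {R..}"
    by (rule set_integrable_subset) (use R in auto)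
  hence fR: "f integrable_on {R..}"
    by (rule set_lebesgue_integral_eq_integral)
  have g: "((\<lambda>t. R powr x * exp (- 1 * t)) has_integral R powr x * (exp (- 1 * R) / 1)) {R..}"
    by (intro has_integral_mult_right has_integral_exp_minus_to_infinity) auto
  have "R powr x * (exp (- 1 * R) / 1) \<le> integral {R..} f"
  proof (rule has_integral_le[OF g integrable_integral[OF fR]])
    fix t assume t: "t \<in> {R..}"
    have "R powr x \<le> t powr x" using t R x by (intro powr_mono2) auto
    thus "R powr x * exp (- 1 * t) \<le> f t" by (simp add: f_def exp_minus divide_inverse)
  qed
  also have "\<dots> \<le> Gamma (x + 1)"
    unfolding f(2)[symmetric] by (rule integral_subset_le[OF _ fR f(1)])
        (use R in \<open>auto simp: f_def\<close>)
  finally have le: "R powr x * exp (- R) \<le> Gamma (x + 1)" by simp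
  have "rGamma (x + 1) = inverse (Gamma (x + 1))" by (rule rGamma_inverse_Gamma)
  also have "\<dots> \<le> inverse (R powr x * exp (- R))"
    by (rule le_imp_inverse_le[OF le]) (use R in simp)
  also have "\<dots> = exp R * R powr (- x)" by (simp add: exp_minus powr_minus)
  finally show ?thesis .
qed

definition mittag_leffler :: "real \<Rightarrow> real \<Rightarrow> real" where
  "mittag_leffler \<beta> y = (\<Sum>n. rGamma (\<beta> * real n + 1) * y ^ n)"

lemma summable_mittag_leffler:
  assumes "\<beta> > 0"
  shows "summable (\<lambda>n. rGamma (\<beta> * real n + 1) * y ^ n)"
proof (rule summable_comparison_test')
  \<comment> \<open>Chosen so that \<open>R powr \<beta>\<close> is 2|y| + 1, which makes the ratio
    |y| / (2|y| + 1) of the majorising geometric series at most 1/2.\<close>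
  define R where "R = (2 * \<bar>y\<bar> + 1) powr (1 / \<beta>)"
  have R: "R > 0" "R powr \<beta> = 2 * \<bar>y\<bar> + 1"
    using assms by (auto simp: R_def powr_powr)
  show "summable (\<lambda>n. exp R * (1/2) ^ n)"
    by (intro summable_mult summable_geometric) auto
  fix n :: nat assume "n \<ge> 0"
  have "norm (rGamma (\<beta> * real n + 1) * y ^ n) = rGamma (\<beta> * real n + 1) * \<bar>y\<bar> ^ n"
    using assms by (simp add: abs_mult power_abs rGamma_real_nonneg add_nonneg_pos)
  also have "\<dots> \<le> exp R * R powr (- (\<beta> * real n)) * \<bar>y\<bar> ^ n"
    using assms R by (intro mult_right_mono rGamma_plus1_le) auto
  also have "R powr (- (\<beta> * real n)) = (1 / (2 * \<bar>y\<bar> + 1)) ^ n"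
    using R by (simp add: powr_minus powr_powr[symmetric] powr_realpow power_one_over
        inverse_eq_divide)
  also have "exp R * (1 / (2 * \<bar>y\<bar> + 1)) ^ n * \<bar>y\<bar> ^ n = exp R * (\<bar>y\<bar> / (2 * \<bar>y\<bar> + 1)) ^ n"
    by (simp add: power_divide)
  also have "\<dots> \<le> exp R * (1/2) ^ n"
    by (intro mult_left_mono power_mono) (auto simp: field_simps)
  finally show "norm (rGamma (\<beta> * real n + 1) * y ^ n) \<le> exp R * (1/2) ^ n" .
qed

lemma mittag_leffler_0 [simp]: "mittag_leffler \<beta> 0 = 1"
proof -
  have "(\<lambda>n. rGamma (\<beta> * real n + 1) * 0 ^ n) sums (rGamma (\<beta> * real 0 + 1))"
    using powser_sums_zero[of "\<lambda>n. rGamma (\<beta> * real n + 1)"] by simp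
  thus ?thesis by (simp add: mittag_leffler_def sums_iff)
qed

lemma continuous_on_mittag_leffler: "\<beta> > 0 \<Longrightarrow> continuous_on S (mittag_leffler \<beta>)"
  unfolding mittag_leffler_def
  by (intro continuous_at_imp_continuous_on ballI isCont_powser_converges_everywhere
      summable_mittag_leffler)

text \<open>The factor \<beta> (n + 1) from differentiation is absorbed by the functional equation
  of the reciprocal Gamma function.\<close>

lemma diffs_mittag_leffler:
  "\<beta> * diffs (\<lambda>n. rGamma (\<beta> * real n + 1)) n = rGamma (\<beta> * real (Suc n))"
  using rGamma_plus1[of "\<beta> * real (Suc n)"] by (simp add: diffs_def mult_ac)

lemma summable_mittag_leffler_deriv:
  assumes "\<beta> > 0"
  shows "summable (\<lambda>n. rGamma (\<beta> * real (Suc n)) * y ^ n)"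
  using summable_mult[OF termdiff_converges_all[OF summable_mittag_leffler[OF assms]], of \<beta> y]
  by (simp only: diffs_mittag_leffler mult.assoc[symmetric])

text \<open>The series is the two-parameter Mittag-Leffler function with both parameters equal to
  \<beta>.\<close>

lemma DERIV_mittag_leffler:
  assumes "\<beta> > 0"
  shows "(mittag_leffler \<beta> has_real_derivative (\<Sum>n. rGamma (\<beta> * real (Suc n)) * y ^ n) / \<beta>) (at y)"
proof -
  have "(mittag_leffler \<beta> has_real_derivative (\<Sum>n. diffs (\<lambda>n. rGamma (\<beta> * real n + 1)) n * y ^ n))
      (at y)"
    unfolding mittag_leffler_def[abs_def]
    by (intro termdiffs_strong_converges_everywhere summable_mittag_leffler assms)
  moreover have "(\<Sum>n. rGamma (\<beta> * real (Suc n)) * y ^ n)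
      = \<beta> * (\<Sum>n. diffs (\<lambda>n. rGamma (\<beta> * real n + 1)) n * y ^ n)"
    using suminf_mult[OF termdiff_converges_all[OF summable_mittag_leffler[OF assms]], of \<beta> y]
    by (simp only: diffs_mittag_leffler mult.assoc[symmetric])
  ultimately show ?thesis using assms by simp
qed

lemma set_integral_suminf:
  fixes f :: "nat \<Rightarrow> 'a \<Rightarrow> real"
  assumes int: "\<And>n. set_integrable M A (f n)"
    and summable: "\<And>x. x \<in> A \<Longrightarrow> summable (\<lambda>n. norm (f n x))"
    and norms: "summable (\<lambda>n. LINT x:A|M. norm (f n x))"
  shows "set_integrable M A (\<lambda>x. \<Sum>n. f n x)"
    and "(\<lambda>n. LINT x:A|M. f n x) sums (LINT x:A|M. (\<Sum>n. f n x))"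
proof -
  define g where "g = (\<lambda>n x. indicator A x *\<^sub>R f n x)"
  have 1: "integrable M (g n)" for n
    using int[of n] by (simp add: g_def set_integrable_def)
  have 2: "AE x in M. summable (\<lambda>n. norm (g n x))"
    using summable by (auto simp: g_def indicator_def intro!: AE_I2)
  have n: "norm (g n x) = indicator A x *\<^sub>R norm (f n x)" for n x
    by (simp add: g_def indicator_def)
  have 3: "summable (\<lambda>n. LINT x|M. norm (g n x))"
    using norms unfolding n set_lebesgue_integral_def .
  have s: "(\<Sum>n. g n x) = indicator A x *\<^sub>R (\<Sum>n. f n x)" for x
    by (simp add: g_def indicator_def)
  show "set_integrable M A (\<lambda>x. \<Sum>n. f n x)"
    using integrable_suminf[OF 1 2 3] unfolding s set_integrable_def .
  show "(\<lambda>n. LINT x:A|M. f n x) sums (LINT x:A|M. (\<Sum>n. f n x))"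
    using sums_integral[OF 1 2 3] unfolding s unfolding g_def set_lebesgue_integral_def .
qed

lemma integral_Beta_scaled:
  fixes a b t :: real
  assumes ab: "a > 0" "b > 0" and t: "t > 0"
  shows "set_integrable lborel {0<..<t} (\<lambda>\<tau>. \<tau> powr (a - 1) * (t - \<tau>) powr (b - 1))"
    and "(LINT \<tau>:{0<..<t}|lborel. \<tau> powr (a - 1) * (t - \<tau>) powr (b - 1)) = t powr (a + b - 1) * Beta
        a b"
proof -
  define f where "f = (\<lambda>\<tau>. \<tau> powr (a - 1) * (t - \<tau>) powr (b - 1))"
  define h where "h = (\<lambda>x::real. x powr (a - 1) * (1 - x) powr (b - 1))"
  have "(h has_integral Beta a b) {0<..<1}"
    using has_integral_Beta_real[OF ab] by (simp add: h_def has_integral_Icc_iff_Ioo)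
  hence h: "h integrable_on {0<..<1}" "integral {0<..<1} h = Beta a b"
    by (auto simp: has_integral_iff)
  have habs: "(\<lambda>x. t powr (a + b - 1) * h x) absolutely_integrable_on {0<..<1}"
    using h by (intro set_integrable_mult_right nonnegative_absolutely_integrable_1)
        (auto simp: h_def)
  have img: "(\<lambda>x. t * x) ` {0<..<1} = {0<..<t}"
    using t by (auto simp: image_iff intro!: bexI[of _ "_ / t"])
  have eq: "\<bar>t\<bar> *\<^sub>R f (t * x) = t powr (a + b - 1) * h x" if "x \<in> {0<..<1}" for x
  proof -
    have "t - t * x = t * (1 - x)" by (simp add: ring_distribs)
    moreover have "t powr (a + b - 1) = t * t powr (a - 1) * t powr (b - 1)"
      using t by (simp add: powr_add powr_diff)
    ultimately show ?thesis
      using that t by (simp add: f_def h_def powr_mult mult_ac)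
  qed
  have "(\<lambda>x. \<bar>t\<bar> *\<^sub>R f (t * x)) absolutely_integrable_on {0<..<1}"
    using habs eq by (subst set_integrable_cong[OF refl refl, of _ _
        "\<lambda>x. t powr (a + b - 1) * h x"]) auto
  moreover have "integral {0<..<1} (\<lambda>x. \<bar>t\<bar> *\<^sub>R f (t * x)) = t powr (a + b - 1) * Beta a b"
    using h(2) eq by (subst Henstock_Kurzweil_Integration.integral_cong[of _ _
        "\<lambda>x. t powr (a + b - 1) * h x"]) auto
  ultimately have "f absolutely_integrable_on (\<lambda>x. t * x) ` {0<..<1}
      \<and> integral ((\<lambda>x. t * x) ` {0<..<1}) f = t powr (a + b - 1) * Beta a b"
    by (subst has_absolute_integral_change_of_variables_real[symmetric, where h = "\<lambda>_. t"])
       (use t in \<open>auto simp: inj_on_def intro!: derivative_eq_intros\<close>)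
  hence f: "f absolutely_integrable_on {0<..<t}" "integral {0<..<t} f = t powr (a + b - 1) * Beta a
      b"
    by (auto simp: img)
  have "f \<in> borel_measurable borel" unfolding f_def by measurable
  hence fl: "set_integrable lborel {0<..<t} f"
    using f(1) unfolding set_integrable_def by (subst (asm) integrable_completion) auto
  thus "set_integrable lborel {0<..<t} (\<lambda>\<tau>. \<tau> powr (a - 1) * (t - \<tau>) powr (b - 1))"
    by (simp add: f_def)
  show "(LINT \<tau>:{0<..<t}|lborel. \<tau> powr (a - 1) * (t - \<tau>) powr (b - 1)) = t powr (a + b - 1) * Beta
      a b"
    using f(2) set_borel_integral_eq_integral(2)[OF fl] by (simp add: f_def)
qed

context
  fixes \<beta> \<mu> :: real
  assumes \<beta>: "0 < \<beta>" "\<beta> \<le> 1" and \<mu>: "\<mu> \<ge> 0"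
begin

lemma continuous_on_relaxation: "continuous_on {0..} (\<lambda>t. mittag_leffler \<beta> (- \<mu> * t powr \<beta>))"
  using \<beta> by (intro continuous_on_compose2[OF continuous_on_mittag_leffler] continuous_intros
      continuous_on_powr') auto

lemma DERIV_relaxation:
  assumes "\<tau> > 0"
  shows "((\<lambda>t. mittag_leffler \<beta> (- \<mu> * t powr \<beta>)) has_real_derivative
      (\<Sum>n. rGamma (\<beta> * real (Suc n)) * (- \<mu> * \<tau> powr \<beta>) ^ n) * (- \<mu> * \<tau> powr (\<beta> - 1))) (at \<tau>)"
proof -
  have "((\<lambda>t. - \<mu> * t powr \<beta>) has_real_derivative - \<mu> * (\<beta> * \<tau> powr (\<beta> - 1))) (at \<tau>)"
    using assms by (auto intro!: derivative_eq_intros simp: powr_diff)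
  from DERIV_chain2[OF DERIV_mittag_leffler[OF \<beta>(1)] this] show ?thesis
    using \<beta> by simp
qed

text \<open>For \<open>\<beta> < 1\<close> the Abel kernel is integrated against the derivative term
  by term. The term \<tau>^(\<beta> (n + 1) - 1) gives Beta (\<beta> (n + 1), 1 - \<beta>)
  t^(\<beta> n), whose Gamma factors lower the index of the series by one and reproduce it with the
  factor - \<mu>.\<close>

lemma caputo_relaxation:
  assumes t: "t > 0"
  shows "has_caputo_derivative \<beta> (\<lambda>t. of_real (mittag_leffler \<beta> (- \<mu> * t powr \<beta>)))
           (of_real (- \<mu>) * of_real (mittag_leffler \<beta> (- \<mu> * t powr \<beta>))) t"
proof (cases "\<beta> = 1")
  case True
  have "(\<Sum>n. rGamma (\<beta> * real (Suc n)) * (- \<mu> * t powr \<beta>) ^ n) = mittag_leffler \<beta> (- \<mu> * t powr \<beta>)"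
    by (simp add: mittag_leffler_def True add.commute)
  with DERIV_relaxation[OF t] have "((\<lambda>t. mittag_leffler \<beta> (- \<mu> * t powr \<beta>)) has_real_derivative
      - \<mu> * mittag_leffler \<beta> (- \<mu> * t powr \<beta>)) (at t)"
    using t by (simp add: True mult.commute)
  from has_vector_derivative_of_real[OF this] show ?thesis
    by (simp add: has_caputo_derivative_def True)
next
  case False
  hence \<beta>1: "\<beta> < 1" using \<beta> by simp
  define D where "D = (\<lambda>\<tau>. (\<Sum>n. rGamma (\<beta> * real (Suc n)) * (- \<mu> * \<tau> powr \<beta>) ^ n)
      * (- \<mu> * \<tau> powr (\<beta> - 1)))"
  define f where "f = (\<lambda>n \<tau>. ((- \<mu>) ^ Suc n * rGamma (\<beta> * real (Suc n)))
      * (\<tau> powr (\<beta> * real (Suc n) - 1) * (t - \<tau>) powr ((1 - \<beta>) - 1)))"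
  define F where "F = (\<lambda>n. (- \<mu>) ^ Suc n * Gamma (1 - \<beta>) * (rGamma (\<beta> * real n + 1) * (t powr \<beta>) ^
      n))"
  have pos: "\<beta> * real (Suc n) > 0" for n using \<beta> by simp
  have f_eq: "f n \<tau> = (rGamma (\<beta> * real (Suc n)) * (- \<mu> * \<tau> powr \<beta>) ^ n)
      * (- \<mu> * \<tau> powr (\<beta> - 1) * (t - \<tau>) powr (- \<beta>))" if "\<tau> \<in> {0<..<t}" for n \<tau>
  proof -
    have "\<tau> powr (\<beta> * real (Suc n) - 1) = (\<tau> powr \<beta>) ^ n * \<tau> powr (\<beta> - 1)"
      using that by (simp add: powr_power ring_distribs flip: powr_add) (simp add: algebra_simps)
    moreover have "(1 - \<beta>) - 1 = - \<beta>" by simp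
    ultimately show ?thesis by (simp only: f_def power_mult_distrib power_Suc mult_ac)
  qed
  have int: "set_integrable lborel {0<..<t} (f n)"
    "(LINT \<tau>:{0<..<t}|lborel. f n \<tau>) = F n" for n
  proof -
    show "set_integrable lborel {0<..<t} (f n)"
      unfolding f_def by (intro set_integrable_mult_right integral_Beta_scaled pos)
          (use \<beta>1 t in auto)
    have "(LINT \<tau>:{0<..<t}|lborel. f n \<tau>) = (- \<mu>) ^ Suc n * rGamma (\<beta> * real (Suc n)) *
        (t powr (\<beta> * real (Suc n) + (1 - \<beta>) - 1) * Beta (\<beta> * real (Suc n)) (1 - \<beta>))"
      unfolding f_def by (subst set_integral_mult_right, subst integral_Beta_scaled)
          (use \<beta>1 t pos in auto)
    also have "\<beta> * real (Suc n) + (1 - \<beta>) - 1 = real n * \<beta>" by (simp add: algebra_simps)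
    also have "t powr (real n * \<beta>) = (t powr \<beta>) ^ n" using t by (simp add: powr_power)
    also have "Beta (\<beta> * real (Suc n)) (1 - \<beta>) = Gamma (\<beta> * real (Suc n)) * Gamma (1 - \<beta>)
        * rGamma (\<beta> * real n + 1)"
      by (simp add: Beta_altdef algebra_simps)
    also have "(- \<mu>) ^ Suc n * rGamma (\<beta> * real (Suc n))
        * ((t powr \<beta>) ^ n * (Gamma (\<beta> * real (Suc n)) * Gamma (1 - \<beta>) * rGamma (\<beta> * real n + 1)))
        = (rGamma (\<beta> * real (Suc n)) * Gamma (\<beta> * real (Suc n))) * F n"
      by (simp only: F_def mult_ac)
    also have "rGamma (\<beta> * real (Suc n)) * Gamma (\<beta> * real (Suc n)) = 1"
      using Gamma_real_pos[OF pos[of n]] by (simp add: rGamma_inverse_Gamma)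
    finally show "(LINT \<tau>:{0<..<t}|lborel. f n \<tau>) = F n" by simp
  qed
  \<comment> \<open>Each term has a constant sign on the interval. The integrals of the norms are
    thus the same integrals with \<mu> in place of - \<mu>, up to a fixed factor a convergent
    Mittag-Leffler series again.\<close>
  have "norm (f n \<tau>) = (-1) ^ Suc n * f n \<tau>" for n \<tau>
    using \<mu> pos[of n] by (simp add: f_def abs_mult power_abs rGamma_real_nonneg power_minus[of \<mu>]
        flip: mult.assoc power_add)
  hence "(LINT \<tau>:{0<..<t}|lborel. norm (f n \<tau>)) = (-1) ^ Suc n * F n" for n
    by (simp only: set_integral_mult_right int)
  also have "(-1) ^ Suc n * F n = \<mu> * Gamma (1 - \<beta>) * (rGamma (\<beta> * real n + 1) * (\<mu> * t powr \<beta>) ^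
      n)" for n
    by (simp add: F_def power_minus[of \<mu>] power_mult_distrib flip: mult.assoc power_add)
  finally have norms: "summable (\<lambda>n. LINT \<tau>:{0<..<t}|lborel. norm (f n \<tau>))"
    using \<beta> by (simp add: summable_mult summable_mittag_leffler)
  have summ: "summable (\<lambda>n. norm (f n \<tau>))" if "\<tau> \<in> {0<..<t}" for \<tau>
  proof -
    have "norm (f n \<tau>) = (rGamma (\<beta> * real (Suc n)) * (\<mu> * \<tau> powr \<beta>) ^ n)
        * norm (- \<mu> * \<tau> powr (\<beta> - 1) * (t - \<tau>) powr (- \<beta>))" for n
      unfolding f_eq[OF that] using \<mu> pos[of n] by (simp add: abs_mult power_abs rGamma_real_nonneg)
    thus ?thesis by (simp only:) (intro summable_mult2 summable_mittag_leffler_deriv \<beta>)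
  qed
  have sumf: "(\<Sum>n. f n \<tau>) = D \<tau> / (t - \<tau>) powr \<beta>" if "\<tau> \<in> {0<..<t}" for \<tau>
  proof -
    have "(\<Sum>n. f n \<tau>) = (\<Sum>n. rGamma (\<beta> * real (Suc n)) * (- \<mu> * \<tau> powr \<beta>) ^ n)
        * (- \<mu> * \<tau> powr (\<beta> - 1) * (t - \<tau>) powr (- \<beta>))"
      unfolding f_eq[OF that] by (intro suminf_mult2[symmetric] summable_mittag_leffler_deriv \<beta>)
    thus ?thesis by (simp only: D_def powr_minus divide_inverse mult.assoc)
  qed
  note si = set_integral_suminf[OF int(1) summ norms]
  have "F = (\<lambda>n. (- \<mu> * Gamma (1 - \<beta>)) * (rGamma (\<beta> * real n + 1) * (- \<mu> * t powr \<beta>) ^ n))"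
    by (simp add: F_def power_mult_distrib fun_eq_iff)
       (metis mult_minus_left power_mult_distrib)
  hence "F sums ((- \<mu> * Gamma (1 - \<beta>)) * mittag_leffler \<beta> (- \<mu> * t powr \<beta>))"
    unfolding mittag_leffler_def
        by (simp only:) (intro sums_mult summable_sums summable_mittag_leffler \<beta>)
  with si(2) have val: "(LINT \<tau>:{0<..<t}|lborel. (\<Sum>n. f n \<tau>)) = (- \<mu> * Gamma (1 - \<beta>))
      * mittag_leffler \<beta> (- \<mu> * t powr \<beta>)"
    unfolding int by (rule sums_unique2)
  have "((\<lambda>\<tau>. \<Sum>n. f n \<tau>) has_integral (- \<mu> * Gamma (1 - \<beta>)) * mittag_leffler \<beta> (- \<mu> * t powr \<beta>))
      {0<..<t}"
    using set_borel_integral_eq_integral[OF si(1)] val by (simp add: has_integral_iff)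
  hence "((\<lambda>\<tau>. D \<tau> / (t - \<tau>) powr \<beta>) has_integral (- \<mu> * Gamma (1 - \<beta>)) * mittag_leffler \<beta>
      (- \<mu> * t powr \<beta>)) {0<..<t}"
    by (rule has_integral_eq[rotated]) (rule sumf)
  hence "((\<lambda>\<tau>. D \<tau> / (t - \<tau>) powr \<beta>) has_integral (- \<mu> * Gamma (1 - \<beta>)) * mittag_leffler \<beta>
      (- \<mu> * t powr \<beta>)) {0..t}"
    by (simp add: has_integral_Icc_iff_Ioo)
  moreover have "Gamma (1 - \<beta>) \<noteq> 0"
    using Gamma_real_pos[of "1 - \<beta>"] \<beta>1 by linarith
  moreover note has_integral_mult_right[OF calculation(1), of "1 / Gamma (1 - \<beta>)"]
  ultimately have "((\<lambda>\<tau>. 1 / Gamma (1 - \<beta>) * (D \<tau> / (t - \<tau>) powr \<beta>)) has_integral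
      - \<mu> * mittag_leffler \<beta> (- \<mu> * t powr \<beta>)) {0..t}"
    by simp
  hence "((\<lambda>\<tau>. complex_of_real (1 / Gamma (1 - \<beta>) * (D \<tau> / (t - \<tau>) powr \<beta>))) has_integral
      complex_of_real (- \<mu> * mittag_leffler \<beta> (- \<mu> * t powr \<beta>))) {0..t}"
    by (rule has_integral_of_real)
  hence "((\<lambda>\<tau>. 1 / complex_of_real (Gamma (1 - \<beta>)) * (of_real (D \<tau>) / of_real ((t - \<tau>) powr \<beta>)))
      has_integral
      of_real (- \<mu>) * of_real (mittag_leffler \<beta> (- \<mu> * t powr \<beta>))) {0..t}"
    by simp
  moreover have "((\<lambda>t. complex_of_real (mittag_leffler \<beta> (- \<mu> * t powr \<beta>))) has_vector_derivative
      of_real (D \<tau>)) (at \<tau>)" if "\<tau> \<in> {0<..<t}" for \<tau>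
    using DERIV_relaxation[of \<tau>] that unfolding D_def
    by (intro has_vector_derivative_of_real) simp
  ultimately show ?thesis
    unfolding has_caputo_derivative_def using False by (auto intro!: exI[of _ "\<lambda>\<tau>. of_real (D \<tau>)"])
qed

text \<open>Term by term, the Gamma factors cancel and a geometric series with ratio - \<mu> /
  s^\<beta> remains. The second part of the assumption \<open>s\<close> is its condition of
  convergence.\<close>

lemma laplace_relaxation:
  assumes s: "s > 0" "\<mu> < s powr \<beta>"
  shows "set_integrable lborel {0<..} (\<lambda>t. exp (- (s * t)) * mittag_leffler \<beta> (- \<mu> * t powr \<beta>))"
    and "(LINT t:{0<..}|lborel. exp (- (s * t)) * mittag_leffler \<beta> (- \<mu> * t powr \<beta>))
        = s powr (\<beta> - 1) / (s powr \<beta> + \<mu>)"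
proof -
  define f where "f = (\<lambda>n t. ((- \<mu>) ^ n * rGamma (\<beta> * real n + 1)) * (t powr ((\<beta> * real n + 1) - 1)
      * exp (- (s * t))))"
  define F where "F = (\<lambda>n. inverse s * (- \<mu> / s powr \<beta>) ^ n)"
  have pos: "\<beta> * real n + 1 > 0" for n using \<beta> by (simp add: add_nonneg_pos)
  have int: "set_integrable lborel {0<..} (f n)"
    "(LINT t:{0<..}|lborel. f n t) = F n" for n
  proof -
    show "set_integrable lborel {0<..} (f n)"
      unfolding f_def by (intro set_integrable_mult_right laplace_powr pos s)
    have "(LINT t:{0<..}|lborel. f n t) = (- \<mu>) ^ n * rGamma (\<beta> * real n + 1) *
        (Gamma (\<beta> * real n + 1) * s powr (- (\<beta> * real n + 1)))"
      unfolding f_def by (simp only: set_integral_mult_right laplace_powr[OF pos s(1)])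
    also have "\<dots> = (rGamma (\<beta> * real n + 1) * Gamma (\<beta> * real n + 1))
        * ((- \<mu>) ^ n * s powr (- (\<beta> * real n + 1)))"
      by (simp only: mult_ac)
    also have "rGamma (\<beta> * real n + 1) * Gamma (\<beta> * real n + 1) = 1"
      using Gamma_real_pos[OF pos[of n]] by (simp add: rGamma_inverse_Gamma)
    also have "s powr (- (\<beta> * real n + 1)) = inverse (s powr 1 * s powr (real n * \<beta>))"
      by (simp only: powr_minus powr_add[symmetric] add.commute mult.commute)
    also have "\<dots> = inverse s * inverse ((s powr \<beta>) ^ n)"
      using s by (simp add: powr_power)
    finally show "(LINT t:{0<..}|lborel. f n t) = F n"
      unfolding F_def power_divide by (simp only: divide_inverse mult_1 mult_ac)
  qed
  have "norm (f n t) = (-1) ^ n * f n t" for n t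
    using \<mu> pos[of n] by (simp add: f_def abs_mult power_abs rGamma_real_nonneg power_minus[of \<mu>]
        flip: mult.assoc power_add)
  hence "(LINT t:{0<..}|lborel. norm (f n t)) = (-1) ^ n * F n" for n
    by (simp only: set_integral_mult_right int)
  also have "(-1) ^ n * F n = inverse s * (\<mu> / s powr \<beta>) ^ n" for n
    by (simp add: F_def power_minus[of "\<mu> / s powr \<beta>"] mult_ac flip: mult.assoc power_add)
  finally have norms: "summable (\<lambda>n. LINT t:{0<..}|lborel. norm (f n t))"
    using s \<mu> by (simp add: summable_mult)
  have f_eq: "f n t = (rGamma (\<beta> * real n + 1) * (- \<mu> * t powr \<beta>) ^ n) * exp (- (s * t))"
      if "t \<in> {0<..}" for n t
    using that by (simp add: f_def power_mult_distrib[of "- \<mu>" "t powr \<beta>", simplified] powr_power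
        mult_ac)
  have summ: "summable (\<lambda>n. norm (f n t))" if "t \<in> {0<..}" for t
  proof -
    have "norm (f n t) = (rGamma (\<beta> * real n + 1) * (\<mu> * t powr \<beta>) ^ n) * exp (- (s * t))" for n
      unfolding f_eq[OF that] using \<mu> pos[of n] by (simp add: abs_mult power_abs rGamma_real_nonneg)
    thus ?thesis by (simp only:) (intro summable_mult2 summable_mittag_leffler \<beta>)
  qed
  have sumf: "(\<Sum>n. f n t) = exp (- (s * t)) * mittag_leffler \<beta> (- \<mu> * t powr \<beta>)" if "t \<in> {0<..}"
      for t
    unfolding f_eq[OF that] mittag_leffler_def
    by (subst suminf_mult2[symmetric]) (simp_all only: summable_mittag_leffler \<beta> mult.commute)
  note si = set_integral_suminf[OF int(1) summ norms]
  show "set_integrable lborel {0<..} (\<lambda>t. exp (- (s * t)) * mittag_leffler \<beta> (- \<mu> * t powr \<beta>))"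
    using si(1) sumf by (subst set_integrable_cong[OF refl refl, of _ _ "\<lambda>t. \<Sum>n. f n t"]) auto
  have "F sums (inverse s * (1 / (1 - (- \<mu> / s powr \<beta>))))"
    unfolding F_def using s \<mu> by (intro sums_mult geometric_sums) auto
  with si(2) have "(LINT t:{0<..}|lborel. (\<Sum>n. f n t)) = inverse s * (1 / (1 - (- \<mu> / s powr \<beta>)))"
    unfolding int by (rule sums_unique2)
  also have "\<dots> = s powr (\<beta> - 1) / (s powr \<beta> + \<mu>)"
    using s \<mu> by (simp add: powr_diff field_simps)
  finally show "(LINT t:{0<..}|lborel. exp (- (s * t)) * mittag_leffler \<beta> (- \<mu> * t powr \<beta>))
      = s powr (\<beta> - 1) / (s powr \<beta> + \<mu>)"
    using sumf by (subst set_lebesgue_integral_cong[of _ _ _ "\<lambda>t. \<Sum>n. f n t"]) auto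
qed

end

subsection \<open>The relaxation equation\<close>

text \<open>The classical derivative is determined on the open interval, so two admissible
  integrands differ at most at the two end points.\<close>

lemma has_caputo_derivative_unique:
  assumes t: "t > 0" and D: "has_caputo_derivative \<beta> u D t" "has_caputo_derivative \<beta> u D' t"
  shows "D = D'"
proof (cases "\<beta> = 1")
  case True
  with D show ?thesis by (auto simp: has_caputo_derivative_def intro: vector_derivative_unique_at)
next
  case False
  define G where "G = (\<lambda>u' \<tau>. 1 / complex_of_real (Gamma (1 - \<beta>))
      * (u' \<tau> / of_real ((t - \<tau>) powr \<beta>)))"
  from D obtain u1 u2
    where u1: "\<And>\<tau>. \<tau> \<in> {0<..<t} \<Longrightarrow> (u has_vector_derivative u1 \<tau>) (at \<tau>)"
        "(G u1 has_integral D) {0..t}"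
      and u2: "\<And>\<tau>. \<tau> \<in> {0<..<t} \<Longrightarrow> (u has_vector_derivative u2 \<tau>) (at \<tau>)"
          "(G u2 has_integral D') {0..t}"
    unfolding has_caputo_derivative_def G_def if_not_P[OF False] by blast
  have "G u2 \<tau> = G u1 \<tau>" if "\<tau> \<in> {0..t} - {0, t}" for \<tau>
    using vector_derivative_unique_at[OF u1(1) u2(1), of \<tau>] that by (simp add: G_def)
  hence "(G u1 has_integral D') {0..t}"
    by (intro has_integral_spike_finite[OF _ _ u2(2), of "{0, t}"]) auto
  with u1(2) show ?thesis by (rule has_integral_unique)
qed

lemma Lim_at_right_0_eq:
  fixes u :: "real \<Rightarrow> complex"
  assumes "continuous_on {0..} u"
  shows "Lim (at_right 0) u = u 0"
proof -
  have "(u \<longlongrightarrow> u 0) (at 0 within {0..})"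
    using assms by (auto simp: continuous_on_def)
  hence "(u \<longlongrightarrow> u 0) (at_right 0)"
    by (rule tendsto_within_subset) auto
  thus ?thesis by (intro tendsto_Lim) auto
qed

context
  fixes \<beta> \<mu> :: real
  assumes \<beta>: "0 < \<beta>" "\<beta> \<le> 1" and \<mu>: "\<mu> \<ge> 0"
begin

lemma powr_gt_threshold:
  assumes "s > (\<mu> + 1) powr (1 / \<beta>)"
  shows "s > 0" "s powr \<beta> > \<mu>"
proof -
  have "(\<mu> + 1) powr (1 / \<beta>) > 0" using \<mu> by simp
  thus "s > 0" using assms by linarith
  have "((\<mu> + 1) powr (1 / \<beta>)) powr \<beta> < s powr \<beta>"
    using assms \<beta> by (intro powr_less_mono2) auto
  thus "s powr \<beta> > \<mu>" using \<beta> \<mu> by (simp add: powr_powr)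
qed

lemma has_laplace_transform_relaxation:
  assumes "s > 0" "\<mu> < s powr \<beta>"
  shows "has_laplace_transform (\<lambda>t. of_real (mittag_leffler \<beta> (- \<mu> * t powr \<beta>)))
      s (of_real (s powr (\<beta> - 1) / (s powr \<beta> + \<mu>)))"
proof -
  note L = laplace_relaxation[OF \<beta> \<mu> assms]
  have "set_integrable lborel {0<..}
      (\<lambda>t. complex_of_real (exp (- (s * t)) * mittag_leffler \<beta> (- \<mu> * t powr \<beta>)))"
    using L(1) by (simp only: set_integrable_of_real_iff)
  moreover have "{0<..} \<subseteq> {0::real..}" "{0..} - {0<..} \<subseteq> {0::real}" by auto
  ultimately have "((\<lambda>t. complex_of_real (exp (- (s * t)) * mittag_leffler \<beta> (- \<mu> * t powr \<beta>)))
      has_integral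
      of_real (s powr (\<beta> - 1) / (s powr \<beta> + \<mu>))) {0..}"
    unfolding L(2)[symmetric] set_integral_complex_of_real[symmetric]
        by (rule set_integrable_imp_has_integral)
  thus ?thesis by (simp add: has_laplace_transform_def)
qed

text \<open>By \<open>caputo_relaxation\<close> the Caputo derivative is - \<mu> times the function,
  so the rule becomes the identity - \<mu> U = s^\<beta> U - s^(\<beta> - 1) for the transform U
  already computed.\<close>

lemma caputo_laplace_rule_relaxation:
  "caputo_laplace_rule \<beta> (\<lambda>t. of_real (mittag_leffler \<beta> (- \<mu> * t powr \<beta>)))"
proof -
  define e where "e = (\<lambda>t. complex_of_real (mittag_leffler \<beta> (- \<mu> * t powr \<beta>)))"
  have "continuous_on {0..} e"
    unfolding e_def by (intro continuous_intros continuous_on_relaxation \<beta> \<mu>)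
  from Lim_at_right_0_eq[OF this] have lim: "Lim (at_right 0) e = 1"
    using \<beta> by (simp add: e_def)
  have "\<exists>U. has_laplace_transform e s U \<and>
      has_laplace_transform (\<lambda>t. of_real (- \<mu>) * e t) s (of_real (s powr \<beta>) * U
          - of_real (s powr (\<beta> - 1)) * Lim (at_right 0) e)"
    if s: "s > (\<mu> + 1) powr (1 / \<beta>)" for s
  proof -
    note s' = powr_gt_threshold[OF s]
    define U where "U = complex_of_real (s powr (\<beta> - 1) / (s powr \<beta> + \<mu>))"
    have 1: "has_laplace_transform e s U"
      unfolding e_def U_def by (rule has_laplace_transform_relaxation[OF s'])
    hence "((\<lambda>t. of_real (- \<mu>) * (of_real (exp (- (s * t))) * e t)) has_integral of_real (- \<mu>) * U)
        {0..}"
      unfolding has_laplace_transform_def by (rule has_integral_mult_right)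
    moreover have "of_real (- \<mu>) * U = of_real (s powr \<beta>) * U - of_real (s powr (\<beta> - 1)) * 1"
    proof -
      have "- \<mu> * (s powr (\<beta> - 1) / (s powr \<beta> + \<mu>)) = s powr \<beta> * (s powr (\<beta> - 1) / (s powr \<beta> + \<mu>))
          - s powr (\<beta> - 1)"
        using s' \<mu> by (simp add: field_simps)
      from arg_cong[OF this, of complex_of_real] show ?thesis unfolding U_def by simp
    qed
    ultimately have "has_laplace_transform (\<lambda>t. of_real (- \<mu>) * e t) s (of_real (s powr \<beta>) * U
        - of_real (s powr (\<beta> - 1)) * 1)"
      unfolding has_laplace_transform_def by (simp add: mult_ac)
    with 1 show ?thesis unfolding lim by blast
  qed
  moreover have "\<forall>t>0. has_caputo_derivative \<beta> e (of_real (- \<mu>) * e t) t"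
    unfolding e_def using caputo_relaxation[OF \<beta> \<mu>] by blast
  ultimately show ?thesis
    unfolding caputo_laplace_rule_def e_def[symmetric]
    by (intro exI[of _ "\<lambda>t. of_real (- \<mu>) * e t"] conjI exI[of _ "(\<mu> + 1) powr (1 / \<beta>)"]) auto
qed

text \<open>The rule and the equation each provide a Caputo derivative. Identifying the two turns
  the rule into a linear equation for U, and \<open>laplace_unique\<close> does the rest.\<close>

lemma relaxation_unique:
  fixes u :: "real \<Rightarrow> complex"
  assumes cont: "continuous_on {0..} u" and u0: "u 0 = 1"
    and eq: "\<And>t. t > 0 \<Longrightarrow> has_caputo_derivative \<beta> u (of_real (- \<mu>) * u t) t"
    and rule: "caputo_laplace_rule \<beta> u" and t: "t \<ge> 0"
  shows "u t = of_real (mittag_leffler \<beta> (- \<mu> * t powr \<beta>))"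
proof (cases "t = 0")
  case True
  thus ?thesis using u0 \<beta> by simp
next
  case False
  define e where "e = (\<lambda>t. complex_of_real (mittag_leffler \<beta> (- \<mu> * t powr \<beta>)))"
  obtain Du s0 where Du: "\<And>t. t > 0 \<Longrightarrow> has_caputo_derivative \<beta> u (Du t) t"
    and lap: "\<And>s. s > s0 \<Longrightarrow> \<exists>U. has_laplace_transform u s U \<and>
          has_laplace_transform Du s (of_real (s powr \<beta>) * U - of_real (s powr (\<beta> - 1))
              * Lim (at_right 0) u)"
    using rule unfolding caputo_laplace_rule_def by blast
  have Du_eq: "Du t = of_real (- \<mu>) * u t" if "t > 0" for t
    using has_caputo_derivative_unique[OF that Du[OF that] eq[OF that]] .
  have "((\<lambda>t. of_real (exp (- (s * t))) * (u t - e t)) has_integral 0) {0..}"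
    if s: "s > max s0 ((\<mu> + 1) powr (1 / \<beta>))" for s
  proof -
    have s': "s > 0" "s powr \<beta> > \<mu>" using powr_gt_threshold[of s] s by auto
    from lap[of s] s obtain U where U: "((\<lambda>t. of_real (exp (- (s * t))) * u t) has_integral U)
        {0..}"
      and DU: "((\<lambda>t. of_real (exp (- (s * t))) * Du t) has_integral of_real (s powr \<beta>) * U
          - of_real (s powr (\<beta> - 1))) {0..}"
      by (auto simp: has_laplace_transform_def Lim_at_right_0_eq[OF cont] u0)
    \<comment> \<open>The two derivatives are known to agree for t > 0; the single point 0 is
      negligible.\<close>
    have "((\<lambda>t. of_real (- \<mu>) * (of_real (exp (- (s * t))) * u t)) has_integral of_real (s powr \<beta>)
        * U - of_real (s powr (\<beta> - 1))) {0..}"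
      by (rule has_integral_spike_finite[OF _ _ DU, of "{0}"]) (auto simp: Du_eq)
    from has_integral_unique[OF this has_integral_mult_right[OF U]]
    have "of_real (s powr \<beta> + \<mu>) * U = of_real (s powr (\<beta> - 1))"
      by (simp add: algebra_simps)
    hence "U = of_real (s powr (\<beta> - 1) / (s powr \<beta> + \<mu>))"
      using s' \<mu> by (simp add: field_simps flip: of_real_add)
    moreover have "((\<lambda>t. of_real (exp (- (s * t))) * e t)
        has_integral of_real (s powr (\<beta> - 1) / (s powr \<beta> + \<mu>))) {0..}"
      using has_laplace_transform_relaxation[OF s'] by (simp add: has_laplace_transform_def e_def)
    ultimately have "((\<lambda>t. of_real (exp (- (s * t))) * e t) has_integral U) {0..}" by simp
    from has_integral_diff[OF U this] show ?thesis by (simp add: right_diff_distrib)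
  qed
  moreover have "continuous_on {0<..} (\<lambda>t. u t - e t)"
  proof (rule continuous_on_subset)
    show "continuous_on {0..} (\<lambda>t. u t - e t)"
      unfolding e_def by (intro continuous_intros cont continuous_on_relaxation \<beta> \<mu>)
  qed auto
  ultimately have "u t - e t = 0"
    using laplace_unique[of "\<lambda>t. u t - e t" "max s0 ((\<mu> + 1) powr (1 / \<beta>))" t] False t by simp
  thus ?thesis by (simp add: e_def)
qed

end

subsection \<open>The Mellin-Barnes representation of the Mittag-Leffler function\<close>

lemma lborel_Fubini_dominated:
  fixes f :: "real \<Rightarrow> real \<Rightarrow> complex" and A B :: "real \<Rightarrow> real"
  assumes meas: "case_prod f \<in> borel_measurable (lborel \<Otimes>\<^sub>M lborel)"
    and bound: "\<And>x v. norm (f x v) \<le> A x * B v"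
    and AB: "integrable lborel A" "integrable lborel B"
  shows "integrable lborel (\<lambda>x. LINT v|lborel. f x v)"
    and "(LINT v|lborel. LINT x|lborel. f x v) = (LINT x|lborel. LINT v|lborel. f x v)"
proof -
  have [measurable]: "A \<in> borel_measurable lborel" "B \<in> borel_measurable lborel"
    using AB by auto
  have "integrable (lborel \<Otimes>\<^sub>M lborel) (\<lambda>p. A (fst p) * B (snd p))"
  proof (rule lborel_pair.Fubini_integrable)
    show "integrable lborel (\<lambda>x. LINT y|lborel. norm (A (fst (x, y)) * B (snd (x, y))))"
      using AB by (simp add: abs_mult)
  qed (use AB in auto)
  hence "integrable (lborel \<Otimes>\<^sub>M lborel) (case_prod f)"
    by (rule Bochner_Integration.integrable_bound[OF _ meas])
       (auto intro!: AE_I2 order_trans[OF bound] abs_ge_self)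
  from lborel_pair.integrable_fst'[OF this] lborel_pair.Fubini_integral[OF this]
  show "integrable lborel (\<lambda>x. LINT v|lborel. f x v)"
    "(LINT v|lborel. LINT x|lborel. f x v) = (LINT x|lborel. LINT v|lborel. f x v)" by auto
qed

lemma Complex_measurable [measurable]:
  assumes [measurable]: "f \<in> borel_measurable M" "g \<in> borel_measurable M"
  shows "(\<lambda>x. Complex (f x) (g x)) \<in> borel_measurable M"
  unfolding Complex_eq by measurable

text \<open>All exponents have the same real part, so the modulus of the power depends on x only and
  stays bounded along a sequence converging in the open half line; dominated convergence
  applies.\<close>

lemma continuous_on_LINT_rpow:
  assumes K: "integrable lborel K" and w [measurable]: "w \<in> borel_measurable borel" and Re:
      "\<And>v. Re (w v) = c"
  shows "continuous_on {0<..} (\<lambda>x. LINT v|lborel. K v * rpow x (w v))"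
  unfolding continuous_on_sequentially comp_def
proof (intro allI ballI impI, elim conjE)
  fix X :: "nat \<Rightarrow> real" and a :: real
  assume a: "a \<in> {0<..}" and X: "\<forall>n. X n \<in> {0<..}" "X \<longlonglongrightarrow> a"
  have [measurable]: "K \<in> borel_measurable borel" using K
      by (auto dest: borel_measurable_integrable)
  have ln: "(\<lambda>n. ln (X n)) \<longlonglongrightarrow> ln a" using X a by (intro tendsto_intros) auto
  hence "Bseq (\<lambda>n. ln (X n))" by (intro convergent_imp_Bseq) (auto simp: convergent_def)
  then obtain B where B: "\<And>n. \<bar>ln (X n)\<bar> \<le> B" by (auto simp: Bseq_def)
  show "(\<lambda>n. LINT v|lborel. K v * rpow (X n) (w v)) \<longlonglongrightarrow> (LINT v|lborel. K v * rpow a (w v))"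
  proof (rule integral_dominated_convergence)
    show "integrable lborel (\<lambda>v. norm (K v) * exp (\<bar>c\<bar> * B))" using K by simp
    show "AE v in lborel. (\<lambda>n. K v * rpow (X n) (w v)) \<longlonglongrightarrow> K v * rpow a (w v)"
      unfolding rpow_def by (intro AE_I2 tendsto_intros ln)
    show "AE v in lborel. norm (K v * rpow (X n) (w v)) \<le> norm (K v) * exp (\<bar>c\<bar> * B)" for n
    proof (intro AE_I2)
      fix v
      have "c * ln (X n) \<le> \<bar>c\<bar> * \<bar>ln (X n)\<bar>" by (metis abs_ge_self abs_mult)
      also have "\<dots> \<le> \<bar>c\<bar> * B" using B[of n] by (intro mult_left_mono) auto
      finally have "norm (rpow (X n) (w v)) \<le> exp (\<bar>c\<bar> * B)"
        by (simp add: rpow_def Re)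
      thus "norm (K v * rpow (X n) (w v)) \<le> norm (K v) * exp (\<bar>c\<bar> * B)"
        unfolding norm_mult by (intro mult_left_mono) auto
    qed
  qed auto
qed

text \<open>The decay rate pi of the pair loses at most pi \<beta> / 2 \<le> pi / 2 to the
  reciprocal Gamma function. The rest exceeds 1 by enough to absorb the quadratic polynomial
  factor.\<close>

lemma gamma_pair_rGamma_bound:
  assumes \<beta>: "0 < \<beta>" "\<beta> \<le> 1" and ab: "- (1/2) \<le> a" "b < 1"
  shows "\<exists>C\<ge>0. \<forall>s. a \<le> Re s \<longrightarrow> Re s \<le> b \<longrightarrow> norm (gamma_pair s * rGamma (1 - of_real \<beta> * s))
      \<le> C * exp (- 1 * \<bar>Im s\<bar>)"
proof -
  obtain C1 where C1: "C1 \<ge> 0" "\<And>s. a \<le> Re s \<Longrightarrow> Re s \<le> b \<Longrightarrow> norm (gamma_pair s) \<le> C1 * (1 + \<bar>Im s\<bar>)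
      * exp (- pi * \<bar>Im s\<bar>)"
    using gamma_pair_bound[of a b] ab by auto
  obtain C2 where C2: "C2 \<ge> 0" "\<And>z. - (1/2) \<le> Re z \<Longrightarrow> Re z \<le> 2 \<Longrightarrow> norm (rGamma z) \<le> C2 * (1 + norm z)
      * exp (pi / 2 * \<bar>Im z\<bar>)"
    using norm_rGamma_le_exp[of 2] by blast
  have "norm (gamma_pair s * rGamma (1 - of_real \<beta> * s)) \<le> (48 * C1 * C2 * exp (1/2))
      * exp (- 1 * \<bar>Im s\<bar>)" if s: "a \<le> Re s" "Re s \<le> b" for s
  proof -
    define y where "y = \<bar>Im s\<bar>"
    have y: "y \<ge> 0" by (simp add: y_def)
    have Re1: "\<bar>Re s\<bar> \<le> 1" using s ab by auto
    have "\<bar>\<beta> * Re s\<bar> \<le> 1"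
      using \<beta> Re1 mult_mono[of \<beta> 1 "\<bar>Re s\<bar>" 1] by (simp add: abs_mult)
    hence Re2: "- (1/2) \<le> Re (1 - of_real \<beta> * s)" "Re (1 - of_real \<beta> * s) \<le> 2" by auto
    have "norm (1 - of_real \<beta> * s) \<le> 1 + \<beta> * norm s"
      using norm_triangle_ineq4[of 1 "of_real \<beta> * s"] \<beta> by (simp add: norm_mult)
    also have "\<dots> \<le> 1 + 1 * (\<bar>Re s\<bar> + \<bar>Im s\<bar>)"
      using \<beta> cmod_le[of s] by (intro add_left_mono mult_mono) auto
    also have "\<dots> \<le> 2 + y" using Re1 by (simp add: y_def)
    finally have n: "1 + norm (1 - of_real \<beta> * s) \<le> 3 * (1 + y)" using y by simp
    have "pi / 2 * \<bar>Im (1 - of_real \<beta> * s)\<bar> \<le> pi / 2 * y"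
      using \<beta> by (intro mult_left_mono) (auto simp: y_def abs_mult intro: mult_left_le_one_le)
    hence "exp (pi / 2 * \<bar>Im (1 - of_real \<beta> * s)\<bar>) \<le> exp (pi / 2 * y)" by simp
    with n have "C2 * (1 + norm (1 - of_real \<beta> * s)) * exp (pi / 2 * \<bar>Im (1 - of_real \<beta> * s)\<bar>)
        \<le> C2 * (3 * (1 + y)) * exp (pi / 2 * y)"
      using C2(1) y by (intro mult_mono) auto
    with C2(2)[OF Re2] have 2: "norm (rGamma (1 - of_real \<beta> * s)) \<le> C2 * (3 * (1 + y))
        * exp (pi / 2 * y)" by linarith
    have 1: "norm (gamma_pair s) \<le> C1 * (1 + y) * exp (- pi * y)"
      using C1(2)[OF s] by (simp add: y_def)
    have "norm (gamma_pair s * rGamma (1 - of_real \<beta> * s)) \<le> (C1 * (1 + y) * exp (- pi * y))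
        * (C2 * (3 * (1 + y)) * exp (pi / 2 * y))"
      unfolding norm_mult using 1 2 C1(1) y by (intro mult_mono) auto
    also have "\<dots> = (3 * C1 * C2) * ((1 + y)\<^sup>2 * exp (- (pi / 2) * y))"
      by (simp add: power2_eq_square exp_minus field_simps flip: exp_add)
    \<comment> \<open>From 1 + y \<le> 4 exp ((1 + y) / 4), squared: this spends 1/2 of the rate pi
      / 2, and (pi - 1) / 2 \<ge> 1 because pi > 3.\<close>
    also have "\<dots> \<le> (3 * C1 * C2) * (16 * exp (1/2) * exp (- 1 * y))"
    proof (intro mult_left_mono)
      have "(1 + y)\<^sup>2 \<le> (exp (1/4 * (1 + y)) / (1/4))\<^sup>2"
        using le_exp_div[of "1/4" "1 + y"] y by (intro power_mono) auto
      also have "\<dots> = 16 * exp (1/2) * exp (1/2 * y)"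
        by (simp add: power2_eq_square field_simps flip: exp_add)
      finally have "(1 + y)\<^sup>2 * exp (- (pi / 2) * y) \<le> 16 * exp (1/2) * exp (1/2 * y)
          * exp (- (pi / 2) * y)"
        by (intro mult_right_mono) auto
      also have "\<dots> = 16 * exp (1/2) * exp (- ((pi - 1) / 2 * y))"
        by (simp add: field_simps flip: exp_add)
      also have "\<dots> \<le> 16 * exp (1/2) * exp (- 1 * y)"
      proof -
        have "1 * y \<le> (pi - 1) / 2 * y" using pi_gt3 y by (intro mult_right_mono) auto
        thus ?thesis by simp
      qed
      finally show "(1 + y)\<^sup>2 * exp (- (pi / 2) * y) \<le> 16 * exp (1/2) * exp (- 1 * y)" .
    qed (use C1 C2 in auto)
    finally show ?thesis by (simp add: y_def mult_ac)
  qed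
  moreover have "48 * C1 * C2 * exp (1/2) \<ge> 0" using C1 C2 by simp
  ultimately show ?thesis by blast
qed

lemma mittag_leffler_Mellin_Barnes:
  fixes \<beta> \<mu> t \<sigma> :: real
  assumes \<beta>: "0 < \<beta>" "\<beta> \<le> 1" and \<mu>: "\<mu> > 0" and t: "t > 0" and \<sigma>: "0 < \<sigma>" "\<sigma> < 1"
  defines "K \<equiv> (\<lambda>v. gamma_pair (Complex \<sigma> v) / Complex \<sigma> v * rGamma (1 - of_real \<beta> * Complex \<sigma> v))"
  shows "integrable lborel K"
    and "(LINT v|lborel. K v * rpow (\<mu> * t powr \<beta>) (- Complex \<sigma> v))
        = 2 * of_real pi * of_real (mittag_leffler \<beta> (- \<mu> * t powr \<beta>))"
proof -
  obtain C where C: "\<And>s. \<sigma> \<le> Re s \<Longrightarrow> Re s \<le> \<sigma> \<Longrightarrow> norm (gamma_pair s * rGamma (1 - of_real \<beta> * s))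
      \<le> C * exp (- 1 * \<bar>Im s\<bar>)"
    using gamma_pair_rGamma_bound[OF \<beta>, of \<sigma> \<sigma>] \<sigma> by auto
  have nz: "Complex \<sigma> v \<noteq> 0" for v using \<sigma> by (auto simp: complex_eq_iff)
  have "continuous_on {s. - 1 < Re s \<and> Re s < 1} gamma_pair"
    by (rule holomorphic_on_imp_continuous_on[OF holomorphic_gamma_pair])
  hence "continuous_on UNIV (\<lambda>v. gamma_pair (Complex \<sigma> v))"
    by (rule continuous_on_compose2) (use \<sigma> in \<open>auto intro!: continuous_intros\<close>)
  moreover have "continuous_on UNIV (\<lambda>v. rGamma (1 - of_real \<beta> * Complex \<sigma> v))"
    by (intro continuous_on_compose2[OF holomorphic_on_imp_continuous_on[OF holomorphic_rGamma]]
        continuous_intros) auto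
  ultimately have "continuous_on UNIV K"
    unfolding K_def using nz by (intro continuous_intros) auto
  hence Kmeas [measurable]: "K \<in> borel_measurable borel"
    by (rule borel_measurable_continuous_onI)
  show K: "integrable lborel K"
  proof (rule integrable_exp_bound[OF Kmeas, of 1])
    fix v
    have "\<sigma> \<le> norm (Complex \<sigma> v)" using abs_Re_le_cmod[of "Complex \<sigma> v"] by simp
    moreover have "norm (gamma_pair (Complex \<sigma> v) * rGamma (1 - of_real \<beta> * Complex \<sigma> v))
        \<le> C * exp (- 1 * \<bar>v\<bar>)"
      using C[of "Complex \<sigma> v"] by simp
    moreover from this have "0 \<le> C * exp (- 1 * \<bar>v\<bar>)" using norm_ge_zero order_trans by blast
    ultimately have "norm (gamma_pair (Complex \<sigma> v) * rGamma (1 - of_real \<beta> * Complex \<sigma> v))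
        / norm (Complex \<sigma> v) \<le> C * exp (- 1 * \<bar>v\<bar>) / \<sigma>"
      using \<sigma> by (intro frac_le) auto
    thus "norm (K v) \<le> C / \<sigma> * exp (- 1 * \<bar>v\<bar>)" by (simp add: K_def norm_mult norm_divide)
  qed simp
  define w where "w = (\<lambda>v. - Complex \<sigma> v)"
  have [measurable]: "w \<in> borel_measurable borel" unfolding w_def by measurable
  have Rew: "Re (w v) = - \<sigma>" for v by (simp add: w_def)
  define m where "m = (\<lambda>t. LINT v|lborel. K v * rpow (\<mu> * t powr \<beta>) (w v))"
  define e where "e = (\<lambda>t. complex_of_real (mittag_leffler \<beta> (- \<mu> * t powr \<beta>)))"
  have contm: "continuous_on {0<..} m"
    unfolding m_def by (rule continuous_on_compose2[OF continuous_on_LINT_rpow[OF K _ Rew]])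
       (use \<mu> in \<open>auto intro!: continuous_intros\<close>)
  have lapm: "((\<lambda>t. of_real (exp (- (p * t))) * m t) has_integral 2 * of_real pi
      * of_real (p powr (\<beta> - 1) / (p powr \<beta> + \<mu>))) {0..}"
    if p: "p > 0" for p
  proof -
    define f where "f = (\<lambda>t v. indicator {0<..} t *\<^sub>R (of_real (exp (- (p * t)))
        * (K v * rpow (\<mu> * t powr \<beta>) (w v))))"
    define A where "A = (\<lambda>t. \<mu> powr (- \<sigma>)
        * (indicator {0<..} t *\<^sub>R (t powr ((1 - \<beta> * \<sigma>) - 1) * exp (- (p * t)))))"
    \<comment> \<open>This makes t^(- \<beta> \<sigma>) integrable at 0, so that the majorant
      \<open>A\<close> has a Laplace integral.\<close>
    have bs: "\<beta> * \<sigma> < 1" using \<beta> \<sigma> mult_left_le[of \<sigma> \<beta>] mult_strict_mono'[of \<beta> 1 \<sigma> 1]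
        by (cases "\<beta> = 1") auto
    have A: "integrable lborel A"
      unfolding A_def using laplace_powr(1)[of "1 - \<beta> * \<sigma>" p] bs p
      by (intro integrable_mult_right) (simp add: set_integrable_def)
    have fm: "case_prod f \<in> borel_measurable (lborel \<Otimes>\<^sub>M lborel)"
      unfolding f_def by measurable
    have fb: "norm (f t v) \<le> A t * norm (K v)" for t v
    proof (cases "t > 0")
      case True
      hence "norm (rpow (\<mu> * t powr \<beta>) (w v)) = \<mu> powr (- \<sigma>) * t powr (- (\<beta> * \<sigma>))"
        using \<mu> by (simp add: norm_rpow Rew powr_mult powr_powr)
      thus ?thesis using True by (simp add: f_def A_def norm_mult mult_ac)
    qed (simp add: f_def A_def)
    note Fub = lborel_Fubini_dominated[OF fm fb A integrable_norm[OF K]]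
    have row: "(LINT v|lborel. f t v) = indicator {0<..} t *\<^sub>R (of_real (exp (- (p * t))) * m t)"
        for t
      by (simp add: f_def m_def)
    \<comment> \<open>The Laplace transform of the power contributes Gamma (1 - \<beta> s), which
      cancels the reciprocal Gamma function in \<open>K\<close>. What remains is the integrand of
      \<open>integral_exp_div_sin\<close> with l = ln (\<mu> / p^\<beta>).\<close>
    have col: "(LINT t|lborel. f t v) = inverse (of_real p) * (gamma_pair (Complex \<sigma> v) / Complex \<sigma>
        v * exp (- of_real (ln (\<mu> / p powr \<beta>)) * Complex \<sigma> v))" for v
    proof -
      define s where "s = Complex \<sigma> v"
      define z where "z = 1 - of_real \<beta> * s"
      have z: "Re z > 0" using bs by (simp add: z_def s_def)
      have "f t v = (K v * rpow \<mu> (- s))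
          * (indicator {0<..} t *\<^sub>R (rpow t (z - 1) * of_real (exp (- (p * t)))))" for t
        using \<mu> by (cases "t > 0") (simp_all add: f_def w_def s_def[symmetric] rpow_mult rpow_powr
            z_def)
      hence "(LINT t|lborel. f t v) = (K v * rpow \<mu> (- s)) * (LINT t:{0<..}|lborel. rpow t (z - 1)
          * of_real (exp (- (p * t))))"
        by (simp only: integral_mult_right_zero set_lebesgue_integral_def)
      also have "(LINT t:{0<..}|lborel. rpow t (z - 1) * of_real (exp (- (p * t))))
          = Gamma z * rpow p (- z)"
        by (rule laplace_rpow(2)[OF z p])
      also have "(K v * rpow \<mu> (- s)) * (Gamma z * rpow p (- z)) = gamma_pair s / s
          * (rGamma z * Gamma z) * (rpow \<mu> (- s) * rpow p (- z))"
        by (simp add: K_def s_def[symmetric] z_def[symmetric])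
      also have "rGamma z * Gamma z = 1"
        using Gamma_eq_zero_iff[of z] z
            by (auto simp: rGamma_inverse_Gamma elim!: nonpos_Ints_cases)
      also have "rpow \<mu> (- s) * rpow p (- z) = inverse (of_real p)
          * exp (- of_real (ln (\<mu> / p powr \<beta>)) * s)"
      proof -
        have 1: "- z = - 1 + of_real \<beta> * s" by (simp add: z_def)
        have 2: "rpow p (- 1) = inverse (of_real p)"
          using rpow_of_real[of p "-1"] p by (simp add: powr_minus)
        have 3: "rpow \<mu> (- s) * rpow p (of_real \<beta> * s) = exp (- of_real (ln (\<mu> / p powr \<beta>)) * s)"
          using \<mu> p by (simp add: rpow_def ln_div ln_powr algebra_simps flip: exp_add)
        show ?thesis unfolding 1 rpow_add 2 3[symmetric] by (rule mult.left_commute)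
      qed
      finally show ?thesis by (simp add: s_def mult_ac)
    qed
    have "(LINT v|lborel. LINT t|lborel. f t v) = inverse (of_real p)
        * (2 * of_real pi / (1 + exp (of_real (ln (\<mu> / p powr \<beta>)))))"
      unfolding col integral_mult_right_zero
      using integral_exp_div_sin(2)[OF \<sigma>, of "of_real (ln (\<mu> / p powr \<beta>))"] by simp
    also have "exp (of_real (ln (\<mu> / p powr \<beta>))) = complex_of_real (\<mu> / p powr \<beta>)"
      using \<mu> p by (simp add: exp_of_real)
    also have "inverse (of_real p) * (2 * of_real pi / (1 + of_real (\<mu> / p powr \<beta>)))
        = 2 * complex_of_real pi * of_real (p powr (\<beta> - 1) / (p powr \<beta> + \<mu>))"
    proof -
      have "inverse p * (2 * pi / (1 + \<mu> / p powr \<beta>)) = 2 * pi * (p powr (\<beta> - 1) / (p powr \<beta> + \<mu>))"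
        using p \<mu> by (simp add: powr_diff field_simps add_pos_pos)
      from arg_cong[OF this, of complex_of_real] show ?thesis by simp
    qed
    finally have "(LINT t|lborel. LINT v|lborel. f t v)
        = 2 * of_real pi * of_real (p powr (\<beta> - 1) / (p powr \<beta> + \<mu>))"
      using Fub(2) by simp
    hence "set_integrable lborel {0<..} (\<lambda>t. of_real (exp (- (p * t))) * m t)"
      "(LINT t:{0<..}|lborel. of_real (exp (- (p * t))) * m t)
          = 2 * of_real pi * of_real (p powr (\<beta> - 1) / (p powr \<beta> + \<mu>))"
      using Fub(1) unfolding row set_integrable_def set_lebesgue_integral_def by auto
    moreover have "{0<..} \<subseteq> {0::real..}" "{0..} - {0<..} \<subseteq> {0::real}" by auto
    ultimately show ?thesis using set_integrable_imp_has_integral by metis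
  qed
  \<comment> \<open>Here p has to be large, since the transform of the Mittag-Leffler function was
    obtained from a geometric series. Lerch's theorem only asks for large p.\<close>
  have "((\<lambda>t. of_real (exp (- (p * t))) * (m t - 2 * of_real pi * e t)) has_integral 0) {0..}"
    if p: "p > (\<mu> + 1) powr (1 / \<beta>)" for p
  proof -
    have p': "p > 0" "p powr \<beta> > \<mu>" using powr_gt_threshold[OF \<beta> _ p] \<mu> by auto
    have "((\<lambda>t. of_real (exp (- (p * t))) * e t)
        has_integral of_real (p powr (\<beta> - 1) / (p powr \<beta> + \<mu>))) {0..}"
      using has_laplace_transform_relaxation[OF \<beta> _ p'] \<mu>
          by (simp add: has_laplace_transform_def e_def)
    from has_integral_diff[OF lapm[OF p'(1)] has_integral_mult_right[OF this, of "2 * of_real pi"]]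
    show ?thesis by (simp add: right_diff_distrib mult_ac)
  qed
  moreover have "continuous_on {0<..} (\<lambda>t. m t - 2 * of_real pi * e t)"
    unfolding e_def
    by (intro continuous_intros contm continuous_on_subset[OF continuous_on_relaxation[OF \<beta>]])
        (use \<mu> in auto)
  ultimately have "m t - 2 * of_real pi * e t = 0"
    using laplace_unique[of "\<lambda>t. m t - 2 * of_real pi * e t" "(\<mu> + 1) powr (1 / \<beta>)" t] t by blast
  thus "(LINT v|lborel. K v * rpow (\<mu> * t powr \<beta>) (- Complex \<sigma> v))
      = 2 * of_real pi * of_real (mittag_leffler \<beta> (- \<mu> * t powr \<beta>))"
    by (simp add: m_def e_def w_def)
qed

subsection \<open>Fourier transforms of powers\<close>

lemma integral_powr_Ioc:
  fixes a R :: real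
  assumes a: "a < 1" and R: "R \<ge> 0"
  shows "set_integrable lborel {0<..R} (\<lambda>x. x powr (- a))"
    and "(LINT x:{0<..R}|lborel. x powr (- a)) = R powr (1 - a) / (1 - a)"
proof -
  have *: "((\<lambda>x. x powr (- a)) has_integral R powr (1 - a) / (1 - a)) {0..R}"
    using has_integral_powr_from_0[of "- a" R] a R by (simp add: add.commute)
  hence "(\<lambda>x. x powr (- a)) absolutely_integrable_on {0..R}"
    by (intro nonnegative_absolutely_integrable_1) (auto simp: has_integral_iff)
  hence "(\<lambda>x. x powr (- a)) absolutely_integrable_on {0<..R}"
    by (rule set_integrable_subset) auto
  thus **: "set_integrable lborel {0<..R} (\<lambda>x. x powr (- a))"
    unfolding set_integrable_def by (subst (asm) integrable_completion) auto
  have "((\<lambda>x. x powr (- a)) has_integral (LINT x:{0<..R}|lborel. x powr (- a))) {0..R}"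
    by (rule set_integrable_imp_has_integral[OF **, of _ 0]) auto
  from has_integral_unique[OF this *]
  show "(LINT x:{0<..R}|lborel. x powr (- a)) = R powr (1 - a) / (1 - a)" .
qed

text \<open>For Re w < 1 this integral is absolutely convergent, whereas its limit for R tending to
  infinity is in general only an improper integral.\<close>

definition truncated_fourier :: "real \<Rightarrow> complex \<Rightarrow> real \<Rightarrow> complex" where
  "truncated_fourier \<theta> w R = (LINT x:{0<..R}|lborel. rpow x (- w) * exp (\<i> * of_real (\<theta> * x)))"

lemma set_integrable_rpow_cis:
  assumes w: "Re w < 1" and R: "R \<ge> 0"
  shows "set_integrable lborel {0<..R} (\<lambda>x. rpow x (- w) * exp (\<i> * of_real (\<theta> * x)))"
  by (rule set_integrable_bound[OF integral_powr_Ioc(1)[OF w R]])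
     (auto simp: set_borel_measurable_def norm_mult norm_rpow intro!: AE_I2)

lemma norm_truncated_fourier_small:
  assumes w: "Re w < 1" and R: "0 \<le> R" "R \<le> 1"
  shows "norm (truncated_fourier \<theta> w R) \<le> 1 / (1 - Re w)"
proof -
  have "norm (truncated_fourier \<theta> w R)
      \<le> (LINT x:{0<..R}|lborel. norm (rpow x (- w) * exp (\<i> * of_real (\<theta> * x))))"
    unfolding truncated_fourier_def
        by (rule set_integral_norm_bound[OF set_integrable_rpow_cis[OF w R(1)]])
  also have "\<dots> = (LINT x:{0<..R}|lborel. x powr (- Re w))"
    by (rule set_lebesgue_integral_cong) (auto simp: norm_mult norm_rpow)
  also have "\<dots> = R powr (1 - Re w) / (1 - Re w)" by (rule integral_powr_Ioc[OF w R(1)])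
  also have "\<dots> \<le> 1 / (1 - Re w)"
    using w R by (intro divide_right_mono powr_le1) auto
  finally show ?thesis .
qed

text \<open>A single integration by parts improves the power to the absolutely integrable exponent -
  w - 1 at the price of a factor w. This is the origin of the linear growth in |w|.\<close>

lemma norm_integral_rpow_cis_tail:
  assumes w: "Re w > 0" and \<theta>: "\<theta> \<noteq> 0" and R: "R \<ge> 1"
  shows "norm (integral {1..R} (\<lambda>x. rpow x (- w) * exp (\<i> * of_real (\<theta> * x)))) \<le> 2 / \<bar>\<theta>\<bar>
      + norm w / (\<bar>\<theta>\<bar> * Re w)"
proof -
  define E where "E = (\<lambda>x. exp (\<i> * complex_of_real (\<theta> * x)))"
  define k where "k = \<i> * complex_of_real \<theta>"
  have k: "k \<noteq> 0" "norm k = \<bar>\<theta>\<bar>" using \<theta> by (auto simp: k_def norm_mult)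
  define h where "h = (\<lambda>x. rpow x (- w) * (E x / k))"
  have E_deriv: "(E has_vector_derivative k * E x) (at x within S)" for x S
  proof -
    have "((\<lambda>z. exp (k * z)) has_field_derivative k * exp (k * of_real x)) (at (of_real x))"
      by (auto intro!: derivative_eq_intros)
    from has_vector_derivative_real_field[OF this] show ?thesis
      by (simp add: E_def[abs_def] k_def mult_ac)
  qed
  have contE: "continuous_on S E" for S unfolding E_def by (intro continuous_intros)
  have contr: "continuous_on {1..R} (\<lambda>x. rpow x z)" for z
    by (intro continuous_on_rpow_left) auto
  have "((\<lambda>x. rpow x (- w) * E x - w / k * (rpow x (- w - 1) * E x)) has_integral h R - h 1) {1..R}"
  proof (rule fundamental_theorem_of_calculus[OF R])
    fix x assume x: "x \<in> {1..R}"
    have "(h has_vector_derivative (rpow x (- w) * (k * E x / k) + (- w * rpow x (- w - 1))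
        * (E x / k))) (at x within {1..R})"
      unfolding h_def using x by (intro has_vector_derivative_mult rpow_has_vector_derivative
          has_vector_derivative_divide E_deriv) auto
    also have "rpow x (- w) * (k * E x / k) + (- w * rpow x (- w - 1)) * (E x / k)
        = rpow x (- w) * E x - w / k * (rpow x (- w - 1) * E x)"
      using k by (simp add: field_simps)
    finally show "(h has_vector_derivative rpow x (- w) * E x - w / k * (rpow x (- w - 1) * E x))
        (at x within {1..R})" .
  qed
  moreover have int: "(\<lambda>x. rpow x (- w - 1) * E x) integrable_on {1..R}"
    by (intro integrable_continuous_interval continuous_intros contE contr)
  ultimately have "((\<lambda>x. (rpow x (- w) * E x - w / k * (rpow x (- w - 1) * E x))
      + w / k * (rpow x (- w - 1) * E x)) has_integral
     (h R - h 1) + w / k * integral {1..R} (\<lambda>x. rpow x (- w - 1) * E x)) {1..R}"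
    by (intro has_integral_add has_integral_mult_right integrable_integral)
  hence eq: "integral {1..R} (\<lambda>x. rpow x (- w) * E x) = (h R - h 1) + w / k * integral {1..R}
      (\<lambda>x. rpow x (- w - 1) * E x)"
    by (simp add: integral_unique)
  have nE: "norm (E x) = 1" for x by (simp add: E_def)
  have hb: "norm (h x) \<le> 1 / \<bar>\<theta>\<bar>" if "x \<ge> 1" for x
  proof -
    have "x powr (- Re w) \<le> 1" using that w
        by (simp add: powr_minus inverse_le_1_iff ge_one_powr_ge_zero)
    thus ?thesis using that k by (simp add: h_def norm_mult norm_divide nE norm_rpow
        divide_right_mono)
  qed
  have pw: "((\<lambda>x. x powr (- Re w - 1)) has_integral (- (R powr (- Re w) / Re w) -
      - (1 powr (- Re w) / Re w))) {1..R}"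
  proof (rule fundamental_theorem_of_calculus[OF R])
    fix x assume x: "x \<in> {1..R}"
    have "((\<lambda>x. - (x powr (- Re w) / Re w)) has_real_derivative x powr (- Re w - 1))
        (at x within {1..R})"
      using x w by (auto intro!: derivative_eq_intros simp: powr_diff)
    thus "((\<lambda>x. - (x powr (- Re w) / Re w)) has_vector_derivative x powr (- Re w - 1))
        (at x within {1..R})"
      by (simp add: has_real_derivative_iff_has_vector_derivative)
  qed
  have "norm (integral {1..R} (\<lambda>x. rpow x (- w - 1) * E x)) \<le> integral {1..R}
      (\<lambda>x. x powr (- Re w - 1))"
    by (rule integral_norm_bound_integral[OF int])
        (use pw in \<open>auto simp: norm_mult nE norm_rpow has_integral_iff\<close>)
  also have "\<dots> \<le> 1 / Re w" using integral_unique[OF pw] w by simp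
  finally have "norm (w / k) * norm (integral {1..R} (\<lambda>x. rpow x (- w - 1) * E x))
      \<le> norm w / \<bar>\<theta>\<bar> * (1 / Re w)"
    using k by (simp only: norm_divide) (intro mult_left_mono, auto)
  moreover have "norm (h R - h 1) \<le> 1 / \<bar>\<theta>\<bar> + 1 / \<bar>\<theta>\<bar>"
    using norm_triangle_ineq4[of "h R" "h 1"] hb[of R] hb[of 1] R by linarith
  ultimately have "norm (integral {1..R} (\<lambda>x. rpow x (- w) * E x)) \<le> (1 / \<bar>\<theta>\<bar> + 1 / \<bar>\<theta>\<bar>)
      + norm w / \<bar>\<theta>\<bar> * (1 / Re w)"
    unfolding eq using norm_triangle_ineq[of "h R - h 1"
        "w / k * integral {1..R} (\<lambda>x. rpow x (- w - 1) * E x)"]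
    unfolding norm_mult by linarith
  thus ?thesis by (simp add: E_def)
qed

text \<open>The interval is split at 1: absolute integrability below, oscillation above. What
  matters is that the constant depends neither on R nor on Im w.\<close>

lemma truncated_fourier_bound:
  assumes a: "0 < a" "a < 1" and \<theta>: "\<theta> \<noteq> 0"
  shows "\<exists>C\<ge>0. \<forall>w R. Re w = a \<longrightarrow> R \<ge> 0 \<longrightarrow> norm (truncated_fourier \<theta> w R) \<le> C * (1 + norm w)"
proof -
  define C where "C = 1 / (1 - a) + 2 / \<bar>\<theta>\<bar> + 1 / (\<bar>\<theta>\<bar> * a)"
  have "norm (truncated_fourier \<theta> w R) \<le> C * (1 + norm w)" if w: "Re w = a" and R: "R \<ge> 0" for w R
  proof -
    have w1: "Re w < 1" using w a by simp
    have "norm (truncated_fourier \<theta> w R) \<le> 1 / (1 - a) + (2 / \<bar>\<theta>\<bar> + norm w / (\<bar>\<theta>\<bar> * a))"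
    proof (cases "R \<le> 1")
      case True
      have "norm (truncated_fourier \<theta> w R) \<le> 1 / (1 - a)"
        using norm_truncated_fourier_small[OF w1 R True, of \<theta>] w by simp
      moreover have "0 \<le> 2 / \<bar>\<theta>\<bar> + norm w / (\<bar>\<theta>\<bar> * a)" using a by simp
      ultimately show ?thesis by linarith
    next
      case False
      have un: "{0<..R} = {0<..1} \<union> {1<..R}" using False by auto
      have s: "set_integrable lborel {1<..R} (\<lambda>x. rpow x (- w) * exp (\<i> * of_real (\<theta> * x)))"
        by (rule set_integrable_subset[OF set_integrable_rpow_cis[OF w1 R]]) auto
      have "truncated_fourier \<theta> w R = truncated_fourier \<theta> w 1
          + (LINT x:{1<..R}|lborel. rpow x (- w) * exp (\<i> * of_real (\<theta> * x)))"
        unfolding truncated_fourier_def un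
        by (rule set_integral_Un) (use s set_integrable_rpow_cis[OF w1, of 1] in auto)
      also have "(LINT x:{1<..R}|lborel. rpow x (- w) * exp (\<i> * of_real (\<theta> * x))) = integral {1..R}
          (\<lambda>x. rpow x (- w) * exp (\<i> * of_real (\<theta> * x)))"
        by (rule integral_unique[OF set_integrable_imp_has_integral[OF s, of _ 1], symmetric]) auto
      finally have "norm (truncated_fourier \<theta> w R) \<le> norm (truncated_fourier \<theta> w 1)
          + norm (integral {1..R} (\<lambda>x. rpow x (- w) * exp (\<i> * of_real (\<theta> * x))))"
        by (simp add: norm_triangle_ineq)
      also have "\<dots> \<le> 1 / (1 - a) + (2 / \<bar>\<theta>\<bar> + norm w / (\<bar>\<theta>\<bar> * a))"
        using norm_truncated_fourier_small[OF w1, of 1 \<theta>] norm_integral_rpow_cis_tail[of w \<theta> R] w a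
            \<theta> False
        by (intro add_mono) auto
      finally show ?thesis .
    qed
    also have "\<dots> \<le> C * (1 + norm w)"
      using a by (simp add: C_def ring_distribs)
    finally show ?thesis .
  qed
  moreover have "C \<ge> 0" using a by (simp add: C_def)
  ultimately show ?thesis by blast
qed

lemma rGamma_measurable [measurable]:
  assumes "f \<in> borel_measurable M"
  shows "(\<lambda>x. rGamma (f x) :: complex) \<in> borel_measurable M"
proof -
  have "rGamma \<in> borel_measurable (borel :: complex measure)"
    by (intro borel_measurable_continuous_onI holomorphic_on_imp_continuous_on holomorphic_rGamma)
  from measurable_compose[OF assms this] show ?thesis .
qed

text \<open>The limit of \<open>truncated_fourier\<close>, written as an absolutely convergent
  integral: represent x^(- w) as a superposition of exp (- x u) and integrate exp ((i \<theta> - u)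
  x) over x > 0.\<close>

definition half_fourier :: "real \<Rightarrow> complex \<Rightarrow> complex" where
  "half_fourier \<theta> w = rGamma w * (LINT u:{0<..}|lborel. rpow u (w - 1)
      / (of_real u - \<i> * of_real \<theta>))"

text \<open>The second function is the majorant for the limit in
  \<open>truncated_fourier_tendsto\<close>.\<close>

lemma set_integrable_rpow_div_linear:
  assumes w: "0 < Re w" "Re w < 1" and \<theta>: "\<theta> \<noteq> 0"
  shows "set_integrable lborel {0<..} (\<lambda>u. rpow u (w - 1) / (of_real u - \<i> * of_real \<theta>))" (is ?A)
    and "set_integrable lborel {0<..}
        (\<lambda>u. u powr (Re w - 1) * (2 / norm (of_real u - \<i> * of_real \<theta>)))" (is ?B)
proof -
  \<comment> \<open>With q = u^2 + \<theta>^2 one has 1 / sqrt q \<le> (u + |\<theta>|) / q. This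
    leads to \<open>integral_rpow_div_sum_squares\<close> with the exponents Re w and Re w - 1, both
    between -1 and 1.\<close>
  define b where "b = (\<lambda>u. complex_of_real 2 * (rpow u (of_real (Re w)) / of_real (u\<^sup>2 + \<bar>\<theta>\<bar>\<^sup>2)
      + of_real \<bar>\<theta>\<bar> * (rpow u (of_real (Re w) - 1) / of_real (u\<^sup>2 + \<bar>\<theta>\<bar>\<^sup>2))))"
  have b: "set_integrable lborel {0<..} b"
    unfolding b_def by (intro set_integrable_mult_right set_integral_add
        integral_rpow_div_sum_squares) (use w \<theta> in auto)
  have le: "norm (u powr (Re w - 1) * (2 / norm (of_real u - \<i> * of_real \<theta>))) \<le> norm (b u)"
      if u: "u > 0" for u
  proof -
    define q where "q = u\<^sup>2 + \<bar>\<theta>\<bar>\<^sup>2"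
    have q: "q > 0" using u by (simp add: q_def add_pos_nonneg)
    have n: "norm (of_real u - \<i> * of_real \<theta>) = sqrt q"
      by (simp add: cmod_def q_def)
    have "q \<le> (u + \<bar>\<theta>\<bar>)\<^sup>2" using u by (simp add: q_def power2_sum)
    hence "sqrt q \<le> u + \<bar>\<theta>\<bar>" using u by (simp add: real_le_lsqrt)
    moreover have "2 / sqrt q = 2 * sqrt q / q"
      using q real_div_sqrt[of q] by (simp add: field_simps)
    ultimately have "2 / sqrt q \<le> 2 * (u + \<bar>\<theta>\<bar>) / q"
      using q by (simp add: divide_right_mono)
    hence 1: "u powr (Re w - 1) * (2 / sqrt q) \<le> u powr (Re w - 1) * (2 * (u + \<bar>\<theta>\<bar>) / q)"
      by (intro mult_left_mono) auto
    have r1: "rpow u (of_real (Re w)) = of_real (u powr Re w)" using u by (rule rpow_of_real)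
    have r2: "rpow u (of_real (Re w) - 1) = of_real (u powr (Re w - 1))"
        using u rpow_of_real[of u "Re w - 1"] by simp
    have "u powr Re w = u powr (Re w - 1) * u" using u by (simp add: powr_diff)
    hence 2: "u powr (Re w - 1) * (2 * (u + \<bar>\<theta>\<bar>) / q)
        = 2 * (u powr Re w / q + \<bar>\<theta>\<bar> * (u powr (Re w - 1) / q))"
      by (simp add: add_divide_distrib ring_distribs mult_ac)
    have "b u = of_real (2 * (u powr Re w / q + \<bar>\<theta>\<bar> * (u powr (Re w - 1) / q)))"
      by (simp add: b_def r1 r2 q_def)
    hence "norm (b u) = 2 * (u powr Re w / q + \<bar>\<theta>\<bar> * (u powr (Re w - 1) / q))"
      using q by (simp only: norm_of_real) (intro abs_of_nonneg, auto)
    thus ?thesis using 1 2 q by (simp add: n abs_mult)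
  qed
  show ?B
    by (rule set_integrable_bound[OF b])
       (use le in \<open>auto simp: set_borel_measurable_def intro!: AE_I2\<close>)
  show ?A
  proof (rule set_integrable_bound[OF b])
    show "AE u in lborel. u \<in> {0<..} \<longrightarrow> norm (rpow u (w - 1) / (of_real u - \<i> * of_real \<theta>))
        \<le> norm (b u)"
    proof (intro AE_I2 impI)
      fix u :: real assume u: "u \<in> {0<..}"
      have "norm (rpow u (w - 1) / (of_real u - \<i> * of_real \<theta>))
          \<le> norm (u powr (Re w - 1) * (2 / norm (of_real u - \<i> * of_real \<theta>)))"
        using u by (simp add: norm_divide norm_rpow abs_mult divide_right_mono)
      with le[of u] u show "norm (rpow u (w - 1) / (of_real u - \<i> * of_real \<theta>)) \<le> norm (b u)"
          by simp
    qed
  qed (auto simp: set_borel_measurable_def)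
qed

lemma truncated_fourier_eq:
  assumes w: "0 < Re w" "Re w < 1" and \<theta>: "\<theta> \<noteq> 0" and R: "R \<ge> 0"
  shows "truncated_fourier \<theta> w R = rGamma w *
    (LINT u:{0<..}|lborel. rpow u (w - 1) * ((1 - exp ((\<i> * of_real \<theta> - of_real u) * of_real R))
        / (of_real u - \<i> * of_real \<theta>)))"
proof -
  define f where "f = (\<lambda>x u. indicator {0<..R} x *\<^sub>R (indicator {0<..} u *\<^sub>R
     (rpow u (w - 1) * of_real (exp (- (x * u))) * exp (\<i> * of_real (\<theta> * x)))))"
  have fm: "case_prod f \<in> borel_measurable (lborel \<Otimes>\<^sub>M lborel)"
    unfolding f_def by measurable
  have nf: "norm (f x u) = indicator {0<..R}
      x *\<^sub>R (indicator {0<..} u *\<^sub>R (u powr (Re w - 1) * exp (- (x * u))))" for x u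
    by (auto simp: f_def indicator_def norm_mult norm_rpow)
  have int1: "(LINT u|lborel. norm (f x u))
      = Gamma (Re w) * (indicator {0<..R} x *\<^sub>R x powr (- Re w))" for x
    unfolding nf using laplace_powr(2)[of "Re w" x] w
        by (simp add: set_lebesgue_integral_def indicator_def)
  have row: "integrable lborel (\<lambda>u. f x u)"
    "(LINT u|lborel. f x u) = indicator {0<..R} x *\<^sub>R (exp (\<i> * of_real (\<theta> * x))
        * (Gamma w * rpow x (- w)))" for x
  proof -
    have eq: "f x u = (of_real (indicator {0<..R} x) * exp (\<i> * of_real (\<theta> * x)))
        * (indicator {0<..} u *\<^sub>R (rpow u (w - 1) * of_real (exp (- (x * u)))))" for u
      by (simp add: f_def indicator_def)
    have l: "integrable lborel (\<lambda>u. indicator {0<..}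
        u *\<^sub>R (rpow u (w - 1) * of_real (exp (- (x * u)))))"
       "(LINT u|lborel. indicator {0<..} u *\<^sub>R (rpow u (w - 1) * of_real (exp (- (x * u)))))
           = Gamma w * rpow x (- w)" if "x > 0"
      using laplace_rpow[of w x] w that by (auto simp: set_integrable_def set_lebesgue_integral_def)
    show "integrable lborel (\<lambda>u. f x u)"
    proof (cases "x > 0")
      case True
      show ?thesis unfolding eq by (intro integrable_mult_right l True)
    qed (simp add: f_def)
    show "(LINT u|lborel. f x u) = indicator {0<..R} x *\<^sub>R (exp (\<i> * of_real (\<theta> * x))
        * (Gamma w * rpow x (- w)))"
    proof (cases "x > 0")
      case True
      show ?thesis unfolding eq integral_mult_right_zero l(2)[OF True] by (simp add: indicator_def)
    qed (simp add: f_def)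
  qed
  \<comment> \<open>On the bounded interval Fubini is legitimate: integrating the norm over u leaves
    Gamma (Re w) x^(- Re w), which is integrable up to R.\<close>
  have "integrable (lborel \<Otimes>\<^sub>M lborel) (case_prod f)"
  proof (rule lborel_pair.Fubini_integrable[OF fm])
    show "integrable lborel (\<lambda>x. LINT u|lborel. norm (case_prod f (x, u)))"
      using integral_powr_Ioc(1)[OF w(2) R] by (simp add: int1 set_integrable_def)
  qed (use row in auto)
  from lborel_pair.Fubini_integral[OF this]
  have Fub: "(LINT u|lborel. LINT x|lborel. f x u) = (LINT x|lborel. LINT u|lborel. f x u)" .
  have "indicator {0<..R} x *\<^sub>R (exp (\<i> * of_real (\<theta> * x)) * (Gamma w * rpow x (- w)))
      = Gamma w * (indicator {0<..R} x *\<^sub>R (rpow x (- w) * exp (\<i> * of_real (\<theta> * x))))" for x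
    by simp
  hence 1: "(LINT x|lborel. LINT u|lborel. f x u) = Gamma w * truncated_fourier \<theta> w R"
    unfolding row truncated_fourier_def set_lebesgue_integral_def
        by (simp only: integral_mult_right_zero)
  have col: "(LINT x|lborel. f x u) = indicator {0<..}
      u *\<^sub>R (rpow u (w - 1) * ((1 - exp ((\<i> * of_real \<theta> - of_real u) * of_real R))
      / (of_real u - \<i> * of_real \<theta>)))" for u
  proof -
    define k where "k = \<i> * of_real \<theta> - complex_of_real u"
    have k: "k \<noteq> 0" using \<theta> by (auto simp: k_def complex_eq_iff)
    have cont: "continuous_on S (\<lambda>x. exp (k * of_real x))" for S by (intro continuous_intros)
    have "set_integrable lborel {0..R} (\<lambda>x. exp (k * of_real x))"
      unfolding set_integrable_def by (intro borel_integrable_compact cont) auto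
    hence s: "set_integrable lborel {0<..R} (\<lambda>x. exp (k * of_real x))"
      by (rule set_integrable_subset) auto
    have "((\<lambda>x. exp (k * of_real x)) has_integral exp (k * of_real R) / k - exp (k * of_real 0) / k)
        {0..R}"
    proof (rule fundamental_theorem_of_calculus[OF R])
      fix x
      have "((\<lambda>z. exp (k * z) / k) has_field_derivative exp (k * of_real x)) (at (of_real x))"
        using k by (auto intro!: derivative_eq_intros)
      from has_vector_derivative_real_field[OF this]
      show "((\<lambda>x. exp (k * of_real x) / k) has_vector_derivative exp (k * of_real x))
          (at x within {0..R})" .
    qed
    hence "(LINT x:{0<..R}|lborel. exp (k * of_real x)) = exp (k * of_real R) / k
        - exp (k * of_real 0) / k"
      by (intro has_integral_unique[OF set_integrable_imp_has_integral[OF s, of _ 0]]) auto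
    hence val: "(LINT x|lborel. indicator {0<..R} x *\<^sub>R exp (k * of_real x))
        = (1 - exp (k * of_real R)) / (- k)"
      by (simp add: set_lebesgue_integral_def diff_divide_distrib)
    have "of_real (exp (- (x * u))) * exp (\<i> * of_real (\<theta> * x)) = exp (k * of_real x)" for x
      by (simp add: k_def exp_of_real[symmetric] algebra_simps flip: exp_add)
    hence "f x u = (indicator {0<..} u *\<^sub>R rpow u (w - 1))
        * (indicator {0<..R} x *\<^sub>R exp (k * of_real x))" for x
      by (simp add: f_def mult.assoc)
    hence "(LINT x|lborel. f x u) = (indicator {0<..} u *\<^sub>R rpow u (w - 1))
        * ((1 - exp (k * of_real R)) / (- k))"
      by (simp only: integral_mult_right_zero val)
    moreover have "- k = of_real u - \<i> * of_real \<theta>" by (simp add: k_def)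
    ultimately show ?thesis unfolding mult_scaleR_left by (simp only: k_def)
  qed
  have "rGamma w * Gamma w = 1"
    using Gamma_eq_zero_iff[of w] w by (auto simp: rGamma_inverse_Gamma elim!: nonpos_Ints_cases)
  hence "truncated_fourier \<theta> w R = rGamma w * (Gamma w * truncated_fourier \<theta> w R)"
    by (simp flip: mult.assoc)
  also have "\<dots> = rGamma w * (LINT u|lborel. LINT x|lborel. f x u)" by (simp only: 1 Fub)
  finally show ?thesis unfolding col set_lebesgue_integral_def .
qed

lemma truncated_fourier_tendsto:
  assumes w: "0 < Re w" "Re w < 1" and \<theta>: "\<theta> \<noteq> 0"
  shows "(truncated_fourier \<theta> w \<longlongrightarrow> half_fourier \<theta> w) at_top"
proof -
  define g where "g = (\<lambda>R u. indicator {0<..}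
      u *\<^sub>R (rpow u (w - 1) * ((1 - exp ((\<i> * of_real \<theta> - of_real u) * of_real R))
      / (of_real u - \<i> * of_real \<theta>))))"
  have ne: "exp ((\<i> * of_real \<theta> - of_real u) * of_real R) = exp (- (R * u)) *\<^sub>R
      exp (\<i> * of_real (\<theta> * R))" for u R
    by (simp add: scaleR_conv_of_real exp_of_real[symmetric] algebra_simps flip: exp_add)
  have "((\<lambda>R. LINT u|lborel. g R u)
      \<longlongrightarrow> (LINT u|lborel. indicator {0<..} u *\<^sub>R (rpow u (w - 1) / (of_real u - \<i> * of_real \<theta>))))
      at_top"
  proof (rule integral_dominated_convergence_at_top)
    show "integrable lborel (\<lambda>u. indicator {0<..}
        u *\<^sub>R (u powr (Re w - 1) * (2 / norm (of_real u - \<i> * of_real \<theta>))))"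
      using set_integrable_rpow_div_linear(2)[OF w \<theta>] by (simp add: set_integrable_def)
    show "AE u in lborel. ((\<lambda>R. g R u) \<longlongrightarrow> indicator {0<..}
        u *\<^sub>R (rpow u (w - 1) / (of_real u - \<i> * of_real \<theta>))) at_top"
    proof (intro AE_I2)
      fix u :: real
      show "((\<lambda>R. g R u) \<longlongrightarrow> indicator {0<..} u *\<^sub>R (rpow u (w - 1) / (of_real u - \<i> * of_real \<theta>)))
          at_top"
      proof (cases "u > 0")
        case True
        have "((\<lambda>R. exp (- (R * u))) \<longlongrightarrow> 0) at_top" using True by real_asymp
        hence "((\<lambda>R. exp ((\<i> * of_real \<theta> - of_real u) * of_real R)) \<longlongrightarrow> 0) at_top"
          by (rule Lim_null_comparison[rotated]) (simp only: ne, simp)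
        moreover have "of_real u - \<i> * of_real \<theta> \<noteq> 0" using \<theta> by (auto simp: complex_eq_iff)
        ultimately have "((\<lambda>R. rpow u (w - 1) * ((1 - exp ((\<i> * of_real \<theta> - of_real u) * of_real R))
            / (of_real u - \<i> * of_real \<theta>)))
            \<longlongrightarrow> rpow u (w - 1) * ((1 - 0) / (of_real u - \<i> * of_real \<theta>))) at_top"
          by (intro tendsto_mult tendsto_divide tendsto_diff tendsto_const)
        thus ?thesis using True by (simp add: g_def)
      qed (simp add: g_def)
    qed
    show "\<forall>\<^sub>F R in at_top. AE u in lborel. norm (g R u) \<le> indicator {0<..}
        u *\<^sub>R (u powr (Re w - 1) * (2 / norm (of_real u - \<i> * of_real \<theta>)))"
      using eventually_ge_at_top[of 0]
    proof eventually_elim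
      case (elim R)
      \<comment> \<open>The exponential has modulus exp (- R u) \<le> 1, which explains the factor 2
        in the majorant.\<close>
      have "norm (1 - exp ((\<i> * of_real \<theta> - of_real u) * of_real R)) \<le> 2" if "u > 0" for u
      proof -
        have "norm (exp ((\<i> * of_real \<theta> - of_real u) * of_real R)) \<le> 1"
          unfolding ne using that elim by simp
        moreover have "norm (1 - exp ((\<i> * of_real \<theta> - of_real u) * of_real R)) \<le> 1
            + norm (exp ((\<i> * of_real \<theta> - of_real u) * of_real R))"
          using norm_triangle_ineq4[of 1 "exp ((\<i> * of_real \<theta> - of_real u) * of_real R)"]
              by (simp only: norm_one)
        ultimately show ?thesis by linarith
      qed
      thus ?case
        by (intro AE_I2) (auto simp: g_def indicator_def norm_mult norm_divide norm_rpow intro!: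
            mult_left_mono divide_right_mono)
    qed
  qed (unfold g_def, measurable)
  hence "((\<lambda>R. rGamma w * (LINT u|lborel. g R u)) \<longlongrightarrow> half_fourier \<theta> w) at_top"
    unfolding half_fourier_def set_lebesgue_integral_def by (intro tendsto_intros)
  moreover have "\<forall>\<^sub>F R in at_top. rGamma w * (LINT u|lborel. g R u) = truncated_fourier \<theta> w R"
    using eventually_ge_at_top[of 0]
    by eventually_elim (simp add: truncated_fourier_eq[OF w \<theta>] g_def set_lebesgue_integral_def)
  ultimately show ?thesis by (rule Lim_transform_eventually)
qed

text \<open>
  \<open>cos_mellin w = Gamma (1 - w) * sin (pi * w / 2)\<close>, the Mellin transform of the cosine at
  \<open>1 - w\<close>, in a form which is holomorphic for \<open>Re w < 1\<close>.
\<close>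

definition cos_mellin :: "complex \<Rightarrow> complex" where
  "cos_mellin w = of_real pi * rGamma w / (2 * cos (of_real pi * w / 2))"

text \<open>The two half lines of an even function contribute 1 / (u - i \<theta>) + 1 / (u + i
  \<theta>) = 2 u / (u^2 + \<theta>^2), which \<open>integral_rpow_div_sum_squares\<close>
  evaluates.\<close>

lemma half_fourier_sum:
  assumes w: "0 < Re w" "Re w < 1" and \<theta>: "\<theta> \<noteq> 0"
  shows "half_fourier \<theta> w + half_fourier (- \<theta>) w = 2 * rpow \<bar>\<theta>\<bar> (w - 1) * cos_mellin w"
proof -
  have s: "set_integrable lborel {0<..} (\<lambda>u. rpow u (w - 1) / (of_real u - \<i> * of_real \<theta>))"
    "set_integrable lborel {0<..} (\<lambda>u. rpow u (w - 1) / (of_real u - \<i> * of_real (- \<theta>)))"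
    using set_integrable_rpow_div_linear(1)[OF w, of \<theta>] set_integrable_rpow_div_linear(1)[OF w,
        of "- \<theta>"] \<theta> by auto
  have eq: "rpow u (w - 1) / (of_real u - \<i> * of_real \<theta>)
      + rpow u (w - 1) / (of_real u - \<i> * of_real (- \<theta>))
      = 2 * (rpow u w / of_real (u\<^sup>2 + \<bar>\<theta>\<bar>\<^sup>2))" if u: "u \<in> {0<..}" for u
  proof -
    define p q where "p = complex_of_real u - \<i> * of_real \<theta>" and "q = complex_of_real u
        - \<i> * of_real (- \<theta>)"
    have nz: "p \<noteq> 0" "q \<noteq> 0" using \<theta> by (auto simp: p_def q_def complex_eq_iff)
    have pq: "p * q = of_real (u\<^sup>2 + \<bar>\<theta>\<bar>\<^sup>2)" "p + q = 2 * of_real u"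
      by (auto simp: p_def q_def complex_eq_iff power2_eq_square)
    have "rpow u w = rpow u (w - 1) * of_real u"
      using rpow_add[of u "w - 1" 1] rpow_of_real[of u 1] u by simp
    moreover have "rpow u (w - 1) / p + rpow u (w - 1) / q = rpow u (w - 1) * (p + q) / (p * q)"
      using nz by (simp add: field_simps)
    ultimately show ?thesis unfolding p_def[symmetric] q_def[symmetric] pq by simp
  qed
  have "half_fourier \<theta> w + half_fourier (- \<theta>) w = rGamma w *
     (LINT u:{0<..}|lborel. rpow u (w - 1) / (of_real u - \<i> * of_real \<theta>)
         + rpow u (w - 1) / (of_real u - \<i> * of_real (- \<theta>)))"
    unfolding half_fourier_def using s by (simp only: set_integral_add ring_distribs)
  also have "(LINT u:{0<..}|lborel. rpow u (w - 1) / (of_real u - \<i> * of_real \<theta>)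
      + rpow u (w - 1) / (of_real u - \<i> * of_real (- \<theta>)))
      = (LINT u:{0<..}|lborel. 2 * (rpow u w / of_real (u\<^sup>2 + \<bar>\<theta>\<bar>\<^sup>2)))"
    using eq by (intro set_lebesgue_integral_cong) auto
  also have "\<dots> = 2 * (rpow \<bar>\<theta>\<bar> (w - 1) * of_real pi / (2 * cos (of_real pi * w / 2)))"
    using integral_rpow_div_sum_squares(2)[of w "\<bar>\<theta>\<bar>"] w \<theta> by (simp only: set_integral_mult_right)
  finally show ?thesis by (simp add: cos_mellin_def)
qed

text \<open>On a bounded interval the real part a < 1 gives a product majorant for Fubini. The
  frequency 0 is included, as the total mass of the solution requires.\<close>

lemma has_integral_LINT_rpow_cis:
  fixes \<phi> w :: "real \<Rightarrow> complex"
  assumes \<phi>: "integrable lborel \<phi>" and w [measurable]: "w \<in> borel_measurable borel"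
    and Re: "\<And>v. Re (w v) = a" and a: "a < 1" and T: "T \<ge> 0"
  shows "((\<lambda>x. (LINT v|lborel. \<phi> v * rpow x (- w v)) * exp (\<i> * of_real (\<theta> * x))) has_integral
           (LINT v|lborel. \<phi> v * truncated_fourier \<theta> (w v) T)) {0..T}"
proof -
  have [measurable]: "\<phi> \<in> borel_measurable borel" using \<phi>
      by (auto dest: borel_measurable_integrable)
  define f where "f = (\<lambda>x v. indicator {0<..T}
      x *\<^sub>R (\<phi> v * (rpow x (- w v) * exp (\<i> * of_real (\<theta> * x)))))"
  define A where "A = (\<lambda>x. indicator {0<..T} x *\<^sub>R x powr (- a))"
  have fm: "case_prod f \<in> borel_measurable (lborel \<Otimes>\<^sub>M lborel)"
    unfolding f_def by measurable
  have A: "integrable lborel A"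
    using integral_powr_Ioc(1)[OF a T] by (simp add: A_def set_integrable_def)
  have fb: "norm (f x v) \<le> A x * norm (\<phi> v)" for x v
    by (auto simp: f_def A_def indicator_def norm_mult norm_rpow Re)
  note Fub = lborel_Fubini_dominated[OF fm fb A integrable_norm[OF \<phi>]]
  have row: "(LINT v|lborel. f x v) = indicator {0<..T} x *\<^sub>R ((LINT v|lborel. \<phi> v * rpow x (- w v))
      * exp (\<i> * of_real (\<theta> * x)))" for x
  proof -
    have "f x v = (indicator {0<..T} x *\<^sub>R exp (\<i> * of_real (\<theta> * x))) * (\<phi> v * rpow x (- w v))" for v
      by (simp add: f_def mult_ac)
    hence "(LINT v|lborel. f x v) = (indicator {0<..T} x *\<^sub>R exp (\<i> * of_real (\<theta> * x)))
        * (LINT v|lborel. \<phi> v * rpow x (- w v))"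
      by (simp only: integral_mult_right_zero)
    thus ?thesis by (simp add: mult_ac)
  qed
  have col: "(LINT x|lborel. f x v) = \<phi> v * truncated_fourier \<theta> (w v) T" for v
  proof -
    have "f x v = \<phi> v * (indicator {0<..T} x *\<^sub>R (rpow x (- w v) * exp (\<i> * of_real (\<theta> * x))))" for x
      by (simp add: f_def)
    thus ?thesis unfolding truncated_fourier_def set_lebesgue_integral_def
        by (simp only: integral_mult_right_zero)
  qed
  have "set_integrable lborel {0<..T} (\<lambda>x. (LINT v|lborel. \<phi> v * rpow x (- w v))
      * exp (\<i> * of_real (\<theta> * x)))"
    using Fub(1) unfolding row set_integrable_def .
  moreover have "{0<..T} \<subseteq> {0..T}" "{0..T} - {0<..T} \<subseteq> {0}" by auto
  ultimately have "((\<lambda>x. (LINT v|lborel. \<phi> v * rpow x (- w v)) * exp (\<i> * of_real (\<theta> * x)))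
      has_integral (LINT x|lborel. LINT v|lborel. f x v)) {0..T}"
    unfolding row using set_integrable_imp_has_integral by (simp only: set_lebesgue_integral_def)
        blast
  thus ?thesis unfolding Fub(2)[symmetric] col .
qed

text \<open>Here the conditionally convergent limit moves inside the Mellin-Barnes integral: the
  bound uniform in T from \<open>truncated_fourier_bound\<close>, weighted with \<phi>, is the
  majorant.\<close>

lemma LINT_truncated_fourier_tendsto:
  fixes \<phi> w :: "real \<Rightarrow> complex"
  assumes \<phi> [measurable]: "\<phi> \<in> borel_measurable borel" and w [measurable]:
      "w \<in> borel_measurable borel"
    and int: "integrable lborel (\<lambda>v. (1 + norm (w v)) * norm (\<phi> v))"
    and Re: "\<And>v. Re (w v) = a" and a: "0 < a" "a < 1" and \<theta>: "\<theta> \<noteq> 0"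
  shows "((\<lambda>T. LINT v|lborel. \<phi> v * truncated_fourier \<theta> (w v) T)
      \<longlongrightarrow> (LINT v|lborel. \<phi> v * half_fourier \<theta> (w v))) at_top"
    and "integrable lborel (\<lambda>v. \<phi> v * half_fourier \<theta> (w v))"
proof -
  obtain C where C: "C \<ge> 0" "\<And>w R. Re w = a \<Longrightarrow> R \<ge> 0 \<Longrightarrow> norm (truncated_fourier \<theta> w R)
      \<le> C * (1 + norm w)"
    using truncated_fourier_bound[OF a \<theta>] by blast
  have tm [measurable]: "(\<lambda>v. truncated_fourier \<theta> (w v) T) \<in> borel_measurable borel" for T
    unfolding truncated_fourier_def set_lebesgue_integral_def by measurable
  have hm [measurable]: "(\<lambda>v. half_fourier \<theta> (w v)) \<in> borel_measurable borel"
    unfolding half_fourier_def set_lebesgue_integral_def by measurable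
  have lim: "(truncated_fourier \<theta> (w v) \<longlongrightarrow> half_fourier \<theta> (w v)) at_top" for v
    by (rule truncated_fourier_tendsto) (use Re a \<theta> in auto)
  have tb: "norm (\<phi> v * truncated_fourier \<theta> (w v) T) \<le> C * ((1 + norm (w v)) * norm (\<phi> v))"
      if "T \<ge> 0" for v T
  proof -
    have "norm (\<phi> v) * norm (truncated_fourier \<theta> (w v) T) \<le> norm (\<phi> v) * (C * (1 + norm (w v)))"
      using C(2)[OF Re that] by (intro mult_left_mono) auto
    thus ?thesis by (simp add: norm_mult mult_ac)
  qed
  have bint: "integrable lborel (\<lambda>v. C * ((1 + norm (w v)) * norm (\<phi> v)))"
    using int by (intro integrable_mult_right)
  show "((\<lambda>T. LINT v|lborel. \<phi> v * truncated_fourier \<theta> (w v) T)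
      \<longlongrightarrow> (LINT v|lborel. \<phi> v * half_fourier \<theta> (w v))) at_top"
  proof (rule integral_dominated_convergence_at_top[OF _ _ bint])
    show "AE v in lborel. ((\<lambda>T. \<phi> v * truncated_fourier \<theta> (w v) T) \<longlongrightarrow> \<phi> v * half_fourier \<theta> (w v))
        at_top"
      by (intro AE_I2 tendsto_intros lim)
    show "\<forall>\<^sub>F T in at_top. AE v in lborel. norm (\<phi> v * truncated_fourier \<theta> (w v) T)
        \<le> C * ((1 + norm (w v)) * norm (\<phi> v))"
      using eventually_ge_at_top[of 0] by eventually_elim (intro AE_I2 tb)
  qed simp_all
  have hb: "norm (half_fourier \<theta> (w v)) \<le> C * (1 + norm (w v))" for v
    by (rule Lim_norm_ubound[OF _ lim])
       (auto intro!: eventually_mono[OF eventually_ge_at_top[of 0]] C(2) Re)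
  have "norm (\<phi> v * half_fourier \<theta> (w v)) \<le> C * ((1 + norm (w v)) * norm (\<phi> v))" for v
    using mult_left_mono[OF hb[of v] norm_ge_zero[of "\<phi> v"]] by (simp add: norm_mult mult_ac)
  hence "norm (\<phi> v * half_fourier \<theta> (w v)) \<le> norm (C * ((1 + norm (w v)) * norm (\<phi> v)))" for v
    by (rule order_trans) simp
  thus "integrable lborel (\<lambda>v. \<phi> v * half_fourier \<theta> (w v))"
    by (intro Bochner_Integration.integrable_bound[OF bint]) auto
qed

text \<open>Used twice: with exponents \<alpha> s to invert the Mittag-Leffler function, and with
  exponents 1 - \<alpha> s to transform the solution back.\<close>

lemma fourier_LINT_rpow:
  fixes \<phi> w :: "real \<Rightarrow> complex"
  assumes \<phi> [measurable]: "\<phi> \<in> borel_measurable borel" and w [measurable]: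
      "w \<in> borel_measurable borel"
    and int: "integrable lborel (\<lambda>v. (1 + norm (w v)) * norm (\<phi> v))"
    and Re: "\<And>v. Re (w v) = a" and a: "0 < a" "a < 1" and \<theta>: "\<theta> \<noteq> 0"
  shows "((\<lambda>x. (LINT v|lborel. \<phi> v * rpow \<bar>x\<bar> (- w v)) * exp (\<i> * of_real (\<theta> * x))) has_integral
           2 * (LINT v|lborel. \<phi> v * (rpow \<bar>\<theta>\<bar> (w v - 1) * cos_mellin (w v)))) UNIV"
proof -
  define F where "F = (\<lambda>x. LINT v|lborel. \<phi> v * rpow x (- w v))"
  have \<phi>i: "integrable lborel \<phi>"
  proof (rule Bochner_Integration.integrable_bound[OF int])
    have "norm (\<phi> v) \<le> norm ((1 + norm (w v)) * norm (\<phi> v))" for v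
      by (simp add: abs_mult mult_le_cancel_right1)
    thus "AE v in lborel. norm (\<phi> v) \<le> norm ((1 + norm (w v)) * norm (\<phi> v))" by simp
  qed simp
  have part: "(\<lambda>x. F \<bar>x\<bar> * exp (\<i> * of_real (\<theta>' * x))) integrable_on {0..T}"
    "integral {0..T} (\<lambda>x. F \<bar>x\<bar> * exp (\<i> * of_real (\<theta>' * x)))
        = (LINT v|lborel. \<phi> v * truncated_fourier \<theta>' (w v) T)"
    if "T \<ge> 0" for T \<theta>'
  proof -
    have "((\<lambda>x. F x * exp (\<i> * of_real (\<theta>' * x)))
        has_integral (LINT v|lborel. \<phi> v * truncated_fourier \<theta>' (w v) T)) {0..T}"
      unfolding F_def by (rule has_integral_LINT_rpow_cis[OF \<phi>i w Re a(2) that])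
    hence "((\<lambda>x. F \<bar>x\<bar> * exp (\<i> * of_real (\<theta>' * x)))
        has_integral (LINT v|lborel. \<phi> v * truncated_fourier \<theta>' (w v) T)) {0..T}"
      by (rule has_integral_eq[rotated]) auto
    thus "(\<lambda>x. F \<bar>x\<bar> * exp (\<i> * of_real (\<theta>' * x))) integrable_on {0..T}"
      "integral {0..T} (\<lambda>x. F \<bar>x\<bar> * exp (\<i> * of_real (\<theta>' * x)))
          = (LINT v|lborel. \<phi> v * truncated_fourier \<theta>' (w v) T)"
      by (auto simp: has_integral_iff)
  qed
  have lim: "((\<lambda>T. integral {0..T} (\<lambda>x. F \<bar>x\<bar> * exp (\<i> * of_real (\<theta>' * x))))
      \<longlongrightarrow> (LINT v|lborel. \<phi> v * half_fourier \<theta>' (w v))) at_top"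
    if "\<theta>' \<noteq> 0" for \<theta>'
    by (rule Lim_transform_eventually[OF LINT_truncated_fourier_tendsto(1)[OF \<phi> w int Re a that]])
       (rule eventually_mono[OF eventually_ge_at_top[of 0]], rule part(2)[symmetric])
  have "((\<lambda>x. F \<bar>x\<bar> * exp (\<i> * of_real (\<theta> * x))) has_integral
      (LINT v|lborel. \<phi> v * half_fourier \<theta> (w v)) + (LINT v|lborel. \<phi> v * half_fourier (- \<theta>) (w v)))
          UNIV"
    by (rule has_integral_UNIV_improper) (use part lim[OF \<theta>] part[where \<theta>' = "- \<theta>"] lim[of "- \<theta>"] \<theta>
        in auto)
  also have "(LINT v|lborel. \<phi> v * half_fourier \<theta> (w v))
      + (LINT v|lborel. \<phi> v * half_fourier (- \<theta>) (w v))
      = (LINT v|lborel. \<phi> v * half_fourier \<theta> (w v) + \<phi> v * half_fourier (- \<theta>) (w v))"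
    by (rule Bochner_Integration.integral_add[symmetric])
       (use LINT_truncated_fourier_tendsto(2)[OF \<phi> w int Re a] \<theta> in auto)
  also have "\<dots> = 2 * (LINT v|lborel. \<phi> v * (rpow \<bar>\<theta>\<bar> (w v - 1) * cos_mellin (w v)))"
  proof -
    have "\<phi> v * half_fourier \<theta> (w v) + \<phi> v * half_fourier (- \<theta>) (w v)
        = 2 * (\<phi> v * (rpow \<bar>\<theta>\<bar> (w v - 1) * cos_mellin (w v)))" for v
      using half_fourier_sum[of "w v" \<theta>] Re[of v] a \<theta> by (simp add: mult_ac flip: distrib_left)
    thus ?thesis by (simp only: integral_mult_right_zero)
  qed
  finally show ?thesis by (simp add: F_def)
qed

text \<open>The exchange of w and 1 - w turns the cosine into the sine, and the double angle formula
  matches the reflection formula. This identity is Fourier inversion on the level of powers.\<close>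

lemma cos_mellin_reflection:
  assumes "0 < Re w" "Re w < 1"
  shows "cos_mellin w * cos_mellin (1 - w) = of_real pi / 2"
proof -
  define z where "z = of_real pi * w / 2"
  have "Re z > 0" "Re z < pi / 2" using assms by (auto simp: z_def)
  hence nz: "cos z \<noteq> 0" "sin z \<noteq> 0"
    using norm_cos_ge[of z] norm_sin_ge[of z] cos_gt_zero[of "Re z"] sin_gt_zero2[of "Re z"]
    by (auto simp: zero_less_mult_iff mult_le_0_iff)
  have 1: "of_real pi * (1 - w) / 2 = of_real pi / 2 - z" by (simp add: z_def field_simps)
  have c: "cos (of_real pi * (1 - w) / 2) = sin z"
    unfolding 1 cos_diff by simp
  have r: "rGamma w * rGamma (1 - w) = 2 * sin z * cos z / of_real pi"
    using rGamma_reflection_complex[of w] sin_double[of z] by (simp add: z_def)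
  have "cos_mellin w * cos_mellin (1 - w) = of_real pi * of_real pi * (rGamma w * rGamma (1 - w))
      / (4 * cos z * sin z)"
    unfolding cos_mellin_def c z_def[symmetric] by (simp add: mult_ac)
  also have "\<dots> = of_real pi / 2"
    unfolding r using nz by (simp add: field_simps)
  finally show ?thesis .
qed

subsection \<open>The fundamental solution as a Mellin-Barnes integral\<close>

text \<open>
  Away from \<open>s = 0\<close> this is
  \<open>Gamma s * Gamma (1 - s) / Gamma (1 - \<beta> s) * cos_mellin (\<alpha> s) / pi * c\<^sup>-\<^sup>s\<close>; the zero of \<open>cos_mellin\<close>
  cancels the pole of \<open>Gamma s\<close>.
\<close>

definition mb_density :: "real \<Rightarrow> real \<Rightarrow> real \<Rightarrow> complex \<Rightarrow> complex" where
  "mb_density \<alpha> \<beta> c s = gamma_pair s * rGamma (1 - of_real \<beta> * s) * rpow c (- s) *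
     (of_real \<alpha> * rGamma (1 + of_real \<alpha> * s) / (2 * cos (of_real pi * (of_real \<alpha> * s) / 2)))"

lemma mb_density_0: "mb_density \<alpha> \<beta> c 0 = of_real \<alpha> / 2"
  by (simp add: mb_density_def)

lemma mb_density_eq:
  assumes "s \<noteq> 0"
  shows "mb_density \<alpha> \<beta> c s = gamma_pair s / s * rGamma (1 - of_real \<beta> * s) * rpow c (- s)
      * (cos_mellin (of_real \<alpha> * s) / of_real pi)"
proof -
  have "rGamma (of_real \<alpha> * s) = of_real \<alpha> * s * rGamma (1 + of_real \<alpha> * s)"
    using rGamma_plus1[of "of_real \<alpha> * s"] by (simp add: add.commute)
  thus ?thesis using assms by (simp add: mb_density_def cos_mellin_def mult_ac)
qed

text \<open>Half of the exponential rate pays for the linear growth of the exponent.\<close>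

lemma integrable_weighted_exp_bound:
  fixes \<phi> w :: "real \<Rightarrow> complex"
  assumes [measurable]: "\<phi> \<in> borel_measurable borel" "w \<in> borel_measurable borel"
    and \<phi>: "\<And>v. norm (\<phi> v) \<le> C * exp (- 1 * \<bar>v\<bar>)" and w: "\<And>v. norm (w v) \<le> A + B * \<bar>v\<bar>"
    and AB: "A \<ge> 0" "B \<ge> 0"
  shows "integrable lborel (\<lambda>v. (1 + norm (w v)) * norm (\<phi> v))"
proof (rule integrable_exp_bound)
  show "norm ((1 + norm (w v)) * norm (\<phi> v)) \<le> ((1 + A + 2 * B) * C) * exp (- (1/2) * \<bar>v\<bar>)" for v
  proof -
    define e where "e = exp (1/2 * \<bar>v\<bar>)"
    have e: "e \<ge> 1" by (simp add: e_def)
    have "\<bar>v\<bar> \<le> 2 * e" using le_exp_div[of "1/2" "\<bar>v\<bar>"] by (simp add: e_def)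
    hence "B * \<bar>v\<bar> \<le> B * (2 * e)" using AB by (intro mult_left_mono) auto
    moreover have "1 + A \<le> (1 + A) * e" using e AB mult_left_mono[of 1 e "1 + A"] by simp
    ultimately have "1 + norm (w v) \<le> (1 + A + 2 * B) * e" using w[of v]
        by (simp add: ring_distribs)
    hence "(1 + norm (w v)) * norm (\<phi> v) \<le> ((1 + A + 2 * B) * e) * (C * exp (- 1 * \<bar>v\<bar>))"
      using \<phi>[of v] AB e by (intro mult_mono) auto
    also have "\<dots> = ((1 + A + 2 * B) * C) * (e * exp (- 1 * \<bar>v\<bar>))" by (simp add: mult_ac)
    also have "e * exp (- 1 * \<bar>v\<bar>) = exp (- (1/2) * \<bar>v\<bar>)" by (simp add: e_def flip: exp_add)
    finally show ?thesis by (simp add: abs_mult)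
  qed
qed auto

lemma truncated_fourier_0:
  assumes w: "Re w < 1" and T: "T > 0"
  shows "truncated_fourier 0 w T = rpow T (1 - w) / (1 - w)"
proof -
  have nz: "1 - w \<noteq> 0" using w by (auto simp: complex_eq_iff)
  \<comment> \<open>The value at 0 is set by hand, since \<open>rpow 0\<close> is constantly 1 and
    would make the primitive discontinuous there.\<close>
  define G where "G = (\<lambda>x. if x = 0 then 0 else rpow x (1 - w) / (1 - w))"
  have G: "(G has_vector_derivative rpow x (- w)) (at x)" if "x > 0" for x
  proof -
    have "((\<lambda>x. rpow x (1 - w) / (1 - w)) has_vector_derivative ((1 - w) * rpow x (1 - w - 1))
        / (1 - w)) (at x)"
      by (intro has_vector_derivative_divide rpow_has_vector_derivative that)
    hence "((\<lambda>x. rpow x (1 - w) / (1 - w)) has_vector_derivative rpow x (- w)) (at x)"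
      using nz by simp
    thus ?thesis
      by (rule has_vector_derivative_transform_within_open[of _ _ _ "{0<..}"])
          (use that in \<open>auto simp: G_def\<close>)
  qed
  have "continuous_on {0..T} G"
    unfolding continuous_on_eq_continuous_within
  proof
    fix x assume x: "x \<in> {0..T}"
    show "continuous (at x within {0..T}) G"
    proof (cases "x = 0")
      case True
      have "((\<lambda>x. x powr (1 - Re w) / norm (1 - w)) \<longlongrightarrow> 0 powr (1 - Re w) / norm (1 - w))
          (at_right 0)"
        using w nz by (intro tendsto_intros)
            (auto intro!: eventually_mono[OF eventually_at_right_less])
      hence "((\<lambda>x. x powr (1 - Re w) / norm (1 - w)) \<longlongrightarrow> 0) (at_right 0)"
        using w by simp
      moreover have "\<forall>\<^sub>F x in at_right 0. norm (G x) \<le> x powr (1 - Re w) / norm (1 - w)"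
        by (rule eventually_mono[OF eventually_at_right_less])
            (simp add: G_def norm_divide norm_rpow)
      ultimately have "(G \<longlongrightarrow> 0) (at_right 0)"
        by (rule Lim_null_comparison[rotated])
      thus ?thesis using True T by (simp add: continuous_within G_def at_within_Icc_at_right)
    next
      case False
      hence "continuous (at x) G"
        using G[of x] x has_vector_derivative_continuous by auto
      thus ?thesis by (rule continuous_at_imp_continuous_at_within)
    qed
  qed
  hence "((\<lambda>x. rpow x (- w)) has_integral G T - G 0) {0..T}"
    using T G by (intro fundamental_theorem_of_calculus_interior) auto
  moreover have s: "set_integrable lborel {0<..T} (\<lambda>x. rpow x (- w) * exp (\<i> * of_real (0 * x)))"
    by (rule set_integrable_rpow_cis) (use w T in auto)
  have "((\<lambda>x. rpow x (- w) * exp (\<i> * of_real (0 * x))) has_integral truncated_fourier 0 w T)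
      {0..T}"
    unfolding truncated_fourier_def by (rule set_integrable_imp_has_integral[OF s, of _ 0]) auto
  ultimately show ?thesis
    using T by (auto simp: G_def dest: has_integral_unique)
qed

context
  fixes \<alpha> \<beta> :: real
  assumes \<alpha>: "\<alpha> > 0" and \<beta>: "0 < \<beta>" "\<beta> \<le> 1"
begin

section \<open>The common strip and bounds for the density\<close>

text \<open>Below this width Re s < 1, as the Mellin-Barnes line requires, and \<alpha> Re s < 1, as
  the convergence of the Fourier integrals requires.\<close>

definition strip_width :: real where
  "strip_width = min 1 (1 / \<alpha>)"

lemma strip_width_pos: "strip_width > 0" and strip_width_le: "strip_width \<le> 1" "\<alpha> * strip_width \<le> 1"
  using \<alpha> by (auto simp: strip_width_def min_def field_simps)

lemma abs_less_strip_width: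
  assumes "\<bar>\<sigma>\<bar> < strip_width"
  shows "\<bar>\<sigma>\<bar> < 1" "\<bar>\<alpha> * \<sigma>\<bar> < 1"
proof -
  show "\<bar>\<sigma>\<bar> < 1" using assms strip_width_le by simp
  have "\<alpha> * \<bar>\<sigma>\<bar> < \<alpha> * strip_width" using assms \<alpha> by simp
  hence "\<alpha> * \<bar>\<sigma>\<bar> < 1" using strip_width_le(2) by linarith
  thus "\<bar>\<alpha> * \<sigma>\<bar> < 1" using \<alpha> by (simp add: abs_mult)
qed

text \<open>For |\<alpha> Re s| < 1 the cosine in the denominator has no zero. The strip extends to
  both sides of 0 because the evaluation at k = 0 crosses the imaginary axis.\<close>

lemma holomorphic_mb_density:
  "mb_density \<alpha> \<beta> c holomorphic_on {s. - strip_width < Re s \<and> Re s < strip_width}"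
proof -
  have "cos (of_real pi * (of_real \<alpha> * s) / 2) \<noteq> 0" if "- strip_width < Re s" "Re s < strip_width"
      for s
  proof -
    have "\<bar>\<alpha> * Re s\<bar> < 1" using abs_less_strip_width(2)[of "Re s"] that by (simp add: abs_less_iff)
    hence "\<bar>pi * (\<alpha> * Re s) / 2\<bar> < pi / 2" by (simp add: abs_mult)
    hence "- (pi / 2) < pi * (\<alpha> * Re s) / 2" "pi * (\<alpha> * Re s) / 2 < pi / 2"
      unfolding abs_less_iff by linarith+
    hence "cos (pi * (\<alpha> * Re s) / 2) > 0" by (rule cos_gt_zero_pi)
    thus ?thesis using norm_cos_ge[of "of_real pi * (of_real \<alpha> * s) / 2"]
      by (auto simp: mult_le_0_iff)
  qed
  moreover have "{s. - strip_width < Re s \<and> Re s < strip_width} \<subseteq> {s. - 1 < Re s \<and> Re s < 1}"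
    using strip_width_le(1) by auto
  ultimately show ?thesis
    unfolding mb_density_def rpow_def
    by (intro holomorphic_intros holomorphic_on_subset[OF holomorphic_gamma_pair]) auto
qed

text \<open>The growth exp (pi \<alpha> |Im s| / 2) of
  \<open>rGamma (1 + of_real \<alpha> * s)\<close> is matched exactly by the cosine below it, so the
  rate 1 survives for every \<alpha>. The condition on \<open>\<alpha> * a\<close> keeps 1 +
  \<alpha> Re s \<ge> 1/2, where the estimate for the reciprocal Gamma function has no polynomial
  factor.\<close>

lemma mb_density_bound:
  assumes a: "- (1/2) \<le> a" "- (1/2) \<le> \<alpha> * a" and b: "b < strip_width"
  shows "\<exists>C\<ge>0. \<forall>s. a \<le> Re s \<longrightarrow> Re s \<le> b \<longrightarrow> norm (mb_density \<alpha> \<beta> c s) \<le> C * exp (- 1 * \<bar>Im s\<bar>)"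
proof -
  have b': "b < 1" "\<alpha> * b < 1"
    using b strip_width_le mult_strict_left_mono[OF b \<alpha>] by auto
  obtain C1 where C1: "C1 \<ge> 0" "\<And>s. a \<le> Re s \<Longrightarrow> Re s \<le> b
      \<Longrightarrow> norm (gamma_pair s * rGamma (1 - of_real \<beta> * s)) \<le> C1 * exp (- 1 * \<bar>Im s\<bar>)"
    using gamma_pair_rGamma_bound[OF \<beta> a(1) b'(1)] by blast
  obtain C2 where C2: "C2 \<ge> 0" "\<And>z. 1/2 \<le> Re z \<Longrightarrow> Re z \<le> 2 \<Longrightarrow> norm (rGamma z)
      \<le> C2 * exp (pi / 2 * \<bar>Im z\<bar>)"
    using norm_rGamma_le_exp_right[of 2] by blast
  \<comment> \<open>A bound below 1 for |\<alpha> Re s| on the whole strip; it keeps the cosine of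
    the real part away from 0.\<close>
  define m where "m = max (1/2) (\<alpha> * b)"
  have m: "0 < m" "m < 1" using b' by (auto simp: m_def)
  have cm: "cos (pi * m / 2) > 0" using m by (intro cos_gt_zero_pi) (auto intro: less_trans[of _ 0])
  define C where "C = C1 * exp \<bar>ln c\<bar> * (\<alpha> * C2 / cos (pi * m / 2))"
  have "norm (mb_density \<alpha> \<beta> c s) \<le> C * exp (- 1 * \<bar>Im s\<bar>)" if s: "a \<le> Re s" "Re s \<le> b" for s
  proof -
    have r1: "\<alpha> * a \<le> \<alpha> * Re s" "\<alpha> * Re s \<le> \<alpha> * b" using s \<alpha> by auto
    have r2: "\<bar>\<alpha> * Re s\<bar> \<le> m" using r1 a(2) by (auto simp: m_def abs_le_iff max_def)
    have "\<bar>Re s\<bar> \<le> 1" using s a b' by auto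
    hence "\<bar>- Re s * ln c\<bar> \<le> 1 * \<bar>ln c\<bar>" unfolding abs_mult by (intro mult_right_mono) auto
    hence "- Re s * ln c \<le> \<bar>ln c\<bar>" by simp
    hence n2: "norm (rpow c (- s)) \<le> exp \<bar>ln c\<bar>" by (simp add: rpow_def)
    define E where "E = exp (pi / 2 * (\<alpha> * \<bar>Im s\<bar>))"
    have n3: "norm (rGamma (1 + of_real \<alpha> * s)) \<le> C2 * E"
    proof -
      have "1/2 \<le> Re (1 + of_real \<alpha> * s)" "Re (1 + of_real \<alpha> * s) \<le> 2"
        using r1 b' a(2) by auto
      from C2(2)[OF this] show ?thesis using \<alpha> by (simp add: E_def abs_mult)
    qed
    have "cos (pi * m / 2) \<le> cos \<bar>pi * (\<alpha> * Re s) / 2\<bar>"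
      using r2 m by (intro cos_monotone_0_pi_le) (auto simp: abs_mult)
    hence "cos (pi * m / 2) * E / 2 \<le> cos (pi * (\<alpha> * Re s) / 2) * E / 2"
      unfolding cos_abs_real by (intro divide_right_mono mult_right_mono) (auto simp: E_def)
    also have "\<dots> \<le> norm (cos (of_real pi * (of_real \<alpha> * s) / 2))"
      using norm_cos_ge[of "of_real pi * (of_real \<alpha> * s) / 2"] \<alpha>
          by (simp add: E_def abs_mult mult_ac)
    finally have n4: "cos (pi * m / 2) * E \<le> norm (2 * cos (of_real pi * (of_real \<alpha> * s) / 2))"
        by (simp add: norm_mult)
    have E: "E > 0" by (simp add: E_def)
    have "norm (of_real \<alpha> * rGamma (1 + of_real \<alpha> * s)
        / (2 * cos (of_real pi * (of_real \<alpha> * s) / 2)))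
       = \<alpha> * norm (rGamma (1 + of_real \<alpha> * s)) / norm (2 * cos (of_real pi * (of_real \<alpha> * s) / 2))"
      using \<alpha> by (simp add: norm_divide norm_mult)
    also have "\<dots> \<le> \<alpha> * (C2 * E) / (cos (pi * m / 2) * E)"
      using n3 n4 \<alpha> C2(1) cm E by (intro frac_le mult_left_mono mult_nonneg_nonneg mult_pos_pos)
          auto
    also have "\<dots> = \<alpha> * C2 / cos (pi * m / 2)" using E by simp
    finally have n5: "norm (of_real \<alpha> * rGamma (1 + of_real \<alpha> * s)
        / (2 * cos (of_real pi * (of_real \<alpha> * s) / 2))) \<le> \<alpha> * C2 / cos (pi * m / 2)" .
    have "norm (mb_density \<alpha> \<beta> c s) \<le> (C1 * exp (- 1 * \<bar>Im s\<bar>)) * exp \<bar>ln c\<bar>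
        * (\<alpha> * C2 / cos (pi * m / 2))"
      unfolding mb_density_def norm_mult[of "_ * rpow _ _"] norm_mult[of _ "rpow _ _"]
      using C1(2)[OF s] n2 n5 C1(1) C2(1) \<alpha> cm by (intro mult_mono mult_nonneg_nonneg) auto
    thus ?thesis by (simp add: C_def mult_ac)
  qed
  moreover have "C \<ge> 0" using C1 C2 \<alpha> cm by (simp add: C_def)
  ultimately show ?thesis by blast
qed

definition mb_solution_line :: "real \<Rightarrow> real \<Rightarrow> real \<Rightarrow> complex" where
  "mb_solution_line \<sigma> c x = (LINT v|lborel. mb_density \<alpha> \<beta> c (Complex \<sigma> v) / (2 * of_real pi) * rpow
      x (- (1 - of_real \<alpha> * Complex \<sigma> v)))"

lemma mb_density_line:
  assumes "0 < \<sigma>" "\<sigma> < strip_width"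
  shows "(\<lambda>v. mb_density \<alpha> \<beta> c (Complex \<sigma> v)) \<in> borel_measurable borel"
    and "\<exists>C\<ge>0. \<forall>v. norm (mb_density \<alpha> \<beta> c (Complex \<sigma> v)) \<le> C * exp (- 1 * \<bar>v\<bar>)"
proof -
  have "continuous_on UNIV (\<lambda>v. mb_density \<alpha> \<beta> c (Complex \<sigma> v))"
    using assms strip_width_pos
    by (intro continuous_on_compose2[OF holomorphic_on_imp_continuous_on[OF holomorphic_mb_density]]
        continuous_intros) auto
  thus "(\<lambda>v. mb_density \<alpha> \<beta> c (Complex \<sigma> v)) \<in> borel_measurable borel"
    by (rule borel_measurable_continuous_onI)
  show "\<exists>C\<ge>0. \<forall>v. norm (mb_density \<alpha> \<beta> c (Complex \<sigma> v)) \<le> C * exp (- 1 * \<bar>v\<bar>)"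
  proof -
    have "0 < \<alpha> * \<sigma>" using assms \<alpha> by simp
    hence "- (1/2) \<le> \<sigma>" "- (1/2) \<le> \<alpha> * \<sigma>" using assms by linarith+
    from mb_density_bound[OF this assms(2), of c] obtain C where C: "C \<ge> 0"
      "\<And>s. \<sigma> \<le> Re s \<Longrightarrow> Re s \<le> \<sigma> \<Longrightarrow> norm (mb_density \<alpha> \<beta> c s) \<le> C * exp (- 1 * \<bar>Im s\<bar>)"
      by blast
    have "norm (mb_density \<alpha> \<beta> c (Complex \<sigma> v)) \<le> C * exp (- 1 * \<bar>v\<bar>)" for v
      using C(2)[of "Complex \<sigma> v"] by simp
    with C(1) show ?thesis by blast
  qed
qed

text \<open>The H-function may be computed along any separating line; its value is unique only
  because these lines all give the same integral.\<close>

lemma mb_solution_line_shift: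
  assumes \<sigma>: "0 < \<sigma>" "\<sigma> \<le> \<sigma>'" "\<sigma>' < strip_width"
  shows "mb_solution_line \<sigma>' c x = mb_solution_line \<sigma> c x"
proof (cases "\<sigma> = \<sigma>'")
  case False
  obtain C where C: "C \<ge> 0" "\<And>s. \<sigma> \<le> Re s \<Longrightarrow> Re s \<le> \<sigma>' \<Longrightarrow> norm (mb_density \<alpha> \<beta> c s)
      \<le> C * exp (- 1 * \<bar>Im s\<bar>)"
  proof -
    have "0 < \<alpha> * \<sigma>" using \<sigma> \<alpha> by simp
    hence "- (1/2) \<le> \<sigma>" "- (1/2) \<le> \<alpha> * \<sigma>" using \<sigma> by linarith+
    from mb_density_bound[OF this \<sigma>(3), of c] that show ?thesis by blast
  qed
  show ?thesis
    unfolding mb_solution_line_def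
  proof (rule strip_line_shift[where l = "- strip_width" and r = strip_width and d = 1 and C
      = "C / (2 * pi) * exp \<bar>ln x\<bar>"])
    show "(\<lambda>s. mb_density \<alpha> \<beta> c s / (2 * of_real pi) * rpow x (- (1 - of_real \<alpha> * s)))
        holomorphic_on {s. - strip_width < Re s \<and> Re s < strip_width}"
      unfolding rpow_def by (intro holomorphic_intros holomorphic_mb_density) auto
    fix s assume s: "\<sigma> \<le> Re s" "Re s \<le> \<sigma>'"
    have "\<bar>\<alpha> * Re s\<bar> < 1" "0 < \<alpha> * Re s" using abs_less_strip_width[of "Re s"] s \<sigma> \<alpha> by auto
    hence "\<bar>\<alpha> * Re s - 1\<bar> \<le> 1" by auto
    hence "\<bar>(\<alpha> * Re s - 1) * ln x\<bar> \<le> 1 * \<bar>ln x\<bar>" unfolding abs_mult by (intro mult_right_mono) auto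
    hence "(\<alpha> * Re s - 1) * ln x \<le> \<bar>ln x\<bar>" by simp
    hence "norm (rpow x (- (1 - of_real \<alpha> * s))) \<le> exp \<bar>ln x\<bar>" by (simp add: rpow_def)
    moreover have "norm (mb_density \<alpha> \<beta> c s / (2 * of_real pi)) \<le> C * exp (- 1 * \<bar>Im s\<bar>) / (2 * pi)"
      using C(2)[OF s] by (simp add: norm_divide norm_mult divide_right_mono)
    ultimately have "norm (mb_density \<alpha> \<beta> c s / (2 * of_real pi) * rpow x (- (1 - of_real \<alpha> * s)))
        \<le> C * exp (- 1 * \<bar>Im s\<bar>) / (2 * pi) * exp \<bar>ln x\<bar>"
      unfolding norm_mult using C(1) by (intro mult_mono) auto
    thus "norm (mb_density \<alpha> \<beta> c s / (2 * of_real pi) * rpow x (- (1 - of_real \<alpha> * s)))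
        \<le> C / (2 * pi) * exp \<bar>ln x\<bar> * exp (- 1 * \<bar>Im s\<bar>)"
      by (simp add: mult_ac)
  qed (use \<sigma> False in auto)
qed simp

text \<open>With the middle of the strip the mirror line at - \<sigma> still satisfies the lower
  bounds required by \<open>mb_density_bound\<close>, as used at k = 0.\<close>

definition mb_solution :: "real \<Rightarrow> real \<Rightarrow> complex" where
  "mb_solution = mb_solution_line (strip_width / 2)"

lemma mb_solution_eq:
  assumes "0 < \<sigma>" "\<sigma> < strip_width"
  shows "mb_solution c x = mb_solution_line \<sigma> c x"
proof -
  have h: "0 < strip_width / 2" "strip_width / 2 < strip_width" using strip_width_pos by auto
  show ?thesis
    unfolding mb_solution_def
    using mb_solution_line_shift[of \<sigma> "strip_width / 2" c x]
        mb_solution_line_shift[of "strip_width / 2" \<sigma> c x] assms h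
    by (cases "\<sigma> \<le> strip_width / 2") auto
qed

lemma mittag_leffler_line:
  assumes c: "c > 0" and k: "k \<noteq> 0" and \<sigma>: "0 < \<sigma>" "\<sigma> < 1"
  defines "K \<equiv> (\<lambda>v. gamma_pair (Complex \<sigma> v) / Complex \<sigma> v * rGamma (1 - of_real \<beta> * Complex \<sigma> v))"
  shows "(LINT v|lborel. K v * rpow c (- Complex \<sigma> v) / (2 * of_real pi) * rpow \<bar>k\<bar>
      (- (of_real \<alpha> * Complex \<sigma> v)))
     = of_real (mittag_leffler \<beta> (- c * \<bar>k\<bar> powr \<alpha>))"
proof -
  have "c * \<bar>k\<bar> powr \<alpha> > 0" using c k by simp
  \<comment> \<open>Time is normalised to 1, and the rate is c |k|^\<alpha>; the actual time
    dependence sits in c.\<close>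
  note MB = mittag_leffler_Mellin_Barnes(2)[OF \<beta> this zero_less_one \<sigma>]
  have "K v * rpow c (- Complex \<sigma> v) / (2 * of_real pi) * rpow \<bar>k\<bar> (- (of_real \<alpha> * Complex \<sigma> v))
      = 1 / (2 * of_real pi) * (K v * rpow (c * \<bar>k\<bar> powr \<alpha> * 1 powr \<beta>) (- Complex \<sigma> v))" for v
    using c k by (simp add: rpow_mult rpow_powr)
  hence "(LINT v|lborel. K v * rpow c (- Complex \<sigma> v) / (2 * of_real pi) * rpow \<bar>k\<bar>
      (- (of_real \<alpha> * Complex \<sigma> v)))
      = 1 / (2 * of_real pi) * (LINT v|lborel. K v * rpow (c * \<bar>k\<bar> powr \<alpha> * 1 powr \<beta>)
          (- Complex \<sigma> v))"
    by (simp only: integral_mult_right_zero)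
  thus ?thesis using MB by (simp add: K_def)
qed

lemma norm_affine_line: "norm (z + of_real \<alpha> * Complex \<sigma> v) \<le> (norm z + \<alpha> * \<bar>\<sigma>\<bar>) + \<alpha> * \<bar>v\<bar>"
proof -
  have "norm (z + of_real \<alpha> * Complex \<sigma> v) \<le> norm z + \<alpha> * norm (Complex \<sigma> v)"
    using norm_triangle_ineq[of z "of_real \<alpha> * Complex \<sigma> v"] \<alpha> by (simp add: norm_mult)
  also have "\<dots> \<le> norm z + \<alpha> * (\<bar>\<sigma>\<bar> + \<bar>v\<bar>)"
    using cmod_le[of "Complex \<sigma> v"] \<alpha> by (intro add_left_mono mult_left_mono) auto
  finally show ?thesis by (simp add: ring_distribs)
qed

section \<open>Fourier transform of the candidate, its inverse, and the total mass\<close>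

text \<open>The density already carries \<open>cos_mellin\<close> at \<alpha> s, and the transform
  adds \<open>cos_mellin\<close> at 1 - \<alpha> s. Their product is constant, and the Mellin-Barnes
  integral of the Mittag-Leffler function reappears.\<close>

lemma fourier_mb_solution:
  assumes c: "c > 0" and k: "k \<noteq> 0"
  shows "has_fourier_transform (\<lambda>x. mb_solution c \<bar>x\<bar>)
      k (of_real (mittag_leffler \<beta> (- c * \<bar>k\<bar> powr \<alpha>)))"
proof -
  define \<sigma> where "\<sigma> = strip_width / 2"
  have \<sigma>: "0 < \<sigma>" "\<sigma> < strip_width" "\<sigma> < 1" "\<alpha> * \<sigma> < 1" "0 < \<alpha> * \<sigma>"
    using strip_width_pos strip_width_le \<alpha> by (auto simp: \<sigma>_def)
  define \<phi> where "\<phi> = (\<lambda>v. mb_density \<alpha> \<beta> c (Complex \<sigma> v) / (2 * of_real pi))"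
  define w where "w = (\<lambda>v. 1 - of_real \<alpha> * Complex \<sigma> v)"
  have w [measurable]: "w \<in> borel_measurable borel" unfolding w_def by measurable
  have \<phi> [measurable]: "\<phi> \<in> borel_measurable borel"
    unfolding \<phi>_def using mb_density_line(1)[OF \<sigma>(1,2)] by measurable
  obtain C where C: "C \<ge> 0" "\<And>v. norm (mb_density \<alpha> \<beta> c (Complex \<sigma> v)) \<le> C * exp (- 1 * \<bar>v\<bar>)"
    using mb_density_line(2)[OF \<sigma>(1,2)] by blast
  have \<phi>b: "norm (\<phi> v) \<le> C / (2 * pi) * exp (- 1 * \<bar>v\<bar>)" for v
    using C(2)[of v] by (simp add: \<phi>_def norm_divide norm_mult divide_right_mono)
  have wb: "norm (w v) \<le> (1 + \<alpha> * \<sigma>) + \<alpha> * \<bar>v\<bar>" for v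
    using norm_affine_line[of "-1" \<sigma> v] \<sigma> by (simp add: w_def norm_minus_commute)
  have int: "integrable lborel (\<lambda>v. (1 + norm (w v)) * norm (\<phi> v))"
    using \<sigma> \<alpha> by (intro integrable_weighted_exp_bound[OF \<phi> w \<phi>b wb]) auto
  have Re: "Re (w v) = 1 - \<alpha> * \<sigma>" for v by (simp add: w_def)
  have "((\<lambda>x. (LINT v|lborel. \<phi> v * rpow \<bar>x\<bar> (- w v)) * exp (\<i> * of_real (k * x))) has_integral
           2 * (LINT v|lborel. \<phi> v * (rpow \<bar>k\<bar> (w v - 1) * cos_mellin (w v)))) UNIV"
    by (rule fourier_LINT_rpow[OF \<phi> w int Re _ _ k]) (use \<sigma> in auto)
  moreover have "(LINT v|lborel. \<phi> v * rpow \<bar>x\<bar> (- w v)) = mb_solution c \<bar>x\<bar>" for x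
    by (simp add: mb_solution_def mb_solution_line_def \<phi>_def w_def \<sigma>_def)
  moreover have "2 * (LINT v|lborel. \<phi> v * (rpow \<bar>k\<bar> (w v - 1) * cos_mellin (w v)))
      = of_real (mittag_leffler \<beta> (- c * \<bar>k\<bar> powr \<alpha>))"
  proof -
    have eq: "2 * (\<phi> v * (rpow \<bar>k\<bar> (w v - 1) * cos_mellin (w v))) = gamma_pair (Complex \<sigma> v)
        / Complex \<sigma> v * rGamma (1 - of_real \<beta> * Complex \<sigma> v) *
        rpow c (- Complex \<sigma> v) / (2 * of_real pi) * rpow \<bar>k\<bar> (- (of_real \<alpha> * Complex \<sigma> v))" for v
    proof -
      define s where "s = Complex \<sigma> v"
      have nz: "s \<noteq> 0" using \<sigma> by (auto simp: s_def complex_eq_iff)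
      have cc: "cos_mellin (of_real \<alpha> * s) * cos_mellin (1 - of_real \<alpha> * s) = of_real pi / 2"
        by (rule cos_mellin_reflection) (use \<sigma> in \<open>auto simp: s_def\<close>)
      define P where "P = gamma_pair s / s * rGamma (1 - of_real \<beta> * s) * rpow c (- s)"
      have "2 * (\<phi> v * (rpow \<bar>k\<bar> (w v - 1) * cos_mellin (w v))) =
          P / (of_real pi * of_real pi) * rpow \<bar>k\<bar> (- (of_real \<alpha> * s))
              * (cos_mellin (of_real \<alpha> * s) * cos_mellin (1 - of_real \<alpha> * s))"
        unfolding \<phi>_def w_def s_def[symmetric] mb_density_eq[OF nz] P_def[symmetric]
            by (simp add: mult_ac)
      also have "\<dots> = P / (2 * of_real pi) * rpow \<bar>k\<bar> (- (of_real \<alpha> * s))"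
        unfolding cc by (simp add: field_simps)
      finally show ?thesis unfolding P_def s_def .
    qed
    have "2 * (LINT v|lborel. \<phi> v * (rpow \<bar>k\<bar> (w v - 1) * cos_mellin (w v)))
        = (LINT v|lborel. 2 * (\<phi> v * (rpow \<bar>k\<bar> (w v - 1) * cos_mellin (w v))))"
      by (simp only: integral_mult_right_zero)
    also have "\<dots> = of_real (mittag_leffler \<beta> (- c * \<bar>k\<bar> powr \<alpha>))"
      unfolding eq by (rule mittag_leffler_line[OF c k \<sigma>(1,3)])
    finally show ?thesis .
  qed
  ultimately show ?thesis by (simp add: has_fourier_transform_def)
qed

text \<open>Inverting the power |k|^(- \<alpha> s) produces |x|^(\<alpha> s - 1)
  \<open>cos_mellin\<close> at \<alpha> s, which is how the shape of \<open>mb_density\<close>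
  arises.\<close>

lemma inverse_fourier_mb_solution:
  assumes c: "c > 0" and x: "x \<noteq> 0"
  shows "has_inverse_fourier_transform (\<lambda>k. of_real (mittag_leffler \<beta> (- c * \<bar>k\<bar> powr \<alpha>)))
      x (mb_solution c \<bar>x\<bar>)"
proof -
  define \<sigma> where "\<sigma> = strip_width / 2"
  have \<sigma>: "0 < \<sigma>" "\<sigma> < strip_width" "\<sigma> < 1" "\<alpha> * \<sigma> < 1" "0 < \<alpha> * \<sigma>"
    using strip_width_pos strip_width_le \<alpha> by (auto simp: \<sigma>_def)
  define \<phi> where "\<phi> = (\<lambda>v. gamma_pair (Complex \<sigma> v) / Complex \<sigma> v * rGamma (1 - of_real \<beta> * Complex
      \<sigma> v) * rpow c (- Complex \<sigma> v) / (2 * of_real pi))"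
  define w where "w = (\<lambda>v. of_real \<alpha> * Complex \<sigma> v)"
  have w [measurable]: "w \<in> borel_measurable borel" unfolding w_def by measurable
  have "(\<lambda>v. gamma_pair (Complex \<sigma> v) / Complex \<sigma> v * rGamma (1 - of_real \<beta> * Complex \<sigma> v))
      \<in> borel_measurable borel"
    using mittag_leffler_Mellin_Barnes(1)[OF \<beta> zero_less_one zero_less_one \<sigma>(1,3)]
        by (auto dest: borel_measurable_integrable)
  hence \<phi> [measurable]: "\<phi> \<in> borel_measurable borel"
    unfolding \<phi>_def by measurable
  obtain C where C: "C \<ge> 0" "\<And>s. \<sigma> \<le> Re s \<Longrightarrow> Re s \<le> \<sigma>
      \<Longrightarrow> norm (gamma_pair s * rGamma (1 - of_real \<beta> * s)) \<le> C * exp (- 1 * \<bar>Im s\<bar>)"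
    using gamma_pair_rGamma_bound[OF \<beta>, of \<sigma> \<sigma>] \<sigma> by auto
  have \<phi>b: "norm (\<phi> v) \<le> (C / \<sigma> * c powr (- \<sigma>) / (2 * pi)) * exp (- 1 * \<bar>v\<bar>)" for v
  proof -
    have "\<sigma> \<le> norm (Complex \<sigma> v)" using abs_Re_le_cmod[of "Complex \<sigma> v"] by simp
    moreover have "norm (gamma_pair (Complex \<sigma> v) * rGamma (1 - of_real \<beta> * Complex \<sigma> v))
        \<le> C * exp (- 1 * \<bar>v\<bar>)"
      using C(2)[of "Complex \<sigma> v"] by simp
    ultimately have "norm (gamma_pair (Complex \<sigma> v) * rGamma (1 - of_real \<beta> * Complex \<sigma> v))
        / norm (Complex \<sigma> v) \<le> C * exp (- 1 * \<bar>v\<bar>) / \<sigma>"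
      using \<sigma> C(1) by (intro frac_le) auto
    hence "norm (gamma_pair (Complex \<sigma> v) * rGamma (1 - of_real \<beta> * Complex \<sigma> v))
        / norm (Complex \<sigma> v) * (c powr (- \<sigma>) / (2 * pi)) \<le> C * exp (- 1 * \<bar>v\<bar>) / \<sigma>
        * (c powr (- \<sigma>) / (2 * pi))"
      by (intro mult_right_mono) auto
    thus ?thesis using c by (simp add: \<phi>_def norm_mult norm_divide norm_rpow mult_ac)
  qed
  have wb: "norm (w v) \<le> \<alpha> * \<sigma> + \<alpha> * \<bar>v\<bar>" for v
    using norm_affine_line[of 0 \<sigma> v] \<sigma> by (simp add: w_def)
  have int: "integrable lborel (\<lambda>v. (1 + norm (w v)) * norm (\<phi> v))"
    using \<sigma> \<alpha> by (intro integrable_weighted_exp_bound[OF \<phi> w \<phi>b wb]) auto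
  have Re: "Re (w v) = \<alpha> * \<sigma>" for v by (simp add: w_def)
  have "((\<lambda>k. (LINT v|lborel. \<phi> v * rpow \<bar>k\<bar> (- w v)) * exp (\<i> * of_real (- x * k))) has_integral
           2 * (LINT v|lborel. \<phi> v * (rpow \<bar>- x\<bar> (w v - 1) * cos_mellin (w v)))) UNIV"
    by (rule fourier_LINT_rpow[OF \<phi> w int Re]) (use \<sigma> x in auto)
  from has_integral_mult_right[OF this, of "1 / (2 * of_real pi)"]
  have 1: "((\<lambda>k. 1 / (2 * of_real pi) * ((LINT v|lborel. \<phi> v * rpow \<bar>k\<bar> (- w v))
      * exp (\<i> * of_real (- x * k)))) has_integral
           1 / (2 * of_real pi) * (2
               * (LINT v|lborel. \<phi> v * (rpow \<bar>x\<bar> (w v - 1) * cos_mellin (w v))))) UNIV"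
    by simp
  have 2: "1 / (2 * of_real pi)
      * (2 * (LINT v|lborel. \<phi> v * (rpow \<bar>x\<bar> (w v - 1) * cos_mellin (w v)))) = mb_solution c \<bar>x\<bar>"
  proof -
    have "1 / of_real pi * (\<phi> v * (rpow \<bar>x\<bar> (w v - 1) * cos_mellin (w v)))
        = mb_density \<alpha> \<beta> c (Complex \<sigma> v) / (2 * of_real pi) * rpow \<bar>x\<bar>
        (- (1 - of_real \<alpha> * Complex \<sigma> v))" for v
    proof -
      have "Complex \<sigma> v \<noteq> 0" using \<sigma> by (auto simp: complex_eq_iff)
      from mb_density_eq[OF this] show ?thesis by (simp add: \<phi>_def w_def mult_ac)
    qed
    hence "1 / of_real pi * (LINT v|lborel. \<phi> v * (rpow \<bar>x\<bar> (w v - 1) * cos_mellin (w v)))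
        = mb_solution c \<bar>x\<bar>"
      unfolding mb_solution_def mb_solution_line_def \<sigma>_def[symmetric]
          by (simp only: integral_mult_right_zero[symmetric])
    thus ?thesis by simp
  qed
  have 3: "(LINT v|lborel. \<phi> v * rpow \<bar>k\<bar> (- w v)) = of_real (mittag_leffler \<beta> (- c * \<bar>k\<bar> powr \<alpha>))"
      if "k \<noteq> 0" for k
    unfolding \<phi>_def w_def by (rule mittag_leffler_line[OF c that \<sigma>(1,3)])
  show ?thesis
    unfolding has_inverse_fourier_transform_def
    \<comment> \<open>At k = 0 the powers have their junk value 1, so the line integral represents
      the Mittag-Leffler function only for other k.\<close>
    by (rule has_integral_spike_finite[OF _ _ 1[unfolded 2], of "{0}"]) (auto simp: 3 mult_ac)
qed

text \<open>Without oscillation the mass of [0, T] is a line integral of T^(\<alpha> s) / (\<alpha>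
  s) against the density. Beyond the pole the power is T^(- \<alpha> \<sigma>), so only the residue
  1/2 survives; the two half lines add up to 1.\<close>

lemma fourier_mb_solution_0:
  assumes c: "c > 0"
  shows "has_fourier_transform (\<lambda>x. mb_solution c \<bar>x\<bar>) 0 1"
proof -
  define \<sigma> where "\<sigma> = strip_width / 2"
  have \<sigma>: "0 < \<sigma>" "\<sigma> < strip_width" "\<sigma> < 1" "\<alpha> * \<sigma> < 1" "0 < \<alpha> * \<sigma>"
    using strip_width_pos strip_width_le \<alpha> by (auto simp: \<sigma>_def)
  have half: "- (1/2) \<le> - \<sigma>" "- (1/2) \<le> \<alpha> * - \<sigma>"
    using strip_width_le by (auto simp: \<sigma>_def)
  define \<phi> where "\<phi> = (\<lambda>v. mb_density \<alpha> \<beta> c (Complex \<sigma> v) / (2 * of_real pi))"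
  define w where "w = (\<lambda>v. 1 - of_real \<alpha> * Complex \<sigma> v)"
  have w [measurable]: "w \<in> borel_measurable borel" unfolding w_def by measurable
  have \<phi> [measurable]: "\<phi> \<in> borel_measurable borel"
    unfolding \<phi>_def using mb_density_line(1)[OF \<sigma>(1,2)] by measurable
  obtain C where C: "C \<ge> 0" "\<And>v. norm (mb_density \<alpha> \<beta> c (Complex \<sigma> v)) \<le> C * exp (- 1 * \<bar>v\<bar>)"
    using mb_density_line(2)[OF \<sigma>(1,2)] by blast
  have \<phi>i: "integrable lborel \<phi>"
    by (rule integrable_exp_bound[OF \<phi>, of 1 "C / (2 * pi)"])
       (use C(2) in \<open>auto simp: \<phi>_def norm_divide norm_mult divide_right_mono\<close>)
  have Re: "Re (w v) = 1 - \<alpha> * \<sigma>" for v by (simp add: w_def)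
  define I where "I = (\<lambda>T. LINT v|lborel. \<phi> v * truncated_fourier 0 (w v) T)"
  have hI: "((\<lambda>x. mb_solution c \<bar>x\<bar>) has_integral I T) {0..T}" if "T \<ge> 0" for T
  proof -
    have "((\<lambda>x. (LINT v|lborel. \<phi> v * rpow x (- w v)) * exp (\<i> * of_real (0 * x))) has_integral I T)
        {0..T}"
      unfolding I_def by (rule has_integral_LINT_rpow_cis[OF \<phi>i w Re _ that]) (use \<sigma> in auto)
    thus ?thesis
      by (rule has_integral_eq[rotated]) (simp add: mb_solution_def mb_solution_line_def \<phi>_def w_def
          \<sigma>_def)
  qed
  obtain D where D: "D \<ge> 0" "\<And>s. - \<sigma> \<le> Re s \<Longrightarrow> Re s \<le> \<sigma> \<Longrightarrow> norm (mb_density \<alpha> \<beta> c s)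
      \<le> D * exp (- 1 * \<bar>Im s\<bar>)"
    using mb_density_bound[OF half \<sigma>(2), of c] by blast
  define J where "J = (LINT v|lborel. D / (2 * pi * \<alpha>) / \<sigma> * exp (- 1 * \<bar>v\<bar>))"
  have IT: "norm (I T - 1/2) \<le> T powr (- (\<alpha> * \<sigma>)) * J" if T: "T \<ge> 1" for T
  proof -
    define f where "f = (\<lambda>s. mb_density \<alpha> \<beta> c s / (2 * of_real pi * of_real \<alpha>) * rpow
        T (of_real \<alpha> * s))"
    have fh: "f holomorphic_on {s. - strip_width < Re s \<and> Re s < strip_width}"
      unfolding f_def rpow_def using \<alpha> by (intro holomorphic_intros holomorphic_mb_density) auto
    have fb': "norm (f s) \<le> D / (2 * pi * \<alpha>) * T powr (\<alpha> * Re s) * exp (- 1 * \<bar>Im s\<bar>)"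
        if s: "- \<sigma> \<le> Re s" "Re s \<le> \<sigma>" for s
    proof -
      have "norm (f s) = norm (mb_density \<alpha> \<beta> c s) / (2 * pi * \<alpha>) * T powr (\<alpha> * Re s)"
        using T \<alpha> by (simp add: f_def norm_mult norm_divide norm_rpow)
      also have "\<dots> \<le> D * exp (- 1 * \<bar>Im s\<bar>) / (2 * pi * \<alpha>) * T powr (\<alpha> * Re s)"
        using D(2)[OF s] \<alpha> by (intro mult_right_mono divide_right_mono) auto
      finally show ?thesis by (simp add: mult_ac)
    qed
    have fb: "norm (f s) \<le> (D / (2 * pi * \<alpha>) * T powr (\<alpha> * \<sigma>)) * exp (- 1 * \<bar>Im s\<bar>)"
        if s: "- \<sigma> \<le> Re s" "Re s \<le> \<sigma>" for s
    proof -
      have "T powr (\<alpha> * Re s) \<le> T powr (\<alpha> * \<sigma>)" using T s \<alpha> by (intro powr_mono) auto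
      hence "D / (2 * pi * \<alpha>) * T powr (\<alpha> * Re s) * exp (- 1 * \<bar>Im s\<bar>) \<le> D / (2 * pi * \<alpha>) * T
          powr (\<alpha> * \<sigma>) * exp (- 1 * \<bar>Im s\<bar>)"
        using D(1) \<alpha> by (intro mult_right_mono mult_left_mono) auto
      with fb'[OF s] show ?thesis by linarith
    qed
    \<comment> \<open>The value \<alpha> / 2 of the density at 0, divided by 2 pi \<alpha>;
      multiplied by 2 pi it is the residue contribution 1/2.\<close>
    have f0: "f 0 = 1 / (4 * of_real pi)"
      using \<alpha> by (simp add: f_def mb_density_0)
    have "(LINT v|lborel. f (Complex \<sigma> v) / (Complex \<sigma> v - 0))
        - (LINT v|lborel. f (Complex (- \<sigma>) v) / (Complex (- \<sigma>) v - 0)) = 2 * of_real pi * f 0"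
      by (rule strip_line_difference(3)[OF fh _ _ _ _ _ fb]) (use \<sigma> in auto)
    moreover have "(LINT v|lborel. f (Complex \<sigma> v) / (Complex \<sigma> v - 0)) = I T"
    proof -
      \<comment> \<open>The exponent is w = 1 - \<alpha> s, so the denominator 1 - w in
        \<open>truncated_fourier_0\<close> is \<alpha> s and accounts for the simple pole.\<close>
      have "f (Complex \<sigma> v) / (Complex \<sigma> v - 0) = \<phi> v * truncated_fourier 0 (w v) T" for v
        using truncated_fourier_0[of "w v" T] T \<sigma> by (simp add: Re)
            (simp add: f_def \<phi>_def w_def mult_ac)
      thus ?thesis by (simp add: I_def)
    qed
    ultimately have "I T - (LINT v|lborel. f (Complex (- \<sigma>) v) / Complex (- \<sigma>) v) = 1/2"
      by (simp add: f0)
    moreover have "p - q = r \<Longrightarrow> p - r = q" for p q r :: complex by auto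
    ultimately have eq: "I T - 1/2 = (LINT v|lborel. f (Complex (- \<sigma>) v) / Complex (- \<sigma>) v)"
      by blast
    have "norm (LINT v|lborel. f (Complex (- \<sigma>) v) / Complex (- \<sigma>) v)
        \<le> (LINT v|lborel. T powr (- (\<alpha> * \<sigma>)) * (D / (2 * pi * \<alpha>) / \<sigma> * exp (- 1 * \<bar>v\<bar>)))"
    proof (rule Bochner_Integration.integral_norm_bound_integral)
      show "integrable lborel (\<lambda>v. f (Complex (- \<sigma>) v) / Complex (- \<sigma>) v)"
        using strip_line_difference(1)[where p = 0 and a = "- \<sigma>" and b = \<sigma>, OF fh _ _ _ _ _ fb] \<sigma>
            by simp
      show "integrable lborel (\<lambda>v. T powr (- (\<alpha> * \<sigma>)) * (D / (2 * pi * \<alpha>) / \<sigma> * exp (- 1 * \<bar>v\<bar>)))"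
        by (intro integrable_mult_right integrable_exp_abs) auto
      fix v :: real
      have "\<sigma> \<le> norm (Complex (- \<sigma>) v)" using abs_Re_le_cmod[of "Complex (- \<sigma>) v"] by simp
      moreover have "norm (f (Complex (- \<sigma>) v)) \<le> D / (2 * pi * \<alpha>) * T powr (\<alpha> * - \<sigma>)
          * exp (- 1 * \<bar>v\<bar>)"
        using fb'[of "Complex (- \<sigma>) v"] \<sigma> by simp
      ultimately have "norm (f (Complex (- \<sigma>) v)) / norm (Complex (- \<sigma>) v) \<le> D / (2 * pi * \<alpha>) * T
          powr (\<alpha> * - \<sigma>) * exp (- 1 * \<bar>v\<bar>) / \<sigma>"
        using \<sigma> D \<alpha> by (intro frac_le mult_nonneg_nonneg) auto
      thus "norm (f (Complex (- \<sigma>) v) / Complex (- \<sigma>) v) \<le> T powr (- (\<alpha> * \<sigma>))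
          * (D / (2 * pi * \<alpha>) / \<sigma> * exp (- 1 * \<bar>v\<bar>))"
        by (simp add: norm_divide mult_ac)
    qed
    also have "\<dots> = T powr (- (\<alpha> * \<sigma>)) * J"
      unfolding J_def by (rule integral_mult_right_zero)
    finally show ?thesis unfolding eq .
  qed
  have "((\<lambda>T. I T - 1/2) \<longlongrightarrow> 0) at_top"
  proof (rule Lim_null_comparison)
    show "\<forall>\<^sub>F T in at_top. norm (I T - 1/2) \<le> T powr (- (\<alpha> * \<sigma>)) * J"
      using eventually_ge_at_top[of 1] by eventually_elim (rule IT)
    have "((\<lambda>T. T powr (- (\<alpha> * \<sigma>))) \<longlongrightarrow> 0) at_top"
      using \<sigma> by (intro tendsto_neg_powr filterlim_ident) auto
    from tendsto_mult_left_zero[OF this] show "((\<lambda>T. T powr (- (\<alpha> * \<sigma>)) * J) \<longlongrightarrow> 0) at_top" .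
  qed
  hence "((\<lambda>T. I T) \<longlongrightarrow> 1/2) at_top" by (simp add: LIM_zero_iff)
  moreover have "\<forall>\<^sub>F T in at_top. I T = integral {0..T} (\<lambda>x. mb_solution c \<bar>x\<bar>)"
    using eventually_ge_at_top[of 0] by eventually_elim (rule integral_unique[OF hI, symmetric])
  ultimately have "((\<lambda>T. integral {0..T} (\<lambda>x. mb_solution c \<bar>x\<bar>)) \<longlongrightarrow> 1/2) at_top"
    by (rule Lim_transform_eventually)
  hence "((\<lambda>x. mb_solution c \<bar>x\<bar>) has_integral 1/2 + 1/2) UNIV"
    using hI by (intro has_integral_UNIV_improper) (auto simp: has_integral_iff)
  thus ?thesis by (simp add: has_fourier_transform_def)
qed

section \<open>Identification with the H-function\<close>

text \<open>The sine of pi w / 2 is rewritten by reflection at w / 2. These two reciprocal Gamma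
  factors are the parameter pairs (1, 1/2) of the H-function.\<close>

lemma cos_mellin_eq_Gamma:
  assumes "Re w < 1" "0 < Re w"
  shows "cos_mellin w / of_real pi = Gamma (1 - w) / (Gamma (w / 2) * Gamma (1 - w / 2))"
proof -
  define z where "z = of_real pi * w / 2"
  have G: "rGamma (1 - w) * Gamma (1 - w) = 1"
  proof -
    have "1 - w \<notin> \<int>\<^sub>\<le>\<^sub>0"
    proof
      assume "1 - w \<in> \<int>\<^sub>\<le>\<^sub>0"
      then obtain n :: int where n: "1 - w = of_int n" "n \<le> 0" by (elim nonpos_Ints_cases)
      from arg_cong[OF n(1), of Re] n(2) assms(1) show False by simp
    qed
    thus ?thesis using Gamma_eq_zero_iff[of "1 - w"] by (simp add: rGamma_inverse_Gamma)
  qed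
  have "rGamma w * rGamma (1 - w) = sin (of_real pi * w) / of_real pi"
    by (rule rGamma_reflection_complex)
  also have "sin (of_real pi * w) = 2 * sin z * cos z"
    using sin_double[of z] by (simp add: z_def)
  finally have "rGamma w * (rGamma (1 - w) * Gamma (1 - w)) = 2 * sin z * cos z / of_real pi
      * Gamma (1 - w)"
    by (simp only: mult.assoc[symmetric])
  hence r: "rGamma w = 2 * sin z * cos z / of_real pi * Gamma (1 - w)" using G by simp
  have "Re z > 0" "Re z < pi / 2" using assms by (auto simp: z_def)
  hence nz: "cos z \<noteq> 0"
    using norm_cos_ge[of z] cos_gt_zero[of "Re z"] by (auto simp: mult_le_0_iff)
  have "cos_mellin w / of_real pi = rGamma w / (2 * cos z)"
    by (simp add: cos_mellin_def z_def)
  also have "\<dots> = Gamma (1 - w) * (sin (of_real pi * (w / 2)) / of_real pi)"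
    unfolding r using nz by (simp add: z_def)
  also have "sin (of_real pi * (w / 2)) / of_real pi = rGamma (w / 2) * rGamma (1 - w / 2)"
    by (rule rGamma_reflection_complex[symmetric])
  finally show ?thesis
    unfolding rGamma_inverse_Gamma by (simp only: divide_inverse inverse_mult_distrib)
qed

text \<open>With \<xi> = - \<alpha> s the numerator becomes Gamma (1 - \<alpha> s) Gamma (1 - s)
  Gamma s, and the denominator Gamma (\<alpha> s / 2) Gamma (1 - \<beta> s) Gamma (1 - \<alpha> s /
  2). The factor \<open>rpow c s\<close> removes c^(- s) from the density, since c enters the
  H-function through its argument.\<close>

lemma fox_H_kernel_mb_density:
  assumes s: "0 < Re s" "Re s < strip_width"
  shows "fox_H_kernel 2 1 [(1, 1 / \<alpha>), (1, \<beta> / \<alpha>), (1, 1 / 2)] [(1, 1), (1, 1 / \<alpha>), (1, 1 / 2)]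
      (- (of_real \<alpha> * s))
      = mb_density \<alpha> \<beta> c s * rpow c s"
proof -
  have b: "Re s < 1" "\<alpha> * Re s < 1" "0 < \<alpha> * Re s"
    using abs_less_strip_width[of "Re s"] s \<alpha> by auto
  have nz: "s \<noteq> 0" using s by auto
  define w where "w = of_real \<alpha> * s"
  have 1: "fox_H_kernel 2 1 [(1, 1 / \<alpha>), (1, \<beta> / \<alpha>), (1, 1 / 2)] [(1, 1), (1, 1 / \<alpha>), (1, 1 / 2)]
      (- w)
    = Gamma (1 - w) * Gamma (1 - s) * Gamma s
        / (Gamma (w / 2) * (Gamma (1 - of_real \<beta> * s) * Gamma (1 - w / 2)))"
    using \<alpha> by (simp add: fox_H_kernel_def w_def numeral_2_eq_2 numeral_3_eq_3 lessThan_Suc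
        atLeastLessThanSuc mult_ac)
  have "s \<notin> \<int>\<^sub>\<le>\<^sub>0" using s by (auto elim!: nonpos_Ints_cases)
  hence gp: "gamma_pair s / s = Gamma s * Gamma (1 - s)"
    using Gamma_plus1[of s] nz by (simp add: gamma_pair_def add.commute)
  have "mb_density \<alpha> \<beta> c s * rpow c s = (gamma_pair s / s) * rGamma (1 - of_real \<beta> * s)
      * (cos_mellin w / of_real pi)"
    by (simp add: mb_density_eq[OF nz] rpow_minus w_def)
  also have "cos_mellin w / of_real pi = Gamma (1 - w) / (Gamma (w / 2) * Gamma (1 - w / 2))"
    by (rule cos_mellin_eq_Gamma) (use b in \<open>auto simp: w_def\<close>)
  finally show ?thesis
    unfolding w_def[symmetric] 1 gp rGamma_inverse_Gamma
    by (simp only: divide_inverse inverse_mult_distrib mult_ac)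
qed

text \<open>A separating line exists, so the first case of \<open>fox_H\<close> applies. Every such
  line is the image of a line in the common strip, and independence of the line makes the
  description by \<open>THE\<close> definite.\<close>

lemma fox_H_mb_solution:
  assumes c: "c > 0" and x: "x > 0"
  shows "fox_H 2 1 [(1, 1 / \<alpha>), (1, \<beta> / \<alpha>), (1, 1 / 2)] [(1, 1), (1, 1 / \<alpha>), (1, 1 / 2)]
      (of_real (x / c powr (1 / \<alpha>)))
      = of_real (\<alpha> * x) * mb_solution c x"
proof -
  define as :: "(complex \<times> real) list" where "as = [(1, 1 / \<alpha>), (1, \<beta> / \<alpha>), (1, 1 / 2)]"
  define bs :: "(complex \<times> real) list" where "bs = [(1, 1), (1, 1 / \<alpha>), (1, 1 / 2)]"
  define z where "z = x / c powr (1 / \<alpha>)"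
  have z: "z > 0" using x c by (simp add: z_def)
  have line: "((\<lambda>y. 1 / (2 * of_real pi * \<i>) * (fox_H_kernel 2 1 as bs (Complex (- (\<alpha> * \<sigma>)) y)
      * of_real z powr (- Complex (- (\<alpha> * \<sigma>)) y) * \<i>))
      has_integral of_real (\<alpha> * x) * mb_solution c x) UNIV" if \<sigma>: "0 < \<sigma>" "\<sigma> < strip_width" for \<sigma>
  proof -
    define g where "g = (\<lambda>v. of_real x * (mb_density \<alpha> \<beta> c (Complex \<sigma> v) / (2 * of_real pi) * rpow
        x (- (1 - of_real \<alpha> * Complex \<sigma> v))))"
    obtain C where C: "C \<ge> 0" "\<And>v. norm (mb_density \<alpha> \<beta> c (Complex \<sigma> v)) \<le> C * exp (- 1 * \<bar>v\<bar>)"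
      using mb_density_line(2)[OF \<sigma>] by blast
    have [measurable]: "(\<lambda>v. mb_density \<alpha> \<beta> c (Complex \<sigma> v)) \<in> borel_measurable borel"
      by (rule mb_density_line(1)[OF \<sigma>])
    have g: "integrable lborel g"
    proof (rule integrable_exp_bound)
      show "g \<in> borel_measurable borel" unfolding g_def by measurable
      fix v
      have "norm (g v) = x * x powr (- (1 - \<alpha> * \<sigma>)) / (2 * pi)
          * norm (mb_density \<alpha> \<beta> c (Complex \<sigma> v))"
        using x by (simp add: g_def norm_mult norm_divide norm_rpow)
      also have "\<dots> \<le> x * x powr (- (1 - \<alpha> * \<sigma>)) / (2 * pi) * (C * exp (- 1 * \<bar>v\<bar>))"
        using x C by (intro mult_left_mono) auto
      finally show "norm (g v) \<le> (x * x powr (- (1 - \<alpha> * \<sigma>)) / (2 * pi) * C) * exp (- 1 * \<bar>v\<bar>)"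
          by simp
    qed simp
    have gint: "(LINT v|lborel. g v) = of_real x * mb_solution c x"
      unfolding g_def mb_solution_eq[OF \<sigma>] mb_solution_line_def by (rule integral_mult_right_zero)
    have eq: "1 / (2 * of_real pi * \<i>) * (fox_H_kernel 2 1 as bs (Complex (- (\<alpha> * \<sigma>)) y) * of_real z
        powr (- Complex (- (\<alpha> * \<sigma>)) y) * \<i>)
      = g (0 + (- 1 / \<alpha>) * y)" for y
    proof -
      \<comment> \<open>The substitution \<xi> = - \<alpha> s reverses the orientation of the line;
        the Lebesgue integral registers only the absolute scaling factor 1 / \<alpha>.\<close>
      define s where "s = Complex \<sigma> (- 1 / \<alpha> * y)"
      have xi: "Complex (- (\<alpha> * \<sigma>)) y = - (of_real \<alpha> * s)"
        using \<alpha> by (simp add: s_def complex_eq_iff)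
      have k: "fox_H_kernel 2 1 as bs (- (of_real \<alpha> * s)) = mb_density \<alpha> \<beta> c s * rpow c s"
        unfolding as_def bs_def by (rule fox_H_kernel_mb_density) (use \<sigma> in \<open>auto simp: s_def\<close>)
      have "rpow x (of_real \<alpha> * s) = rpow (z * c powr (1 / \<alpha>)) (of_real \<alpha> * s)"
        using c by (simp add: z_def)
      also have "\<dots> = rpow z (of_real \<alpha> * s) * rpow c s"
        using z c \<alpha> by (simp add: rpow_mult rpow_powr)
      finally have zp: "rpow c s * rpow z (of_real \<alpha> * s) = rpow x (of_real \<alpha> * s)"
          by (simp add: mult.commute)
      have xp: "rpow x (of_real \<alpha> * s) = of_real x * rpow x (- (1 - of_real \<alpha> * s))"
        using rpow_add[of x 1 "- (1 - of_real \<alpha> * s)"] rpow_of_real[of x 1] x by simp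
      have "1 / (2 * of_real pi * \<i>) * (mb_density \<alpha> \<beta> c s * rpow c s * rpow z (of_real \<alpha> * s) * \<i>)
         = mb_density \<alpha> \<beta> c s / (2 * of_real pi) * (rpow c s * rpow z (of_real \<alpha> * s))"
        by (simp add: field_simps)
      also have "\<dots> = g (0 + (- 1 / \<alpha>) * y)"
        unfolding zp xp by (simp add: g_def s_def)
      finally show ?thesis
        unfolding xi k using powr_eq_rpow[OF z] by simp
    qed
    have \<alpha>': "- 1 / \<alpha> \<noteq> 0" using \<alpha> by simp
    have "(LINT v|lborel. g v) = \<bar>- 1 / \<alpha>\<bar> *\<^sub>R (LINT y|lborel. g (0 + (- 1 / \<alpha>) * y))"
      by (rule lborel_integral_real_affine[OF \<alpha>'])
    hence "(LINT y|lborel. g (0 + (- 1 / \<alpha>) * y)) = of_real (\<alpha> * x) * mb_solution c x"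
      using \<alpha> by (simp add: gint scaleR_conv_of_real field_simps)
    with has_integral_integral_lborel[OF lborel_integrable_real_affine[OF g \<alpha>', of 0]]
    show ?thesis unfolding eq by simp
  qed
  have unique: "w = of_real (\<alpha> * x) * mb_solution c x"
      if on: "fox_H_on_line 2 1 as bs (of_real z) w" for w
  proof -
    from on obtain \<gamma> where L: "\<And>\<xi>. \<xi> \<in> fox_H_left_poles 2 bs \<Longrightarrow> Re \<xi> < \<gamma>" and R:
        "\<And>\<xi>. \<xi> \<in> fox_H_right_poles 1 as \<Longrightarrow> \<gamma> < Re \<xi>"
      and int: "((\<lambda>y. 1 / (2 * of_real pi * \<i>) * (fox_H_kernel 2 1 as bs (Complex \<gamma> y) * of_real z
          powr (- Complex \<gamma> y) * \<i>)) has_integral w) UNIV"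
      unfolding fox_H_on_line_def by blast
    \<comment> \<open>The poles nearest to a separating line are -1 and - \<alpha> on the left and 0
      on the right. They confine it to - min 1 \<alpha> < \<gamma> < 0, which is the common strip
      multiplied by - \<alpha>.\<close>
    have "- 1 \<in> fox_H_left_poles 2 bs"
      unfolding fox_H_left_poles_def bs_def by (auto intro!: exI[of _ 0])
    from L[OF this] have 1: "- 1 < \<gamma>" by simp
    have "- of_real \<alpha> \<in> fox_H_left_poles 2 bs"
      unfolding fox_H_left_poles_def bs_def using \<alpha> by (auto intro!: exI[of _ 1])
    from L[OF this] have 2: "- \<alpha> < \<gamma>" by simp
    have "0 \<in> fox_H_right_poles 1 as"
      unfolding fox_H_right_poles_def as_def by auto
    from R[OF this] have 3: "\<gamma> < 0" by simp
    define \<sigma> where "\<sigma> = - \<gamma> / \<alpha>"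
    have \<sigma>: "0 < \<sigma>" "\<sigma> < strip_width" "\<gamma> = - (\<alpha> * \<sigma>)"
      using 1 2 3 \<alpha> by (auto simp: \<sigma>_def strip_width_def field_simps)
    show ?thesis using has_integral_unique[OF int[unfolded \<sigma>(3)] line[OF \<sigma>(1,2)]] .
  qed
  have ex: "fox_H_on_line 2 1 as bs (of_real z) (of_real (\<alpha> * x) * mb_solution c x)"
  proof -
    define \<sigma> where "\<sigma> = strip_width / 2"
    have \<sigma>: "0 < \<sigma>" "\<sigma> < strip_width" using strip_width_pos by (auto simp: \<sigma>_def)
    have b: "\<sigma> < 1" "\<alpha> * \<sigma> < 1" "0 < \<alpha> * \<sigma>"
      using abs_less_strip_width[of \<sigma>] \<sigma> \<alpha> by auto
    have L: "Re \<xi> < - (\<alpha> * \<sigma>)" if "\<xi> \<in> fox_H_left_poles 2 bs" for \<xi>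
    proof -
      from that consider "1 + \<xi> \<in> \<int>\<^sub>\<le>\<^sub>0" | "1 + of_real (1 / \<alpha>) * \<xi> \<in> \<int>\<^sub>\<le>\<^sub>0"
        by (auto simp: fox_H_left_poles_def bs_def less_2_cases_iff)
      thus ?thesis
      proof cases
        case 1
        then obtain n :: int where n: "1 + \<xi> = of_int n" "n \<le> 0" by (elim nonpos_Ints_cases)
        from arg_cong[OF n(1), of Re] n(2) b(2) show ?thesis by simp
      next
        case 2
        then obtain n :: int where n: "1 + of_real (1 / \<alpha>) * \<xi> = of_int n" "n \<le> 0"
            by (elim nonpos_Ints_cases)
        from arg_cong[OF n(1), of Re] have "1 + Re \<xi> / \<alpha> = of_int n" by simp
        hence "Re \<xi> / \<alpha> \<le> - 1" using n(2) by simp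
        hence "Re \<xi> \<le> - \<alpha>" using \<alpha> by (simp add: field_simps)
        moreover have "\<alpha> * \<sigma> < \<alpha> * 1" using b(1) \<alpha> by (intro mult_strict_left_mono) auto
        ultimately show ?thesis by simp
      qed
    qed
    have R: "- (\<alpha> * \<sigma>) < Re \<xi>" if "\<xi> \<in> fox_H_right_poles 1 as" for \<xi>
    proof -
      from that have "- (of_real (1 / \<alpha>) * \<xi>) \<in> \<int>\<^sub>\<le>\<^sub>0"
        by (auto simp: fox_H_right_poles_def as_def)
      then obtain n :: int where n: "- (of_real (1 / \<alpha>) * \<xi>) = of_int n" "n \<le> 0"
          by (elim nonpos_Ints_cases)
      from arg_cong[OF n(1), of Re] have "- (Re \<xi> / \<alpha>) = of_int n" by simp
      hence "Re \<xi> / \<alpha> \<ge> 0" using n(2) by simp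
      hence "Re \<xi> \<ge> 0" using \<alpha> by (simp add: zero_le_divide_iff)
      thus ?thesis using b(3) by linarith
    qed
    show ?thesis
      unfolding fox_H_on_line_def
      by (intro exI[of _ "- (\<alpha> * \<sigma>)"] conjI ballI L R line \<sigma>)
  qed
  have "fox_H 2 1 as bs (of_real z) = of_real (\<alpha> * x) * mb_solution c x"
  proof -
    have "(THE w. fox_H_on_line 2 1 as bs (of_real z) w) = of_real (\<alpha> * x) * mb_solution c x"
      by (rule the_equality, rule ex, rule unique)
    thus ?thesis using ex unfolding fox_H_def by auto
  qed
  thus ?thesis by (simp add: as_def bs_def z_def)
qed

end

lemma has_inverse_fourier_transform_unique:
  "has_inverse_fourier_transform H x h \<Longrightarrow> has_inverse_fourier_transform H x h' \<Longrightarrow> h = h'"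
  unfolding has_inverse_fourier_transform_def by (rule has_integral_unique)

theorem corollary1p2:
  fixes \<eta> \<alpha> \<beta> :: real
  assumes "\<eta> > 0" and "\<alpha> > 0" and "0 < \<beta>" and "\<beta> \<le> 1"
  shows "(\<exists>N. transform_solution \<eta> \<alpha> \<beta> N) \<and>
    (\<forall>N. transform_solution \<eta> \<alpha> \<beta> N \<longrightarrow>
      (\<forall>x t. x \<noteq> 0 \<longrightarrow> t > 0 \<longrightarrow>
        N x t = 1 / of_real (\<alpha> * \<bar>x\<bar>) *
          fox_H 2 1
            [(1, 1 / \<alpha>), (1, \<beta> / \<alpha>), (1, 1 / 2)]
            [(1, 1), (1, 1 / \<alpha>), (1, 1 / 2)]
            (of_real (\<bar>x\<bar> / (\<eta> * t powr \<beta>) powr (1 / \<alpha>)))))"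
proof -
  note \<eta> = assms(1) and \<alpha> = assms(2) and \<beta> = assms(3,4)
  define E where "E = (\<lambda>k t. complex_of_real (mittag_leffler \<beta> (- (\<eta> * \<bar>k\<bar> powr \<alpha>) * t powr \<beta>)))"
  define N0 where "N0 = (\<lambda>x t. mb_solution \<alpha> \<beta> (\<eta> * t powr \<beta>) \<bar>x\<bar>)"
  have \<mu>: "\<eta> * \<bar>k\<bar> powr \<alpha> \<ge> 0" for k using \<eta> by simp
  have sym: "\<eta> * space_fractional_symbol \<alpha> k = - (\<eta> * \<bar>k\<bar> powr \<alpha>)" for k
    by (simp add: space_fractional_symbol_def)
  have c: "\<eta> * t powr \<beta> > 0" if "t > 0" for t using \<eta> that by simp
  have E_eq: "E k t = of_real (mittag_leffler \<beta> (- (\<eta> * t powr \<beta>) * \<bar>k\<bar> powr \<alpha>))" for k t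
    by (simp add: E_def mult_ac)
  have fourier: "has_fourier_transform (\<lambda>x. N0 x t) k (E k t)" if "t > 0" for k t
  \<comment> \<open>The oscillation used in the conditional convergence is absent at k = 0, where
    the total mass was computed separately.\<close>
  proof (cases "k = 0")
    case True
    thus ?thesis using fourier_mb_solution_0[OF \<alpha> \<beta> c[OF that]] \<alpha> by (simp add: N0_def E_def)
  next
    case False
    thus ?thesis unfolding N0_def E_eq by (rule fourier_mb_solution[OF \<alpha> \<beta> c[OF that]])
  qed
  have inv: "has_inverse_fourier_transform (\<lambda>k. E k t) x (N0 x t)" if "t > 0" "x \<noteq> 0" for x t
    unfolding N0_def E_eq by (rule inverse_fourier_mb_solution[OF \<alpha> \<beta> c[OF that(1)] that(2)])
  have "transform_solution \<eta> \<alpha> \<beta> N0"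
    unfolding transform_solution_def sym
  proof (intro exI[of _ E] conjI allI impI)
    fix k
    show "continuous_on {0..} (E k)"
      unfolding E_def by (intro continuous_intros continuous_on_relaxation \<beta> \<mu>)
    show "E k 0 = 1" using \<beta> by (simp add: E_def)
    show "caputo_laplace_rule \<beta> (E k)"
      unfolding E_def by (rule caputo_laplace_rule_relaxation[OF \<beta> \<mu>])
    fix t :: real assume "t > 0"
    show "has_caputo_derivative \<beta> (E k) (of_real (- (\<eta> * \<bar>k\<bar> powr \<alpha>)) * E k t) t"
      unfolding E_def by (rule caputo_relaxation[OF \<beta> \<mu> \<open>t > 0\<close>])
  qed (use fourier inv in auto)
  moreover have "N x t = 1 / of_real (\<alpha> * \<bar>x\<bar>) *
          fox_H 2 1 [(1, 1 / \<alpha>), (1, \<beta> / \<alpha>), (1, 1 / 2)] [(1, 1), (1, 1 / \<alpha>), (1, 1 / 2)]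
            (of_real (\<bar>x\<bar> / (\<eta> * t powr \<beta>) powr (1 / \<alpha>)))"
    if N: "transform_solution \<eta> \<alpha> \<beta> N" and x: "x \<noteq> 0" and t: "t > 0" for N x t
  proof -
    obtain Nh where cont: "\<And>k. continuous_on {0..} (Nh k)"
      and eq: "\<And>k t. t > 0 \<Longrightarrow> has_caputo_derivative \<beta> (Nh k) (of_real (- (\<eta> * \<bar>k\<bar> powr \<alpha>)) * Nh k t)
          t"
      and init: "\<And>k. Nh k 0 = 1" and rule: "\<And>k. caputo_laplace_rule \<beta> (Nh k)"
      and N_inv: "\<And>t x. t > 0 \<Longrightarrow> x \<noteq> 0 \<Longrightarrow> has_inverse_fourier_transform (\<lambda>k. Nh k t) x (N x t)"
      using N unfolding transform_solution_def sym by blast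
    \<comment> \<open>For each k the equation is a scalar relaxation equation with rate \<eta>
      |k|^\<alpha>, so every solution has the transform of the candidate, and uniqueness of the
      inversion integral carries over to \<open>N\<close>.\<close>
    have "Nh k t = E k t" for k
      unfolding E_def using relaxation_unique[OF \<beta> \<mu> cont init eq rule] t by simp
    with N_inv[OF t x] have "has_inverse_fourier_transform (\<lambda>k. E k t) x (N x t)" by simp
    hence "N x t = N0 x t"
      by (rule has_inverse_fourier_transform_unique) (rule inv[OF t x])
    thus ?thesis
      using fox_H_mb_solution[OF \<alpha> \<beta> c[OF t], of "\<bar>x\<bar>"] x \<alpha> by (simp add: N0_def)
  qed
  ultimately show ?thesis by blast
qed

end
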